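(* Let $\omega\in S^2$ and $\vartheta\in S(\omega)$. Consider data $(D,\rho,u)$ such that $\omega$ is regular with respect to $D$, $D$ has a conical singularity from direction $\omega$, with $D\cap\{x\in\mathbb R^3: h_D(\omega)-\delta<x\cdot\omega<h_D(\omega)\}=D_{(p(\omega),\omega)}(\delta,Q)$, $F_{\rho,D}$ is active at $p(\omega)$, and $C_{(p(\omega),\omega)}(\delta,Q,\vartheta)\ne0$. Then the point $p(\omega)$ is uniquely determined by the Cauchy data of $u$ on $\partial\Omega$; that is, if $(D_1,\rho_1,u_1)$ and $(D_2,\rho_2,u_2)$ both satisfy these assumptions (with the same $\Omega,k,\omega,\vartheta$) and $u_1=u_2$, $\partial u_1/\partial\nu=\partial u_2/\partial\nu$ on $\partial\Omega$, then the corresponding points $p_1(\omega)$ and $p_2(\omega)$ coincide.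
   Context: Setting. $\Omega\subset\mathbb R^3$ is a bounded domain with $C^2$ boundary and outward unit normal $\nu$; $k\ge 0$. $D$ is a nonempty open set with $\overline D\subset\Omega$, $\rho\in L^2(D)$ is complex-valued, and $F=F_{\rho,D}$ equals $\rho$ on $D$ and $0$ on $\Omega\setminus D$. $u\in H^1(\Omega)$ (complex-valued) is an arbitrary weak solution of $\Delta u+k^2u=F$ in $\Omega$ (no boundary condition is prescribed). The normal derivative $\partial u/\partial\nu\in H^{-1/2}(\partial\Omega)$ is defined weakly by $\langle \partial u/\partial\nu,g|_{\partial\Omega}\rangle=\int_\Omega(\nabla u\cdot\nabla g-k^2ug+Fg)\,dx$ for $g\in H^1(\Omega)$. The Cauchy data of $u$ on $\partial\Omega$ are the pair $(u|_{\partial\Omega},\partial u/\partial\nu)$. $S(\omega)=\{\vartheta\in S^2:\omega\cdot\vartheta=0\}$. $h_D(\omega)=\sup_{x\in D}x\cdot\omega$. $\omega$ is regular with respect to $D$ if $\{x\in\overline D: x\cdot\omega=h_D(\omega)\}$ is a single point, denoted $p(\omega)$. For $p\in\mathbb R^3$, $\omega\in S^2$, $\delta>0$ and a nonempty bounded relatively open subset $Q$ of the plane $x\cdot\omega=p\cdot\omega-\delta$, let $D_{(p,\omega)}(\delta,Q)=\bigcup_{0<s<\delta}\{p+\frac{s}{\delta}(z-p): z\in Q\}$. For $\vartheta\in S(\omega)$, $$C_{(p,\omega)}(\delta,Q,\vartheta)=2s\int_{Q_s}\frac{dS_z}{\{s-i(z-p)\cdot\vartheta\}^3},\qquad Q_s=D_{(p,\omega)}(\delta,Q)\cap\{x: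 x\cdot\omega=p\cdot\omega-s\},$$ which does not depend on $s\in\,]0,\delta[$. If $\omega$ is regular with respect to $D$, $D$ has a conical singularity from direction $\omega$ if there exist $\delta>0$ and a nonempty bounded relatively open subset $Q$ of the plane $x\cdot\omega=h_D(\omega)-\delta$ such that $D\cap\{x: h_D(\omega)-\delta<x\cdot\omega<h_D(\omega)\}=D_{(p(\omega),\omega)}(\delta,Q)$. $F_{\rho,D}$ is active at a point $p\in\partial D$ if there exist an open ball $B_\eta(p)$ centered at $p$ with radius $\eta>0$, $0<\alpha\le1$ and a (complex-valued) $\tilde\rho\in C^{0,\alpha}(\overline{B_\eta(p)})$ such that $\rho=\tilde\rho$ almost everywhere on $B_\eta(p)\cap D$ and $\tilde\rho(p)\ne0$. *)

theory Defs
  imports "HOL-Analysis.Analysis"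
begin

text \<open>
  The surface measure on \<open>\<partial>\<Omega>\<close> is the two-dimensional Hausdorff measure. The factor \<open>\<pi>/4\<close> (the area of
  a disc of diameter 1) makes it agree with the usual surface area. The covering sets must be
  bounded because \<^const>\<open>diameter\<close> is unspecified on unbounded sets.
\<close>

definition hausdorff2_pre :: "real \<Rightarrow> 'a::metric_space set \<Rightarrow> ennreal" where
  "hausdorff2_pre \<epsilon> A =
     (INF C \<in> {C :: nat \<Rightarrow> 'a set. A \<subseteq> (\<Union>i. C i) \<and> (\<forall>i. bounded (C i) \<and> diameter (C i) \<le> \<epsilon>)}.
        \<Sum>i. ennreal (pi / 4 * (diameter (C i))\<^sup>2))"

definition hausdorff2_outer :: "'a::metric_space set \<Rightarrow> ennreal" where
  "hausdorff2_outer A = (SUP \<epsilon> \<in> {0<..}. hausdorff2_pre \<epsilon> A)"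

definition hausdorff2 :: "'a::metric_space measure" where
  "hausdorff2 = measure_of UNIV (sets borel) hausdorff2_outer"

text \<open>
  \<^const>\<open>measure_of\<close> silently returns the zero measure unless the given set function is a measure on
  the given sigma-algebra; the lemmas up to \<open>emeasure_hausdorff2\<close> show that it is one on the Borel
  sets.
\<close>

lemma hausdorff2_pre_mono: "A \<subseteq> B \<Longrightarrow> hausdorff2_pre \<epsilon> A \<le> hausdorff2_pre \<epsilon> B"
  unfolding hausdorff2_pre_def by (rule INF_superset_mono) auto

lemma hausdorff2_pre_antimono: "d \<le> e \<Longrightarrow> hausdorff2_pre e A \<le> hausdorff2_pre d A"
  unfolding hausdorff2_pre_def by (rule INF_superset_mono) (auto intro: order_trans)

lemma hausdorff2_outer_mono: "A \<subseteq> B \<Longrightarrow> hausdorff2_outer A \<le> hausdorff2_outer B"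
  unfolding hausdorff2_outer_def by (intro SUP_mono) (use hausdorff2_pre_mono in blast)

lemma hausdorff2_pre_empty: "0 < \<epsilon> \<Longrightarrow> hausdorff2_pre \<epsilon> {} = 0"
proof -
  assume "0 < \<epsilon>"
  then have "hausdorff2_pre \<epsilon> ({} :: 'a set) \<le> (\<Sum>i::nat. ennreal (pi / 4 * (diameter ({}::'a set))\<^sup>2))"
    unfolding hausdorff2_pre_def by (intro INF_lower2[of "\<lambda>_. {}"]) auto
  then show ?thesis by simp
qed

lemma hausdorff2_outer_empty: "hausdorff2_outer {} = 0"
  unfolding hausdorff2_outer_def by (auto simp: hausdorff2_pre_empty intro!: SUP_eq_const)

lemma hausdorff2_pre_subadd:
  "hausdorff2_pre \<epsilon> (\<Union>n. A n) \<le> (\<Sum>n. hausdorff2_pre \<epsilon> (A n))"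
proof (rule ennreal_le_epsilon)
  fix e :: real
  assume fin: "(\<Sum>n. hausdorff2_pre \<epsilon> (A n)) < top" and e: "0 < e"
  let ?S = "\<lambda>C :: nat \<Rightarrow> 'a set. \<Sum>i. ennreal (pi / 4 * (diameter (C i))\<^sup>2)"
  have "\<exists>C. A n \<subseteq> (\<Union>i. C i) \<and> (\<forall>i. bounded (C i) \<and> diameter (C i) \<le> \<epsilon>) \<and>
      ?S C \<le> hausdorff2_pre \<epsilon> (A n) + ennreal (e * (1/2)^Suc n)" for n
  proof -
    have "0 < e * (1/2)^Suc n" using e by simp
    then have lt: "hausdorff2_pre \<epsilon> (A n) < hausdorff2_pre \<epsilon> (A n) + ennreal (e * (1/2)^Suc n)"
      using ennreal_suminf_lessD[OF fin, of n] ennreal_add_left_cancel_less[of "hausdorff2_pre \<epsilon> (A n)" 0]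
      by (simp add: less_top del: power_Suc)
    then show ?thesis
      unfolding hausdorff2_pre_def[of \<epsilon> "A n"] INF_less_iff by (auto intro: less_imp_le)
  qed
  then obtain C where C: "\<And>n. A n \<subseteq> (\<Union>i. C n i)" "\<And>n i. bounded (C n i)" "\<And>n i. diameter (C n i) \<le> \<epsilon>"
    "\<And>n. ?S (C n) \<le> hausdorff2_pre \<epsilon> (A n) + ennreal (e * (1/2)^Suc n)"
    by metis
  let ?D = "\<lambda>k. case prod_decode k of (n, i) \<Rightarrow> C n i"
  have "(\<Union>n. A n) \<subseteq> (\<Union>k. ?D k)"
  proof
    fix x assume "x \<in> (\<Union>n. A n)"
    then obtain n i where "x \<in> C n i" using C(1) by blast
    then show "x \<in> (\<Union>k. ?D k)" by (intro UN_I[of "prod_encode (n, i)"]) auto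
  qed
  then have "hausdorff2_pre \<epsilon> (\<Union>n. A n) \<le> ?S ?D"
    unfolding hausdorff2_pre_def using C(2,3) by (intro INF_lower) (auto split: prod.split)
  also have "?S ?D = (\<Sum>k. (case prod_decode k of (n, i) \<Rightarrow> ennreal (pi / 4 * (diameter (C n i))\<^sup>2)))"
    by (intro suminf_cong) (auto split: prod.split)
  also have "\<dots> = (\<Sum>n. ?S (C n))"
    by (rule suminf_ennreal_2dimen[where f = "\<lambda>(n, i). ennreal (pi / 4 * (diameter (C n i))\<^sup>2)"]) (simp only: prod.case)
  also have "\<dots> \<le> (\<Sum>n. hausdorff2_pre \<epsilon> (A n) + ennreal (e * (1/2)^Suc n))"
    by (intro suminf_le C) auto
  also have "\<dots> = (\<Sum>n. hausdorff2_pre \<epsilon> (A n)) + (\<Sum>n. ennreal (e * (1/2)^Suc n))"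
    by (intro suminf_add[symmetric]) auto
  also have "(\<Sum>n. ennreal (e * (1/2)^Suc n)) = ennreal (\<Sum>n. e * (1/2)^Suc n)"
    using e power_half_series by (intro suminf_ennreal2) (auto intro!: summable_mult simp: sums_iff)
  also have "(\<Sum>n. e * (1/2)^Suc n) = e"
    using sums_mult[OF power_half_series, of e] by (simp add: sums_iff)
  finally show "hausdorff2_pre \<epsilon> (\<Union>n. A n) \<le> (\<Sum>n. hausdorff2_pre \<epsilon> (A n)) + ennreal e" .
qed

lemma hausdorff2_outer_subadd:
  "hausdorff2_outer (\<Union>n. A n) \<le> (\<Sum>n. hausdorff2_outer (A n))"
  unfolding hausdorff2_outer_def[of "\<Union>n. A n"]
proof (rule SUP_least)
  fix \<epsilon> :: real assume "\<epsilon> \<in> {0<..}"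
  then have "(\<Sum>n. hausdorff2_pre \<epsilon> (A n)) \<le> (\<Sum>n. hausdorff2_outer (A n))"
    by (intro suminf_le) (auto simp: hausdorff2_outer_def intro: SUP_upper)
  with hausdorff2_pre_subadd[of \<epsilon> A] show "hausdorff2_pre \<epsilon> (\<Union>n. A n) \<le> (\<Sum>n. hausdorff2_outer (A n))"
    by (rule order_trans)
qed

lemma hausdorff2_outer_Un: "hausdorff2_outer (A \<union> B) \<le> hausdorff2_outer A + hausdorff2_outer B"
proof -
  let ?A = "\<lambda>n::nat. if n = 0 then A else if n = 1 then B else {}"
  have "A \<union> B = (\<Union>n. ?A n)" by (auto split: if_splits)
  then have "hausdorff2_outer (A \<union> B) \<le> (\<Sum>n. hausdorff2_outer (?A n))"
    using hausdorff2_outer_subadd[of ?A] by simp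
  also have "\<dots> = (\<Sum>n<2. hausdorff2_outer (?A n))"
    by (rule suminf_finite) (auto simp: hausdorff2_outer_empty)
  also have "\<dots> = hausdorff2_outer A + hausdorff2_outer B" by (simp add: numeral_2_eq_2)
  finally show ?thesis .
qed

lemma hausdorff2_outer_separated:
  assumes d: "0 < d" and sep: "\<And>x y. x \<in> A \<Longrightarrow> y \<in> B \<Longrightarrow> d \<le> dist x y"
  shows "hausdorff2_outer A + hausdorff2_outer B \<le> hausdorff2_outer (A \<union> B)"
proof -
  have pre: "hausdorff2_pre \<epsilon> A + hausdorff2_pre \<epsilon> B \<le> hausdorff2_pre \<epsilon> (A \<union> B)" if eps: "0 < \<epsilon>" "\<epsilon> < d" for \<epsilon>
    unfolding hausdorff2_pre_def[of \<epsilon> "A \<union> B"]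
  proof (rule INF_greatest, clarify)
    fix C :: "nat \<Rightarrow> 'a set"
    assume C: "A \<union> B \<subseteq> \<Union> (range C)" "\<forall>i. bounded (C i) \<and> diameter (C i) \<le> \<epsilon>"
    let ?f = "\<lambda>i. ennreal (pi / 4 * (diameter (C i))\<^sup>2)"
    define CA where "CA i = (if C i \<inter> A = {} then {} else C i)" for i
    define CB where "CB i = (if C i \<inter> B = {} then {} else C i)" for i
    have "hausdorff2_pre \<epsilon> A \<le> (\<Sum>i. ennreal (pi / 4 * (diameter (CA i))\<^sup>2))"
      unfolding hausdorff2_pre_def
    proof (rule INF_lower)
      have "A \<subseteq> (\<Union>i. CA i)"
      proof
        fix x assume "x \<in> A"
        moreover from this C(1) obtain i where "x \<in> C i" by auto
        ultimately show "x \<in> (\<Union>i. CA i)" by (intro UN_I[of i]) (auto simp: CA_def)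
      qed
      moreover have "bounded (CA i) \<and> diameter (CA i) \<le> \<epsilon>" for i
        using C(2) eps by (simp add: CA_def)
      ultimately show "CA \<in> {C. A \<subseteq> (\<Union>i. C i) \<and> (\<forall>i. bounded (C i) \<and> diameter (C i) \<le> \<epsilon>)}"
        by simp
    qed
    moreover have "hausdorff2_pre \<epsilon> B \<le> (\<Sum>i. ennreal (pi / 4 * (diameter (CB i))\<^sup>2))"
      unfolding hausdorff2_pre_def
    proof (rule INF_lower)
      have "B \<subseteq> (\<Union>i. CB i)"
      proof
        fix x assume "x \<in> B"
        moreover from this C(1) obtain i where "x \<in> C i" by auto
        ultimately show "x \<in> (\<Union>i. CB i)" by (intro UN_I[of i]) (auto simp: CB_def)
      qed
      moreover have "bounded (CB i) \<and> diameter (CB i) \<le> \<epsilon>" for i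
        using C(2) eps by (simp add: CB_def)
      ultimately show "CB \<in> {C. B \<subseteq> (\<Union>i. C i) \<and> (\<forall>i. bounded (C i) \<and> diameter (C i) \<le> \<epsilon>)}"
        by simp
    qed
    moreover have "ennreal (pi / 4 * (diameter (CA i))\<^sup>2) + ennreal (pi / 4 * (diameter (CB i))\<^sup>2) \<le> ?f i" for i
    proof -
      have "C i \<inter> A = {} \<or> C i \<inter> B = {}"
      proof (rule ccontr)
        assume "\<not> ?thesis"
        then obtain x y where xy: "x \<in> C i" "x \<in> A" "y \<in> C i" "y \<in> B" by blast
        then have "dist x y \<le> diameter (C i)" using C(2) by (intro diameter_bounded_bound) auto
        moreover have "diameter (C i) \<le> \<epsilon>" using C(2) by simp
        ultimately show False using sep[OF xy(2,4)] eps by linarith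
      qed
      then show ?thesis by (auto simp: CA_def CB_def)
    qed
    then have "(\<Sum>i. ennreal (pi / 4 * (diameter (CA i))\<^sup>2)) + (\<Sum>i. ennreal (pi / 4 * (diameter (CB i))\<^sup>2)) \<le> (\<Sum>i. ?f i)"
      by (subst suminf_add) (auto intro!: suminf_le)
    ultimately show "hausdorff2_pre \<epsilon> A + hausdorff2_pre \<epsilon> B \<le> (\<Sum>i. ?f i)"
      by (meson add_mono order_trans)
  qed
  have fin: "hausdorff2_pre a A + hausdorff2_pre b B \<le> hausdorff2_outer (A \<union> B)" if "0 < a" "0 < b" for a b
  proof -
    define m where "m = Min {a, b, d/2}"
    have m: "0 < m" "m < d" "m \<le> a" "m \<le> b" using that d by (auto simp: m_def min_less_iff_disj)
    have "hausdorff2_pre a A + hausdorff2_pre b B \<le> hausdorff2_pre m A + hausdorff2_pre m B"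
      using m by (intro add_mono hausdorff2_pre_antimono)
    also have "\<dots> \<le> hausdorff2_pre m (A \<union> B)" using m by (intro pre)
    also have "\<dots> \<le> hausdorff2_outer (A \<union> B)"
      unfolding hausdorff2_outer_def using m by (intro SUP_upper) auto
    finally show ?thesis .
  qed
  have ne: "{0<..} \<noteq> ({}::real set)" by auto
  have "hausdorff2_outer A + hausdorff2_outer B
      = (SUP b\<in>{0<..}. SUP a\<in>{0<..}. hausdorff2_pre a A + hausdorff2_pre b B)"
    unfolding hausdorff2_outer_def
    by (simp add: ennreal_SUP_add_left[OF ne] ennreal_SUP_add_right[OF ne])
  also have "\<dots> \<le> hausdorff2_outer (A \<union> B)"
    by (intro SUP_least) (use fin in auto)
  finally show ?thesis .
qed

lemma hausdorff2_outer_UN_separated: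
  assumes "\<And>n. \<exists>d>0. \<forall>x\<in>(\<Union>k<n. R k). \<forall>y\<in>R n. d \<le> dist x y"
  shows "(\<Sum>k<n. hausdorff2_outer (R k)) \<le> hausdorff2_outer (\<Union>k<(n::nat). R k)"
proof (induction n)
  case (Suc n)
  obtain d where d: "d > 0" "\<forall>x\<in>(\<Union>k<n. R k). \<forall>y\<in>R n. d \<le> dist x y" using assms by blast
  have "(\<Sum>k<Suc n. hausdorff2_outer (R k)) \<le> hausdorff2_outer (\<Union>k<n. R k) + hausdorff2_outer (R n)"
    using Suc by (simp add: add_mono)
  also have "\<dots> \<le> hausdorff2_outer ((\<Union>k<n. R k) \<union> R n)"
    using d by (intro hausdorff2_outer_separated[of d]) auto
  also have "(\<Union>k<n. R k) \<union> R n = (\<Union>k<Suc n. R k)" by (auto simp: less_Suc_eq)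
  finally show ?case .
qed simp

lemma hausdorff2_outer_closed:
  assumes F: "closed F" "F \<noteq> {}"
  shows "hausdorff2_outer (E \<inter> F) + hausdorff2_outer (E - F) \<le> hausdorff2_outer E"
proof (cases "hausdorff2_outer E = top")
  case False
  define a where "a n = 1 / (real n + 1)" for n
  have a_pos: "0 < a n" for n by (simp add: a_def)
  have a_strict: "a n < a m" if "m < n" for m n using that by (simp add: a_def divide_simps)
  have a_mono: "a n \<le> a m" if "m \<le> n" for m n using that by (simp add: a_def divide_simps)
  have far: "0 < infdist x F" if "x \<in> E - F" for x
    using that F in_closed_iff_infdist_zero[of F x] infdist_nonneg[of x F] by force
  define G where "G n = {x \<in> E - F. a n \<le> infdist x F}" for n
  define R where "R n = {x \<in> E - F. a (Suc n) \<le> infdist x F \<and> infdist x F < a n}" for n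
  have sep: "t - s \<le> dist x y" if "t \<le> infdist x F" "infdist y F \<le> s" for x y s t
    using infdist_triangle[of x F y] that by linarith
  have GF: "hausdorff2_outer (E \<inter> F) + hausdorff2_outer (G n) \<le> hausdorff2_outer E" for n
  proof -
    have "hausdorff2_outer (E \<inter> F) + hausdorff2_outer (G n) \<le> hausdorff2_outer (E \<inter> F \<union> G n)"
    proof (rule hausdorff2_outer_separated[OF a_pos[of n]])
      fix x y assume "x \<in> E \<inter> F" "y \<in> G n"
      then show "a n \<le> dist x y"
        using sep[of "a n" y x 0] by (auto simp: G_def dist_commute)
    qed
    also have "\<dots> \<le> hausdorff2_outer E" by (intro hausdorff2_outer_mono) (auto simp: G_def)
    finally show ?thesis .
  qed
  have half: "(\<Sum>k<n. hausdorff2_outer (R (2 * k + j))) \<le> hausdorff2_outer E" for n j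
  proof -
    have "(\<Sum>k<n. hausdorff2_outer (R (2 * k + j))) \<le> hausdorff2_outer (\<Union>k<n. R (2 * k + j))"
    proof (rule hausdorff2_outer_UN_separated)
      fix n
      let ?d = "if n = 0 then 1 else a (2 * n + j - 1) - a (2 * n + j)"
      have "0 < ?d" using a_strict[of "2 * n + j - 1" "2 * n + j"] by auto
      moreover have "?d \<le> dist x y" if x: "x \<in> R (2 * k + j)" "k < n" and y: "y \<in> R (2 * n + j)" for x y k
      proof -
        have "a (2 * n + j - 1) \<le> a (Suc (2 * k + j))" using x by (intro a_mono) auto
        with x y show ?thesis
          using sep[of "a (2 * n + j - 1)" x y "a (2 * n + j)"] by (auto simp: R_def)
      qed
      ultimately show "\<exists>d>0. \<forall>x\<in>(\<Union>k<n. R (2 * k + j)). \<forall>y\<in>R (2 * n + j). d \<le> dist x y" by blast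
    qed
    also have "\<dots> \<le> hausdorff2_outer E" by (intro hausdorff2_outer_mono) (auto simp: R_def)
    finally show ?thesis .
  qed
  have part: "(\<Sum>k<2 * n. hausdorff2_outer (R k)) = (\<Sum>k<n. hausdorff2_outer (R (2 * k + 0))) + (\<Sum>k<n. hausdorff2_outer (R (2 * k + 1)))" for n
    by (induction n) (auto simp: algebra_simps)
  let ?T = "\<Sum>k. hausdorff2_outer (R k)"
  have "(\<Sum>k<n. hausdorff2_outer (R k)) \<le> hausdorff2_outer E + hausdorff2_outer E" for n
  proof -
    have "(\<Sum>k<n. hausdorff2_outer (R k)) \<le> (\<Sum>k<2 * n. hausdorff2_outer (R k))"
      by (intro sum_mono2) auto
    also have "\<dots> \<le> hausdorff2_outer E + hausdorff2_outer E"
      unfolding part by (intro add_mono half)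
    finally show ?thesis .
  qed
  then have "?T \<le> hausdorff2_outer E + hausdorff2_outer E" by (intro suminf_le_const) auto
  with False have T: "?T \<noteq> top" by (auto simp: top_unique)
  have "hausdorff2_outer (E - F) + (\<Sum>k<n. hausdorff2_outer (R k)) \<le> hausdorff2_outer (G n) + ?T" for n
  proof -
    have "E - F \<subseteq> G n \<union> (\<Union>k. R (k + n))"
    proof
      fix x assume x: "x \<in> E - F"
      show "x \<in> G n \<union> (\<Union>k. R (k + n))"
      proof (cases "a n \<le> infdist x F")
        case False
        have "\<exists>m. a m < infdist x F"
          using reals_Archimedean[OF far[OF x]] by (auto simp: a_def inverse_eq_divide add.commute)
        then obtain m0 where "a m0 < infdist x F" by blast
        then have m0: "a m0 \<le> infdist x F" by simp
        define m where "m = (LEAST m. a m \<le> infdist x F)"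
        have m: "a m \<le> infdist x F" unfolding m_def using m0 by (rule LeastI)
        have less: "infdist x F < a l" if "l < m" for l
          using not_less_Least[OF that[unfolded m_def]] by simp
        have "n < m" using m False a_mono[of m n] by force
        then have "x \<in> R (m - 1)" using x m less[of "m - 1"] by (auto simp: R_def)
        moreover have "m - 1 = (m - 1 - n) + n" using \<open>n < m\<close> by simp
        ultimately show ?thesis by (metis UN_I UNIV_I UnI2)
      qed (use x in \<open>auto simp: G_def\<close>)
    qed
    then have "hausdorff2_outer (E - F) \<le> hausdorff2_outer (G n \<union> (\<Union>k. R (k + n)))"
      by (rule hausdorff2_outer_mono)
    also have "\<dots> \<le> hausdorff2_outer (G n) + hausdorff2_outer (\<Union>k. R (k + n))"
      by (rule hausdorff2_outer_Un)
    also have "\<dots> \<le> hausdorff2_outer (G n) + (\<Sum>k. hausdorff2_outer (R (k + n)))"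
      by (intro add_left_mono hausdorff2_outer_subadd)
    finally have "hausdorff2_outer (E - F) + (\<Sum>k<n. hausdorff2_outer (R k)) \<le>
        hausdorff2_outer (G n) + ((\<Sum>k. hausdorff2_outer (R (k + n))) + (\<Sum>k<n. hausdorff2_outer (R k)))"
      by (metis add_right_mono add.assoc)
    also have "(\<Sum>k. hausdorff2_outer (R (k + n))) + (\<Sum>k<n. hausdorff2_outer (R k)) = ?T"
      by (rule suminf_offset[symmetric]) auto
    finally show ?thesis .
  qed
  note GT = this
  have bound: "hausdorff2_outer (E \<inter> F) + hausdorff2_outer (E - F) + (\<Sum>k<n. hausdorff2_outer (R k))
      \<le> hausdorff2_outer E + ?T" for n
  proof -
    have "hausdorff2_outer (E \<inter> F) + (hausdorff2_outer (E - F) + (\<Sum>k<n. hausdorff2_outer (R k)))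
        \<le> hausdorff2_outer (E \<inter> F) + (hausdorff2_outer (G n) + ?T)"
      by (intro add_left_mono GT)
    also have "\<dots> = (hausdorff2_outer (E \<inter> F) + hausdorff2_outer (G n)) + ?T"
      by (simp only: add.assoc)
    also have "\<dots> \<le> hausdorff2_outer E + ?T" by (intro add_right_mono GF)
    finally show ?thesis by (simp only: add.assoc)
  qed
  have "hausdorff2_outer (E \<inter> F) + hausdorff2_outer (E - F) + ?T
      = (SUP n. hausdorff2_outer (E \<inter> F) + hausdorff2_outer (E - F) + (\<Sum>k<n. hausdorff2_outer (R k)))"
    unfolding suminf_eq_SUP by (subst ennreal_SUP_add_right) auto
  also have "\<dots> \<le> hausdorff2_outer E + ?T" by (intro SUP_least bound)
  finally have "?T + (hausdorff2_outer (E \<inter> F) + hausdorff2_outer (E - F)) \<le> ?T + hausdorff2_outer E"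
    by (simp only: add.commute)
  with T show ?thesis unfolding ennreal_add_left_cancel_le by simp
qed simp

lemma sets_hausdorff2 [simp, measurable_cong]: "sets hausdorff2 = sets borel"
  using sets.sigma_sets_eq[of "borel :: 'a measure"] by (simp add: hausdorff2_def)

lemma emeasure_hausdorff2: "A \<in> sets borel \<Longrightarrow> emeasure hausdorff2 A = hausdorff2_outer A"
proof -
  interpret sigma_algebra UNIV "UNIV :: 'a set set" using sigma_algebra_Pow[of UNIV] by simp
  have pos: "positive UNIV (hausdorff2_outer :: 'a set \<Rightarrow> _)"
    by (simp add: positive_def hausdorff2_outer_empty)
  have oms: "outer_measure_space UNIV (hausdorff2_outer :: 'a set \<Rightarrow> _)"
    unfolding outer_measure_space_def countably_subadditive_def
    using pos by (auto simp: increasing_def hausdorff2_outer_mono hausdorff2_outer_subadd)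
  have ms: "measure_space UNIV (lambda_system UNIV UNIV hausdorff2_outer) (hausdorff2_outer :: 'a set \<Rightarrow> _)"
    by (rule caratheodory_lemma[OF oms])
  then have sa: "sigma_algebra UNIV (lambda_system UNIV UNIV (hausdorff2_outer :: 'a set \<Rightarrow> _))"
    by (simp add: measure_space_def)
  have cl: "F \<in> lambda_system UNIV UNIV hausdorff2_outer" if "closed F" for F :: "'a set"
  proof (cases "F = {}")
    case True then show ?thesis using lambda_system_empty[OF pos] by simp
  next
    case False
    have "hausdorff2_outer E \<le> hausdorff2_outer (E \<inter> F) + hausdorff2_outer (E - F)" for E
      using hausdorff2_outer_Un[of "E \<inter> F" "E - F"] by (simp add: Int_Diff_Un)
    with hausdorff2_outer_closed[OF that False] show ?thesis
      by (auto simp: lambda_system_eq intro!: antisym)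
  qed
  have "sets (borel :: 'a measure) = sigma_sets UNIV (Collect closed)"
    unfolding borel_eq_closed by (simp add: sets_measure_of)
  also have "\<dots> \<subseteq> lambda_system UNIV UNIV hausdorff2_outer"
    by (rule sigma_algebra.sigma_sets_subset[OF sa]) (use cl in auto)
  finally have sub: "sets (borel :: 'a measure) \<subseteq> lambda_system UNIV UNIV hausdorff2_outer" .
  have "measure_space UNIV (sets borel) (hausdorff2_outer :: 'a set \<Rightarrow> _)"
    using measure_down[OF ms _ sub] sets.sigma_algebra_axioms[of "borel :: 'a measure"] by simp
  moreover assume "A \<in> sets borel"
  ultimately show ?thesis
    by (intro emeasure_measure_of[OF hausdorff2_def]) (auto simp: measure_space_def)
qed

definition boundary_measure :: "(real^3) set \<Rightarrow> (real^3) measure" where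
  "boundary_measure \<Omega> = restrict_space hausdorff2 (frontier \<Omega>)"

text \<open>For orthonormal \<open>e1\<close>, \<open>e2\<close>: the surface measure \<open>dS\<close> of the plane \<open>x0 + span {e1, e2}\<close>.\<close>

definition plane_measure :: "real^3 \<Rightarrow> real^3 \<Rightarrow> real^3 \<Rightarrow> (real^3) measure" where
  "plane_measure x0 e1 e2 =
     distr lborel borel (\<lambda>(a::real, b::real). x0 + a *\<^sub>R e1 + b *\<^sub>R e2)"

primrec Ck :: "nat \<Rightarrow> ('a::euclidean_space \<Rightarrow> 'b::real_normed_vector) \<Rightarrow> bool" where
  "Ck 0 f \<longleftrightarrow> continuous_on UNIV f"
| "Ck (Suc n) f \<longleftrightarrow> continuous_on UNIV f \<and>
     (\<forall>b\<in>Basis. \<exists>g. (\<forall>x. ((\<lambda>t. f (x + t *\<^sub>R b)) has_vector_derivative g x) (at 0)) \<and> Ck n g)"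

definition C2_boundary :: "(real^3) set \<Rightarrow> bool" where
  "C2_boundary \<Omega> \<longleftrightarrow>
     (\<forall>x0\<in>frontier \<Omega>. \<exists>r>0. \<exists>T :: real^3 \<Rightarrow> real^3. \<exists>\<gamma> :: real \<times> real \<Rightarrow> real.
        orthogonal_transformation T \<and> Ck 2 \<gamma> \<and>
        \<Omega> \<inter> ball x0 r = {x \<in> ball x0 r. T x $ 3 > \<gamma> (T x $ 1, T x $ 2)})"

definition bounded_C2_domain :: "(real^3) set \<Rightarrow> bool" where
  "bounded_C2_domain \<Omega> \<longleftrightarrow>
     \<Omega> \<noteq> {} \<and> open \<Omega> \<and> connected \<Omega> \<and> bounded \<Omega> \<and> C2_boundary \<Omega>"

definition L2 :: "'a measure \<Rightarrow> ('a \<Rightarrow> complex) \<Rightarrow> bool" where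
  "L2 M f \<longleftrightarrow> f \<in> borel_measurable M \<and> integrable M (\<lambda>x. (cmod (f x))\<^sup>2)"

definition L2_converges :: "'a measure \<Rightarrow> (nat \<Rightarrow> 'a \<Rightarrow> complex) \<Rightarrow> ('a \<Rightarrow> complex) \<Rightarrow> bool" where
  "L2_converges M f g \<longleftrightarrow> (\<lambda>n. \<integral>\<^sup>+x. ennreal ((cmod (f n x - g x))\<^sup>2) \<partial>M) \<longlonglongrightarrow> 0"

definition partial_deriv :: "3 \<Rightarrow> (real^3 \<Rightarrow> complex) \<Rightarrow> real^3 \<Rightarrow> complex" where
  "partial_deriv i f x = vector_derivative (\<lambda>t. f (x + t *\<^sub>R axis i 1)) (at 0)"

definition smooth :: "(real^3 \<Rightarrow> complex) \<Rightarrow> bool" where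
  "smooth f \<longleftrightarrow> (\<forall>n. Ck n f)"

definition test_functions :: "(real^3) set \<Rightarrow> (real^3 \<Rightarrow> complex) set" where
  "test_functions \<Omega> =
     {\<phi>. smooth \<phi> \<and> compact (closure {x. \<phi> x \<noteq> 0}) \<and> closure {x. \<phi> x \<noteq> 0} \<subseteq> \<Omega>}"

definition is_weak_grad ::
    "(real^3) set \<Rightarrow> (real^3 \<Rightarrow> complex) \<Rightarrow> (real^3 \<Rightarrow> complex^3) \<Rightarrow> bool" where
  "is_weak_grad \<Omega> u G \<longleftrightarrow>
     (\<forall>i. L2 (lebesgue_on \<Omega>) (\<lambda>x. G x $ i)) \<and>
     (\<forall>\<phi>\<in>test_functions \<Omega>. \<forall>i.
        integral\<^sup>L (lebesgue_on \<Omega>) (\<lambda>x. u x * partial_deriv i \<phi> x) =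
        - integral\<^sup>L (lebesgue_on \<Omega>) (\<lambda>x. G x $ i * \<phi> x))"

definition H1 :: "(real^3) set \<Rightarrow> (real^3 \<Rightarrow> complex) set" where
  "H1 \<Omega> = {u. L2 (lebesgue_on \<Omega>) u \<and> (\<exists>G. is_weak_grad \<Omega> u G)}"

text \<open>The weak gradient is unique up to null sets; a representative is chosen.\<close>

definition weak_grad :: "(real^3) set \<Rightarrow> (real^3 \<Rightarrow> complex) \<Rightarrow> real^3 \<Rightarrow> complex^3" where
  "weak_grad \<Omega> u = (SOME G. is_weak_grad \<Omega> u G)"

text \<open>
  \<open>has_trace \<Omega> u \<gamma>\<close>: the function \<open>\<gamma> \<in> L\<^sup>2(\<partial>\<Omega>)\<close> represents the trace \<open>u|\<^bsub>\<partial>\<Omega>\<^esub>\<close> of \<open>u \<in> H\<^sup>1(\<Omega>)\<close>, the trace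
  operator being the continuous extension of \<open>\<phi> \<mapsto> \<phi>|\<^bsub>\<partial>\<Omega>\<^esub>\<close> from the functions that are smooth up to
  the boundary.
\<close>

definition has_trace ::
    "(real^3) set \<Rightarrow> (real^3 \<Rightarrow> complex) \<Rightarrow> (real^3 \<Rightarrow> complex) \<Rightarrow> bool" where
  "has_trace \<Omega> u \<gamma> \<longleftrightarrow>
     u \<in> H1 \<Omega> \<and> L2 (boundary_measure \<Omega>) \<gamma> \<and>
     (\<exists>\<phi> :: nat \<Rightarrow> real^3 \<Rightarrow> complex.
        (\<forall>n. smooth (\<phi> n)) \<and>
        L2_converges (lebesgue_on \<Omega>) \<phi> u \<and>
        (\<forall>i. L2_converges (lebesgue_on \<Omega>) (\<lambda>n. partial_deriv i (\<phi> n)) (\<lambda>x. weak_grad \<Omega> u x $ i)) \<and>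
        L2_converges (boundary_measure \<Omega>) \<phi> \<gamma>)"

definition source_term :: "(real^3 \<Rightarrow> complex) \<Rightarrow> (real^3) set \<Rightarrow> real^3 \<Rightarrow> complex" where
  "source_term \<rho> D x = (if x \<in> D then \<rho> x else 0)"

definition helmholtz_form ::
    "(real^3) set \<Rightarrow> real \<Rightarrow> (real^3 \<Rightarrow> complex) \<Rightarrow> (real^3 \<Rightarrow> complex) \<Rightarrow> (real^3 \<Rightarrow> complex) \<Rightarrow> complex" where
  "helmholtz_form \<Omega> k F u g =
     integral\<^sup>L (lebesgue_on \<Omega>)
       (\<lambda>x. (\<Sum>i\<in>UNIV. weak_grad \<Omega> u x $ i * weak_grad \<Omega> g x $ i)
            - (complex_of_real k)\<^sup>2 * u x * g x + F x * g x)"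

text \<open>\<open>\<Delta>u + k\<^sup>2u = F\<close> in \<open>\<Omega>\<close> in the sense of distributions, after one integration by parts.\<close>

definition weak_solution ::
    "(real^3) set \<Rightarrow> real \<Rightarrow> (real^3 \<Rightarrow> complex) \<Rightarrow> (real^3 \<Rightarrow> complex) \<Rightarrow> bool" where
  "weak_solution \<Omega> k F u \<longleftrightarrow>
     u \<in> H1 \<Omega> \<and> (\<forall>\<phi>\<in>test_functions \<Omega>. helmholtz_form \<Omega> k F u \<phi> = 0)"

text \<open>
  The functional \<open>\<Lambda>\<close> on boundary functions is the weak normal derivative \<open>\<partial>u/\<partial>\<nu>\<close>. Its values are
  determined exactly on the trace space of \<open>H\<^sup>1(\<Omega>)\<close>; what it does on other functions is irrelevant.
\<close>

definition has_normal_derivative ::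
    "(real^3) set \<Rightarrow> real \<Rightarrow> (real^3 \<Rightarrow> complex) \<Rightarrow> (real^3 \<Rightarrow> complex) \<Rightarrow>
     ((real^3 \<Rightarrow> complex) \<Rightarrow> complex) \<Rightarrow> bool" where
  "has_normal_derivative \<Omega> k F u \<Lambda> \<longleftrightarrow>
     (\<forall>g\<in>H1 \<Omega>. \<forall>\<gamma>. has_trace \<Omega> g \<gamma> \<longrightarrow> \<Lambda> \<gamma> = helmholtz_form \<Omega> k F u g)"

definition has_cauchy_data ::
    "(real^3) set \<Rightarrow> real \<Rightarrow> (real^3 \<Rightarrow> complex) \<Rightarrow> (real^3 \<Rightarrow> complex) \<Rightarrow>
     (real^3 \<Rightarrow> complex) \<times> ((real^3 \<Rightarrow> complex) \<Rightarrow> complex) \<Rightarrow> bool" where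
  "has_cauchy_data \<Omega> k F u = (\<lambda>(\<gamma>, \<Lambda>). has_trace \<Omega> u \<gamma> \<and> has_normal_derivative \<Omega> k F u \<Lambda>)"

definition source_problem ::
    "(real^3) set \<Rightarrow> real \<Rightarrow> (real^3) set \<Rightarrow> (real^3 \<Rightarrow> complex) \<Rightarrow> (real^3 \<Rightarrow> complex) \<Rightarrow> bool" where
  "source_problem \<Omega> k D \<rho> u \<longleftrightarrow>
     open D \<and> D \<noteq> {} \<and> closure D \<subseteq> \<Omega> \<and> L2 (lebesgue_on D) \<rho> \<and>
     weak_solution \<Omega> k (source_term \<rho> D) u"

definition orthogonal_circle :: "real^3 \<Rightarrow> (real^3) set" where
  "orthogonal_circle \<omega> = {\<theta> \<in> sphere 0 1. \<omega> \<bullet> \<theta> = 0}"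

definition support_fun :: "(real^3) set \<Rightarrow> real^3 \<Rightarrow> real" where
  "support_fun D \<omega> = (SUP x\<in>D. x \<bullet> \<omega>)"

definition contact_set :: "(real^3) set \<Rightarrow> real^3 \<Rightarrow> (real^3) set" where
  "contact_set D \<omega> = {x \<in> closure D. x \<bullet> \<omega> = support_fun D \<omega>}"

definition regular_direction :: "(real^3) set \<Rightarrow> real^3 \<Rightarrow> bool" where
  "regular_direction D \<omega> \<longleftrightarrow> is_singleton (contact_set D \<omega>)"

definition contact_point :: "(real^3) set \<Rightarrow> real^3 \<Rightarrow> real^3" where
  "contact_point D \<omega> = the_elem (contact_set D \<omega>)"

definition plane :: "real^3 \<Rightarrow> real \<Rightarrow> (real^3) set" where
  "plane \<omega> c = {x. x \<bullet> \<omega> = c}"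

definition cone_base :: "real^3 \<Rightarrow> real \<Rightarrow> (real^3) set \<Rightarrow> bool" where
  "cone_base \<omega> c Q \<longleftrightarrow> Q \<noteq> {} \<and> bounded Q \<and> openin (top_of_set (plane \<omega> c)) Q"

text \<open>The direction \<open>\<omega>\<close> enters the finite cone only through the plane containing its base \<open>Q\<close>.\<close>

definition finite_cone :: "real^3 \<Rightarrow> real \<Rightarrow> (real^3) set \<Rightarrow> (real^3) set" where
  "finite_cone p \<delta> Q = (\<Union>s\<in>{0<..<\<delta>}. {p + (s / \<delta>) *\<^sub>R (z - p) |z. z \<in> Q})"

definition cone_slice :: "real^3 \<Rightarrow> real^3 \<Rightarrow> real \<Rightarrow> (real^3) set \<Rightarrow> real \<Rightarrow> (real^3) set" where
  "cone_slice p \<omega> \<delta> Q s = finite_cone p \<delta> Q \<inter> plane \<omega> (p \<bullet> \<omega> - s)"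

text \<open>
  As \<open>\<theta> \<in> S(\<omega>)\<close>, the vectors \<open>\<theta>\<close> and \<open>\<omega> \<times> \<theta>\<close> are an orthonormal basis of the orthogonal complement
  of \<open>\<omega>\<close>.
\<close>

definition cone_integral ::
    "real^3 \<Rightarrow> real^3 \<Rightarrow> real \<Rightarrow> (real^3) set \<Rightarrow> real^3 \<Rightarrow> real \<Rightarrow> complex" where
  "cone_integral p \<omega> \<delta> Q \<theta> s =
     2 * complex_of_real s *
     (LINT z : cone_slice p \<omega> \<delta> Q s | plane_measure (p - s *\<^sub>R \<omega>) \<theta> (cross3 \<omega> \<theta>).
        1 / (complex_of_real s - \<i> * complex_of_real ((z - p) \<bullet> \<theta>)) ^ 3)"

text \<open>The common value of the above for all \<open>0 < s < \<delta>\<close>; see \<open>cone_const_eq\<close>.\<close>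

definition cone_const :: "real^3 \<Rightarrow> real^3 \<Rightarrow> real \<Rightarrow> (real^3) set \<Rightarrow> real^3 \<Rightarrow> complex" where
  "cone_const p \<omega> \<delta> Q \<theta> = (THE c. \<forall>s\<in>{0<..<\<delta>}. c = cone_integral p \<omega> \<delta> Q \<theta> s)"

lemma cone_integral_eq:
  assumes w: "\<omega> \<in> sphere 0 1" and th: "\<theta> \<in> orthogonal_circle \<omega>"
    and Q: "cone_base \<omega> (p \<bullet> \<omega> - \<delta>) Q" and s: "0 < s" "s < \<delta>"
  shows "cone_integral p \<omega> \<delta> Q \<theta> s =
    2 * complex_of_real \<delta> *
    (LINT z : Q | plane_measure (p - \<delta> *\<^sub>R \<omega>) \<theta> (cross3 \<omega> \<theta>).
       1 / (complex_of_real \<delta> - \<i> * complex_of_real ((z - p) \<bullet> \<theta>)) ^ 3)"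
proof -
  define e where "e = cross3 \<omega> \<theta>"
  define f where "f t = (\<lambda>(a::real, b::real). p - t *\<^sub>R \<omega> + a *\<^sub>R \<theta> + b *\<^sub>R e)" for t
  have ww: "\<omega> \<bullet> \<omega> = 1" and tt: "\<theta> \<bullet> \<theta> = 1" and wt: "\<omega> \<bullet> \<theta> = 0" "\<theta> \<bullet> \<omega> = 0"
    using w th by (auto simp: orthogonal_circle_def norm_eq_1 inner_commute)
  have e: "e \<bullet> \<omega> = 0" "e \<bullet> \<theta> = 0" unfolding e_def by (simp_all add: dot_cross_self)
  have f_w: "f t y \<bullet> \<omega> = p \<bullet> \<omega> - t" for t y
    by (simp add: f_def split_beta inner_add_left inner_diff_left ww wt e)
  have f_th: "(f t y - p) \<bullet> \<theta> = fst y" for t y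
    by (simp add: f_def split_beta inner_add_left inner_diff_left tt wt e)
  have f_cont: "continuous_on UNIV (f t)" for t
    unfolding f_def split_beta by (intro continuous_intros)
  then have f_meas [measurable]: "f t \<in> borel_measurable borel" for t
    by (rule borel_measurable_continuous_onI)
  obtain U where U: "open U" "Q = U \<inter> plane \<omega> (p \<bullet> \<omega> - \<delta>)"
    using Q by (auto simp: cone_base_def openin_open Int_commute)
  have closed_plane: "closed (plane \<omega> c)" for c
    unfolding plane_def using closed_hyperplane[of \<omega> c] by (simp add: inner_commute)
  have Qb [measurable]: "Q \<in> sets borel"
    unfolding U by (intro sets.Int borel_open borel_closed U closed_plane)
  define c where "c = s / \<delta>"
  have c: "0 < c" and cd: "s = c * \<delta>" using s by (auto simp: c_def)
  have fc: "f s (c *\<^sub>R y) = p + c *\<^sub>R (f \<delta> y - p)" for y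
    by (simp add: f_def split_beta cd algebra_simps)
  have slice: "f s y \<in> cone_slice p \<omega> \<delta> Q s \<longleftrightarrow> f \<delta> ((1 / c) *\<^sub>R y) \<in> Q" for y
  proof
    assume "f s y \<in> cone_slice p \<omega> \<delta> Q s"
    then obtain t z where t: "0 < t" "t < \<delta>" "z \<in> Q" "f s y = p + (t / \<delta>) *\<^sub>R (z - p)"
      by (auto simp: cone_slice_def finite_cone_def)
    have zw: "z \<bullet> \<omega> = p \<bullet> \<omega> - \<delta>" using t(3) U(2) by (auto simp: plane_def)
    have "p \<bullet> \<omega> - s = p \<bullet> \<omega> - t"
      using arg_cong[OF t(4), of "\<lambda>x. x \<bullet> \<omega>"] f_w[of s y] t(1,2)
      by (simp add: inner_add_left inner_diff_left zw)
    then have "c *\<^sub>R (f \<delta> ((1 / c) *\<^sub>R y) - p) = c *\<^sub>R (z - p)"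
      using t(1,2,4) fc[of "(1 / c) *\<^sub>R y"] c by (simp add: c_def)
    with c t(3) show "f \<delta> ((1 / c) *\<^sub>R y) \<in> Q" by simp
  next
    assume "f \<delta> ((1 / c) *\<^sub>R y) \<in> Q"
    moreover have "f s y = p + (s / \<delta>) *\<^sub>R (f \<delta> ((1 / c) *\<^sub>R y) - p)"
      using fc[of "(1 / c) *\<^sub>R y"] c s by (simp add: c_def)
    ultimately show "f s y \<in> cone_slice p \<omega> \<delta> Q s"
      using s f_w[of s y] by (auto simp: cone_slice_def finite_cone_def plane_def)
  qed
  have sliceb [measurable]: "cone_slice p \<omega> \<delta> Q s \<in> sets borel"
  proof -
    have "cone_slice p \<omega> \<delta> Q s = (\<lambda>x. p + (1 / c) *\<^sub>R (x - p)) -` Q \<inter> plane \<omega> (p \<bullet> \<omega> - s)"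
    proof (intro set_eqI iffI)
      fix x assume "x \<in> cone_slice p \<omega> \<delta> Q s"
      then have x: "x \<in> plane \<omega> (p \<bullet> \<omega> - s)" and "x \<in> finite_cone p \<delta> Q"
        by (auto simp: cone_slice_def)
      then obtain t z where t: "0 < t" "t < \<delta>" "z \<in> Q" "x = p + (t / \<delta>) *\<^sub>R (z - p)"
        by (auto simp: finite_cone_def)
      have zw: "z \<bullet> \<omega> = p \<bullet> \<omega> - \<delta>" using t(3) U(2) by (auto simp: plane_def)
      have "p \<bullet> \<omega> - s = p \<bullet> \<omega> - t"
        using x t by (simp add: plane_def inner_add_left inner_diff_left zw)
      then show "x \<in> (\<lambda>x. p + (1 / c) *\<^sub>R (x - p)) -` Q \<inter> plane \<omega> (p \<bullet> \<omega> - s)"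
        using t c x by (simp add: c_def)
    next
      fix x assume x: "x \<in> (\<lambda>x. p + (1 / c) *\<^sub>R (x - p)) -` Q \<inter> plane \<omega> (p \<bullet> \<omega> - s)"
      define z where "z = p + (1 / c) *\<^sub>R (x - p)"
      have "z \<in> Q" using x by (simp add: z_def)
      moreover have "x = p + (s / \<delta>) *\<^sub>R (z - p)" using s by (simp add: z_def c_def)
      ultimately have "x \<in> finite_cone p \<delta> Q"
        unfolding finite_cone_def using s by (intro UN_I[of s]) auto
      with x show "x \<in> cone_slice p \<omega> \<delta> Q s" by (simp add: cone_slice_def)
    qed
    moreover have "(\<lambda>x. p + (1 / c) *\<^sub>R (x - p)) -` Q \<in> sets borel"
      using measurable_sets[of "\<lambda>x. p + (1 / c) *\<^sub>R (x - p)" borel borel Q] by simp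
    ultimately show ?thesis using closed_plane by auto
  qed
  have pm: "(LINT z : A | plane_measure (p - t *\<^sub>R \<omega>) \<theta> (cross3 \<omega> \<theta>).
      1 / (complex_of_real t - \<i> * complex_of_real ((z - p) \<bullet> \<theta>)) ^ 3) =
    (LINT y | lborel. indicator A (f t y) *\<^sub>R (1 / (complex_of_real t - \<i> * complex_of_real (fst y)) ^ 3))"
    if A [measurable]: "A \<in> sets borel" for A t
  proof -
    have pmf: "plane_measure (p - t *\<^sub>R \<omega>) \<theta> (cross3 \<omega> \<theta>) = distr lborel borel (f t)"
      by (simp add: plane_measure_def f_def e_def)
    show ?thesis
      unfolding pmf set_lebesgue_integral_def
      by (subst integral_distr) (auto simp: f_th)
  qed
  let ?g = "\<lambda>t y. 1 / (complex_of_real t - \<i> * complex_of_real (fst (y :: real \<times> real))) ^ 3"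
  have "(\<lambda>y. complex_of_real s - \<i> * complex_of_real (fst y)) \<in> borel_measurable (borel :: (real \<times> real) measure)"
    by (intro borel_measurable_continuous_onI continuous_intros)
  then have g_meas [measurable]: "?g s \<in> borel_measurable borel"
    by (intro borel_measurable_divide borel_measurable_power borel_measurable_const)
  have sc_meas: "(\<lambda>y :: real \<times> real. r *\<^sub>R y) \<in> borel_measurable borel" for r
    by (intro borel_measurable_continuous_onI continuous_intros)
  have "f \<delta> \<circ> (\<lambda>y. (1 / c) *\<^sub>R y) \<in> borel_measurable borel"
    by (rule measurable_comp[OF sc_meas f_meas])
  then have [measurable]: "(\<lambda>y. f \<delta> ((1 / c) *\<^sub>R y)) \<in> borel_measurable borel" by (simp add: comp_def)
  define h where "h y = indicator Q (f \<delta> ((1 / c) *\<^sub>R y)) *\<^sub>R ?g s y" for y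
  have h_meas [measurable]: "h \<in> borel_measurable borel" unfolding h_def by measurable
  have "(LINT y | lborel. indicator (cone_slice p \<omega> \<delta> Q s) (f s y) *\<^sub>R ?g s y)
      = (LINT y | lborel. indicator Q (f \<delta> ((1 / c) *\<^sub>R y)) *\<^sub>R ?g s y)"
    by (intro Bochner_Integration.integral_cong) (auto simp: indicator_def slice)
  also have "\<dots> = (LINT y | lborel. h y)" by (simp only: h_def)
  also have "\<dots> = (LINT y | density (distr lborel borel (\<lambda>x. 0 + c *\<^sub>R x)) (\<lambda>_. ennreal (\<bar>c\<bar> ^ DIM(real \<times> real))). h y)"
    using lborel_affine[of c "0 :: real \<times> real"] c by simp
  also have "\<dots> = (LINT y | distr lborel borel (\<lambda>x. 0 + c *\<^sub>R x). (\<bar>c\<bar> ^ DIM(real \<times> real)) *\<^sub>R h y)"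
    by (subst integral_density) auto
  also have "\<dots> = (LINT y | lborel. (\<bar>c\<bar> ^ DIM(real \<times> real)) *\<^sub>R h (0 + c *\<^sub>R y))"
    using sc_meas by (subst integral_distr) auto
  also have "\<dots> = (LINT y | lborel. c\<^sup>2 *\<^sub>R (indicator Q (f \<delta> y) *\<^sub>R ?g s (c *\<^sub>R y)))"
    using c by (simp add: h_def power2_eq_square del: fst_scaleR)
  also have "\<dots> = (LINT y | lborel. (1 / c) *\<^sub>R (indicator Q (f \<delta> y) *\<^sub>R ?g \<delta> y))"
  proof (intro Bochner_Integration.integral_cong refl)
    fix y :: "real \<times> real"
    have "complex_of_real s - \<i> * complex_of_real (fst (c *\<^sub>R y))
        = complex_of_real c * (complex_of_real \<delta> - \<i> * complex_of_real (fst y))"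
      by (simp add: cd algebra_simps)
    then have g: "?g s (c *\<^sub>R y) = (1 / complex_of_real c ^ 3) * ?g \<delta> y"
      by (simp only: power_mult_distrib) simp
    have "c\<^sup>2 *\<^sub>R (r *\<^sub>R ((1 / complex_of_real c ^ 3) * v)) = (1 / c) *\<^sub>R (r *\<^sub>R v)" for r :: real and v
      using c by (simp add: scaleR_conv_of_real power2_eq_square power3_eq_cube)
    then show "c\<^sup>2 *\<^sub>R (indicator Q (f \<delta> y) *\<^sub>R ?g s (c *\<^sub>R y)) = (1 / c) *\<^sub>R (indicator Q (f \<delta> y) *\<^sub>R ?g \<delta> y)"
      unfolding g .
  qed
  also have "\<dots> = (1 / c) *\<^sub>R (LINT y | lborel. indicator Q (f \<delta> y) *\<^sub>R ?g \<delta> y)"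
    by (rule integral_scaleR_right)
  finally show ?thesis
    unfolding cone_integral_def pm[OF sliceb] pm[OF Qb] using c cd
    by (simp add: scaleR_conv_of_real field_simps)
qed

lemma cone_const_eq:
  assumes "\<omega> \<in> sphere 0 1" "\<theta> \<in> orthogonal_circle \<omega>"
    and "cone_base \<omega> (p \<bullet> \<omega> - \<delta>) Q" "0 < s" "s < \<delta>"
  shows "cone_const p \<omega> \<delta> Q \<theta> = cone_integral p \<omega> \<delta> Q \<theta> s"
  unfolding cone_const_def
proof (rule the_equality)
  show "\<forall>t\<in>{0<..<\<delta>}. cone_integral p \<omega> \<delta> Q \<theta> s = cone_integral p \<omega> \<delta> Q \<theta> t"
    using cone_integral_eq[OF assms(1-3)] assms(4,5) by simp
qed (use assms(4,5) in auto)

definition conical_singularity ::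
    "(real^3) set \<Rightarrow> real^3 \<Rightarrow> real \<Rightarrow> (real^3) set \<Rightarrow> bool" where
  "conical_singularity D \<omega> \<delta> Q \<longleftrightarrow>
     \<delta> > 0 \<and> cone_base \<omega> (support_fun D \<omega> - \<delta>) Q \<and>
     D \<inter> {x. support_fun D \<omega> - \<delta> < x \<bullet> \<omega> \<and> x \<bullet> \<omega> < support_fun D \<omega>} =
       finite_cone (contact_point D \<omega>) \<delta> Q"

text \<open>On bounded sets \<open>S\<close> this is membership in \<open>C\<^sup>0\<^sup>,\<^sup>\<alpha>(S)\<close>.\<close>

definition holder_on :: "real \<Rightarrow> (real^3) set \<Rightarrow> (real^3 \<Rightarrow> complex) \<Rightarrow> bool" where
  "holder_on \<alpha> S f \<longleftrightarrow> (\<exists>L. \<forall>x\<in>S. \<forall>y\<in>S. cmod (f x - f y) \<le> L * dist x y powr \<alpha>)"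

definition active_at :: "(real^3 \<Rightarrow> complex) \<Rightarrow> (real^3) set \<Rightarrow> real^3 \<Rightarrow> bool" where
  "active_at \<rho> D p \<longleftrightarrow>
     p \<in> frontier D \<and>
     (\<exists>\<eta> \<alpha> \<rho>'. \<eta> > 0 \<and> 0 < \<alpha> \<and> \<alpha> \<le> 1 \<and> holder_on \<alpha> (cball p \<eta>) \<rho>' \<and>
        (AE x in lebesgue. x \<in> ball p \<eta> \<inter> D \<longrightarrow> \<rho> x = \<rho>' x) \<and> \<rho>' p \<noteq> 0)"

end

theory Submission
  imports Defs "HOL-Probability.Distributions"
begin

text \<open>
  Put \<open>a = \<tau> \<omega>\<close>, \<open>b = \<surd>(\<tau>\<^sup>2 + k\<^sup>2) \<theta>\<close> and \<open>v x = exp (x \<bullet> a + \<i> (x \<bullet> b))\<close>. As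
  \<open>a \<bullet> a - b \<bullet> b = - k\<^sup>2\<close> and \<open>a \<bullet> b = 0\<close>, the function \<open>v\<close> solves the Helmholtz equation, and for large \<open>\<tau>\<close>
  it lives, relative to its maximum over \<open>D\<close>, near the points of \<open>D\<close> with the largest \<open>x \<bullet> \<omega>\<close>.

  The Cauchy data determine the moments \<open>\<integral> F v\<close> (\<open>source_moments_eq\<close>). The two weak normal derivatives,
  tested with \<open>v\<close>, give \<open>\<integral> (F\<^sub>1 - F\<^sub>2) v = - \<integral> (\<nabla>w \<bullet> \<nabla>v - k\<^sup>2 w v)\<close> for \<open>w = u\<^sub>1 - u\<^sub>2\<close>, and the right-hand side
  vanishes because \<open>w\<close> has trace zero: \<open>w\<close> is a limit in \<open>H\<^sup>1\<close> of smooth \<open>\<psi>\<^sub>n\<close> whose boundary values tend to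
  zero, and for these the integral is \<open>\<integral> div (\<psi>\<^sub>n \<nabla>v)\<close>. That this tends to zero follows from the
  inequality \<open>|\<integral>\<^sub>\<Omega> \<partial>\<^sub>i f| \<le> C \<integral>\<^sub>\<partial>\<^sub>\<Omega> |f| dH\<^sup>2\<close> of \<open>cmod_integral_partial_deriv_le\<close>.
  It holds for every bounded open \<open>\<Omega>\<close> with a boundary of finite area: shifting \<open>\<Omega>\<close> by \<open>h e\<^sub>i\<close> changes its
  indicator only on the set swept by the boundary, and the volume of that set is at most \<open>C h\<close> times the
  area of the boundary. The smoothness of the boundary enters by making its area finite.

  The moments determine the tip (\<open>tip_concentration\<close>). Substituting \<open>x = p + y / \<tau>\<close> shows that
  \<open>\<tau>\<^sup>3 v(- p) \<integral>\<^sub>D \<rho> v\<close> tends to \<open>\<rho>'(p) \<integral>\<^sub>K exp (y \<bullet> \<omega> + \<i> (y \<bullet> \<theta>)) dy\<close>, where \<open>K\<close> is the infinite cone with which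
  \<open>D - p\<close> agrees near \<open>0\<close>. The last integral is the constant of the cone
  (\<open>cone_transform_eq_cone_const\<close>), so the limit is not zero. If two sources have the same moments, the
  quotient of the two limits shows that \<open>exp ((p\<^sub>1 - p\<^sub>2) \<bullet> a + \<i> ((p\<^sub>1 - p\<^sub>2) \<bullet> b))\<close> converges to a number other
  than zero as \<open>\<tau> \<rightarrow> \<infinity>\<close>. This forces \<open>(p\<^sub>1 - p\<^sub>2) \<bullet> \<omega> = 0\<close> and \<open>(p\<^sub>1 - p\<^sub>2) \<bullet> \<theta> = 0\<close>. One coordinate is still open.
  Since the constant of the cone depends continuously on \<open>\<theta>\<close>, the same reasoning applies to all directions
  of the circle close to \<open>\<theta>\<close>, and two of them together with \<open>\<omega>\<close> span the space.
\<close>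

section \<open>Functions with continuous partial derivatives\<close>

lemma Ck_Suc_imp_Ck: "Ck (Suc n) f \<Longrightarrow> Ck n f"
proof (induction n arbitrary: f)
  case (Suc n)
  then show ?case by (metis Ck.simps(2))
qed simp

lemma Ck_SucE:
  assumes "Ck (Suc n) f" "b \<in> Basis"
  obtains g where "\<And>x. ((\<lambda>t. f (x + t *\<^sub>R b)) has_vector_derivative g x) (at 0)" "Ck n g"
proof -
  have "\<exists>g. (\<forall>x. ((\<lambda>t. f (x + t *\<^sub>R b)) has_vector_derivative g x) (at 0)) \<and> Ck n g"
    using assms by simp
  with that show thesis by metis
qed

lemma Ck_const: "Ck n (\<lambda>x. c)"
proof (induction n arbitrary: c)
  case (Suc n)
  have "((\<lambda>t. c) has_vector_derivative 0) (at (0::real))" by simp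
  with Suc show ?case by (auto intro!: exI[of _ "\<lambda>_. 0"])
qed simp

lemma Ck_add:
  assumes "Ck n f" "Ck n g"
  shows "Ck n (\<lambda>x. f x + g x)"
  using assms
proof (induction n arbitrary: f g)
  case 0
  then show ?case by (auto intro: continuous_on_add)
next
  case (Suc n)
  have "\<exists>h. (\<forall>x. ((\<lambda>t. f (x + t *\<^sub>R b) + g (x + t *\<^sub>R b)) has_vector_derivative h x) (at 0)) \<and> Ck n h"
    if b: "b \<in> Basis" for b
  proof -
    obtain f' where f: "\<And>x. ((\<lambda>t. f (x + t *\<^sub>R b)) has_vector_derivative f' x) (at 0)" "Ck n f'"
      using Ck_SucE[OF Suc.prems(1) b] by blast
    obtain g' where g: "\<And>x. ((\<lambda>t. g (x + t *\<^sub>R b)) has_vector_derivative g' x) (at 0)" "Ck n g'"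
      using Ck_SucE[OF Suc.prems(2) b] by blast
    show ?thesis
      by (intro exI[of _ "\<lambda>x. f' x + g' x"] conjI allI has_vector_derivative_add f g Suc.IH)
  qed
  moreover have "continuous_on UNIV (\<lambda>x. f x + g x)"
    using Suc.prems by (intro continuous_on_add) (simp_all only: Ck.simps)
  ultimately show ?case by simp
qed

lemma Ck_mult:
  fixes f g :: "'a::euclidean_space \<Rightarrow> 'b::real_normed_algebra"
  assumes "Ck n f" "Ck n g"
  shows "Ck n (\<lambda>x. f x * g x)"
  using assms
proof (induction n arbitrary: f g)
  case 0
  then show ?case by (auto intro: continuous_on_mult)
next
  case (Suc n)
  have "\<exists>h. (\<forall>x. ((\<lambda>t. f (x + t *\<^sub>R b) * g (x + t *\<^sub>R b)) has_vector_derivative h x) (at 0)) \<and> Ck n h"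
    if b: "b \<in> Basis" for b
  proof -
    obtain f' where f: "\<And>x. ((\<lambda>t. f (x + t *\<^sub>R b)) has_vector_derivative f' x) (at 0)" "Ck n f'"
      using Ck_SucE[OF Suc.prems(1) b] by blast
    obtain g' where g: "\<And>x. ((\<lambda>t. g (x + t *\<^sub>R b)) has_vector_derivative g' x) (at 0)" "Ck n g'"
      using Ck_SucE[OF Suc.prems(2) b] by blast
    have "((\<lambda>t. f (x + t *\<^sub>R b) * g (x + t *\<^sub>R b)) has_vector_derivative f x * g' x + f' x * g x) (at 0)" for x
      using has_vector_derivative_mult[OF f(1) g(1), of x x] by simp
    moreover have "Ck n (\<lambda>x. f x * g' x + f' x * g x)"
      using Ck_Suc_imp_Ck[OF Suc.prems(1)] Ck_Suc_imp_Ck[OF Suc.prems(2)] f(2) g(2)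
      by (intro Ck_add Suc.IH)
    ultimately show ?thesis by (intro exI[of _ "\<lambda>x. f x * g' x + f' x * g x"] conjI allI)
  qed
  moreover have "continuous_on UNIV (\<lambda>x. f x * g x)"
    using Suc.prems by (intro continuous_on_mult) (simp_all only: Ck.simps)
  ultimately show ?case by simp
qed

lemma smooth_add: "smooth f \<Longrightarrow> smooth g \<Longrightarrow> smooth (\<lambda>x. f x + g x)"
  by (simp add: smooth_def Ck_add)

lemma smooth_mult: "smooth f \<Longrightarrow> smooth g \<Longrightarrow> smooth (\<lambda>x. f x * g x)"
  by (simp add: smooth_def Ck_mult)

lemma smooth_const: "smooth (\<lambda>x. c)"
  by (simp add: smooth_def Ck_const)

lemma smooth_diff: "smooth f \<Longrightarrow> smooth g \<Longrightarrow> smooth (\<lambda>x. f x - g x)"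
  using smooth_add[of f "\<lambda>x. (-1) * g x"] smooth_mult[OF smooth_const, of g "-1"] by simp

lemma smooth_prod: "(\<And>i. i \<in> I \<Longrightarrow> smooth (f i)) \<Longrightarrow> smooth (\<lambda>x. \<Prod>i\<in>I. f i x)"
  by (induction I rule: infinite_finite_induct) (auto intro: smooth_mult smooth_const)

lemma smooth_continuous_on: "smooth f \<Longrightarrow> continuous_on S f"
  unfolding smooth_def by (metis Ck.simps(1) continuous_on_subset subset_UNIV)

lemma smooth_has_partial_deriv_at_0:
  assumes "smooth f"
  shows "((\<lambda>t. f (x + t *\<^sub>R axis i 1)) has_vector_derivative partial_deriv i f x) (at 0)"
proof -
  have "Ck (Suc 0) f" using assms by (simp only: smooth_def)
  moreover have "axis i 1 \<in> (Basis :: (real^3) set)" by (simp add: axis_in_Basis_iff)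
  ultimately obtain g where "\<And>x. ((\<lambda>t. f (x + t *\<^sub>R axis i 1)) has_vector_derivative g x) (at 0)"
    using Ck_SucE by blast
  then show ?thesis
    unfolding partial_deriv_def by (metis vector_derivative_at)
qed

lemma smooth_has_partial_deriv:
  assumes "smooth f"
  shows "((\<lambda>t. f (x + t *\<^sub>R axis i 1)) has_vector_derivative partial_deriv i f (x + s *\<^sub>R axis i 1)) (at s)"
proof -
  have "(((\<lambda>t. f ((x + s *\<^sub>R axis i 1) + t *\<^sub>R axis i 1)) \<circ> (\<lambda>t. t - s)) has_vector_derivative
      1 *\<^sub>R partial_deriv i f (x + s *\<^sub>R axis i 1)) (at s)"
    by (rule vector_diff_chain_at) (auto intro!: derivative_eq_intros smooth_has_partial_deriv_at_0[OF assms])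
  then show ?thesis by (simp add: o_def algebra_simps)
qed

lemma partial_deriv_eqI:
  assumes "((\<lambda>t. f (x + t *\<^sub>R axis i 1)) has_vector_derivative d) (at 0)"
  shows "partial_deriv i f x = d"
  unfolding partial_deriv_def using assms by (rule vector_derivative_at)

lemma smooth_partial_deriv:
  assumes "smooth f"
  shows "smooth (partial_deriv i f)"
  unfolding smooth_def
proof
  fix n
  have "Ck (Suc n) f" using assms by (simp only: smooth_def)
  moreover have "axis i 1 \<in> (Basis :: (real^3) set)" by (simp add: axis_in_Basis_iff)
  ultimately obtain g where g: "\<And>x. ((\<lambda>t. f (x + t *\<^sub>R axis i 1)) has_vector_derivative g x) (at 0)" "Ck n g"
    using Ck_SucE by blast
  from g(1) have "partial_deriv i f = g" by (auto intro: partial_deriv_eqI)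
  with g show "Ck n (partial_deriv i f)" by simp
qed

lemma partial_deriv_mult:
  assumes "smooth f" "smooth g"
  shows "partial_deriv i (\<lambda>x. f x * g x) x = f x * partial_deriv i g x + partial_deriv i f x * g x"
  using has_vector_derivative_mult[OF smooth_has_partial_deriv_at_0[OF assms(1), of x i]
      smooth_has_partial_deriv_at_0[OF assms(2), of x i]]
  by (intro partial_deriv_eqI) simp

lemma partial_deriv_diff:
  assumes "smooth f" "smooth g"
  shows "partial_deriv i (\<lambda>x. f x - g x) x = partial_deriv i f x - partial_deriv i g x"
  using has_vector_derivative_diff[OF smooth_has_partial_deriv_at_0[OF assms(1), of x i]
      smooth_has_partial_deriv_at_0[OF assms(2), of x i]]
  by (intro partial_deriv_eqI) simp

section \<open>Bump functions and the fundamental lemma of the calculus of variations\<close>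

text \<open>
  These functions are closed under differentiation, so that one induction over all \<open>P\<close> at once proves
  that \<open>exp (- 1/t)\<close>, extended by zero, is smooth.
\<close>

definition flat :: "real poly \<Rightarrow> real \<Rightarrow> real" where
  "flat P t = (if t > 0 then poly P (1/t) * exp (-1/t) else 0)"

lemma flat_tendsto_0_right: "((\<lambda>t. poly P (1/t) * exp (-1/t)) \<longlongrightarrow> (0::real)) (at_right 0)"
proof -
  have "((\<lambda>x. poly P x * exp (-x)) \<longlongrightarrow> 0) at_top" for P :: "real poly"
  proof (induction P)
    case (pCons a P)
    have e: "((\<lambda>x::real. exp (-x)) \<longlongrightarrow> 0) at_top"
      by (rule filterlim_compose[OF exp_at_bot]) (rule filterlim_uminus_at_bot_at_top)
    have "((\<lambda>x::real. \<Sum>i\<le>degree (pCons a P). coeff (pCons a P) i * (x ^ i / exp x)) \<longlongrightarrow> (\<Sum>i\<le>degree (pCons a P). coeff (pCons a P) i * 0)) at_top"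
      by (intro tendsto_intros tendsto_power_div_exp_0)
    then show ?case by (simp add: poly_altdef exp_minus field_simps sum_distrib_left sum_divide_distrib sum_distrib_right)
  qed simp
  then have "((\<lambda>t. poly P (inverse t) * exp (- inverse t)) \<longlongrightarrow> 0) (at_right 0)"
    by (rule filterlim_compose[OF _ filterlim_inverse_at_top_right])
  then show ?thesis by (simp add: field_simps)
qed

lemma flat_has_derivative: "(flat P has_real_derivative flat ([:0, 0, 1:] * (P - pderiv P)) t) (at t)"
proof (cases t "0::real" rule: linorder_cases)
  case less
  have "((\<lambda>_. 0) has_real_derivative 0) (at t)" by simp
  then show ?thesis
    using less by (subst DERIV_cong_ev[OF refl _ refl, of _ "\<lambda>_. 0"])
      (auto simp: flat_def eventually_nhds intro!: exI[of _ "{..<0}"])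
next
  case greater
  have "((\<lambda>t. poly P (1/t) * exp (-1/t)) has_real_derivative flat ([:0, 0, 1:] * (P - pderiv P)) t) (at t)"
    using greater
    by (auto intro!: derivative_eq_intros DERIV_chain2[OF poly_DERIV] simp: flat_def field_simps power2_eq_square)
  then show ?thesis
    using greater by (subst DERIV_cong_ev[OF refl _ refl, of _ "\<lambda>t. poly P (1/t) * exp (-1/t)"])
      (auto simp: flat_def eventually_nhds intro!: exI[of _ "{0<..}"])
next
  case equal
  have "((\<lambda>h. flat P h / h) \<longlongrightarrow> 0) (at_right 0)"
  proof (rule Lim_transform_eventually[OF flat_tendsto_0_right[of "[:0, 1:] * P"]])
    show "\<forall>\<^sub>F t in at_right 0. poly ([:0, 1:] * P) (1/t) * exp (-1/t) = flat P t / t"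
      by (auto simp: eventually_at_filter flat_def field_simps)
  qed
  moreover have "((\<lambda>h. flat P h / h) \<longlongrightarrow> 0) (at_left 0)"
    by (rule Lim_transform_eventually[OF tendsto_const]) (auto simp: eventually_at_filter flat_def)
  ultimately have "((\<lambda>h. flat P h / h) \<longlongrightarrow> 0) (at 0)" by (simp add: filterlim_split_at_real filterlim_at_split)
  then show ?thesis by (simp add: equal DERIV_def flat_def)
qed

lemma Ck_flat_affine: "Ck n (\<lambda>x::real^3. complex_of_real (flat P (a \<bullet> x + c)))"
proof (induction n arbitrary: P)
  case 0
  have "continuous_on UNIV (flat P)" using flat_has_derivative by (meson DERIV_continuous_on)
  then have "continuous_on UNIV (\<lambda>x::real^3. flat P (a \<bullet> x + c))"
    by (rule continuous_on_compose2) (auto intro!: continuous_intros)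
  then show ?case by (auto intro!: continuous_intros)
next
  case (Suc n)
  let ?P = "[:0, 0, 1:] * (P - pderiv P)"
  have "((\<lambda>t. complex_of_real (flat P (a \<bullet> (x + t *\<^sub>R b) + c))) has_vector_derivative
      complex_of_real (a \<bullet> b) * complex_of_real (flat ?P (a \<bullet> x + c))) (at 0)" for x b
  proof -
    have "((\<lambda>t. flat P (a \<bullet> (x + t *\<^sub>R b) + c)) has_real_derivative flat ?P (a \<bullet> (x + 0 *\<^sub>R b) + c) * (a \<bullet> b)) (at 0)"
      by (rule DERIV_chain2[OF flat_has_derivative]) (auto intro!: derivative_eq_intros simp: inner_add_right)
    then show ?thesis
      using has_vector_derivative_of_real[of _ _ "at 0"]
      by (fastforce simp: has_real_derivative_iff_has_vector_derivative mult.commute)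
  qed
  moreover have "Ck n (\<lambda>x. complex_of_real (a \<bullet> b) * complex_of_real (flat ?P (a \<bullet> x + c)))" for b
    by (intro Ck_mult Ck_const Suc.IH)
  moreover have "continuous_on UNIV (\<lambda>x::real^3. complex_of_real (flat P (a \<bullet> x + c)))"
  proof -
    have "continuous_on UNIV (flat P)" using flat_has_derivative by (meson DERIV_continuous_on)
    then have "continuous_on UNIV (\<lambda>x::real^3. flat P (a \<bullet> x + c))"
      by (rule continuous_on_compose2) (auto intro!: continuous_intros)
    then show ?thesis by (auto intro!: continuous_intros)
  qed
  ultimately show ?case
    unfolding Ck.simps
    by (intro conjI ballI exI[of _ "\<lambda>x. complex_of_real (a \<bullet> b) * complex_of_real (flat ?P (a \<bullet> x + c))" for b] allI)
qed

text \<open>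
  For \<open>n \<rightarrow> \<infinity>\<close> the factors \<open>exp (- 1 / (n t))\<close> increase to the indicator of \<open>t > 0\<close>. Hence test functions
  approximate indicators of boxes boundedly and pointwise.
\<close>

definition bump :: "real^3 \<Rightarrow> real^3 \<Rightarrow> nat \<Rightarrow> real^3 \<Rightarrow> complex" where
  "bump l u n x = (\<Prod>i\<in>UNIV.
     complex_of_real (flat 1 (real n * (x $ i - l $ i))) * complex_of_real (flat 1 (real n * (u $ i - x $ i))))"

lemma smooth_bump: "smooth (bump l u n)"
proof -
  have "smooth (\<lambda>x. complex_of_real (flat 1 (real n * (x $ i - l $ i))))"
    and "smooth (\<lambda>x. complex_of_real (flat 1 (real n * (u $ i - x $ i))))" for i
    using Ck_flat_affine[of _ 1 "real n *\<^sub>R axis i 1" "- real n * l $ i"]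
      Ck_flat_affine[of _ 1 "- real n *\<^sub>R axis i 1" "real n * u $ i"]
    by (simp_all add: smooth_def inner_axis' algebra_simps)
  then show ?thesis
    unfolding bump_def by (intro smooth_prod smooth_mult)
qed

lemma bump_tendsto: "(\<lambda>n. bump l u n x) \<longlonglongrightarrow> indicator (box l u) x"
proof -
  have one: "(\<lambda>n. complex_of_real (flat 1 (real n * t))) \<longlonglongrightarrow> of_bool (0 < t)" for t
  proof (cases "0 < t")
    case True
    have "(\<lambda>n. exp (- (1/t) * (1 / real n))) \<longlonglongrightarrow> exp (- (1/t) * 0)"
      by (intro tendsto_intros lim_1_over_n)
    moreover have "\<forall>\<^sub>F n in sequentially. exp (- (1/t) * (1 / real n)) = flat 1 (real n * t)"
      using eventually_gt_at_top[of "0::nat"]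
      by eventually_elim (use True in \<open>auto simp: flat_def field_simps\<close>)
    ultimately have "(\<lambda>n. flat 1 (real n * t)) \<longlonglongrightarrow> 1"
      by (auto intro: Lim_transform_eventually)
    from tendsto_of_real[OF this] True show ?thesis by simp
  next
    case False
    then have "flat 1 (real n * t) = 0" for n
      by (auto simp: flat_def zero_less_mult_iff)
    with False show ?thesis by simp
  qed
  have "(\<lambda>n. bump l u n x) \<longlonglongrightarrow> (\<Prod>i\<in>UNIV. of_bool (0 < x $ i - l $ i) * of_bool (0 < u $ i - x $ i))"
    unfolding bump_def by (intro tendsto_prod tendsto_mult one)
  also have "(\<Prod>i\<in>UNIV. of_bool (0 < x $ i - l $ i) * of_bool (0 < u $ i - x $ i)) = (indicator (box l u) x :: complex)"
    by (auto simp: indicator_def mem_box_cart)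
  finally show ?thesis .
qed

lemma cmod_bump_le_1: "cmod (bump l u n x) \<le> 1"
proof -
  have "\<bar>flat 1 t\<bar> \<le> 1" for t by (simp add: flat_def)
  then show ?thesis
    unfolding bump_def prod_norm[symmetric]
    by (intro prod_le_1) (auto simp: norm_mult intro!: mult_le_one)
qed

lemma bump_eq_0:
  assumes "x \<notin> cbox l u"
  shows "bump l u n x = 0"
proof -
  obtain i where "x $ i < l $ i \<or> u $ i < x $ i"
    using assms by (auto simp: mem_box_cart not_le)
  then have "flat 1 (real n * (x $ i - l $ i)) = 0 \<or> flat 1 (real n * (u $ i - x $ i)) = 0"
    by (auto simp: flat_def zero_less_mult_iff)
  then show ?thesis unfolding bump_def by (intro prod_zero) auto
qed

lemma bump_in_test_functions:
  assumes "cbox l u \<subseteq> \<Omega>"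
  shows "bump l u n \<in> test_functions \<Omega>"
proof -
  have "closure {x. bump l u n x \<noteq> 0} \<subseteq> cbox l u"
    by (intro closure_minimal closed_cbox) (use bump_eq_0 in blast)
  moreover from this have "compact (closure {x. bump l u n x \<noteq> 0})"
    by (meson bounded_cbox bounded_subset closed_closure compact_eq_bounded_closed)
  ultimately show ?thesis
    using assms smooth_bump by (auto simp: test_functions_def)
qed

lemma sigma_finite_lebesgue: "sigma_finite_measure (lebesgue :: 'a::euclidean_space measure)"
proof -
  obtain A :: "'a set set" where "countable A" "A \<subseteq> sets lborel" "\<Union>A = space lborel" "\<forall>a\<in>A. emeasure lborel a \<noteq> \<infinity>"
    using lborel.sigma_finite_countable by blast
  then show ?thesis
    by (intro sigma_finite_measure.intro exI[of _ A]) (auto simp: emeasure_completion subset_iff)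
qed

text \<open>
  The sets over which \<open>f\<close> integrates to zero form a Dynkin system, and the boxes are an
  intersection-stable generator of the Borel sets.
\<close>

lemma AE_zero_of_box_integrals_zero:
  fixes f :: "real^3 \<Rightarrow> complex"
  assumes f: "integrable lebesgue f"
    and zero: "\<And>l u. (LINT x|lebesgue. indicator (box l u) x *\<^sub>R f x) = 0"
  shows "AE x in lebesgue. f x = 0"
proof (rule sigma_finite_measure.density_zero[OF sigma_finite_lebesgue f])
  have int: "integrable lebesgue (\<lambda>x. indicator A x *\<^sub>R f x)" if "A \<in> sets borel" for A
    using that f by (intro integrable_mult_indicator) auto
  \<comment> \<open>The Dynkin argument needs the whole space, which is an increasing union of boxes.\<close>
  have UNIV0: "(LINT x|lebesgue. f x) = 0"
  proof -
    have "(\<lambda>n. LINT x|lebesgue. indicator (box (- (\<chi> i. real n)) (\<chi> i. real n)) x *\<^sub>R f x) \<longlonglongrightarrow> (LINT x|lebesgue. f x)"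
    proof (rule integral_dominated_convergence[where w = "\<lambda>x. cmod (f x)"])
      show "AE x in lebesgue. (\<lambda>n. indicator (box (- (\<chi> i. real n)) (\<chi> i. real n)) x *\<^sub>R f x) \<longlonglongrightarrow> f x"
      proof (intro AE_I2 tendsto_eventually)
        fix x :: "real^3"
        obtain N where N: "norm x < real N" using reals_Archimedean2 by blast
        have "x \<in> box (- (\<chi> i. real n)) (\<chi> i. real n)" if "N \<le> n" for n
        proof -
          have "\<bar>x $ i\<bar> < real n" for i
            using component_le_norm_cart[of x i] N that by linarith
          then show ?thesis by (simp add: mem_box_cart abs_less_iff) (meson minus_less_iff)
        qed
        then show "\<forall>\<^sub>F n in sequentially. indicator (box (- (\<chi> i. real n)) (\<chi> i. real n)) x *\<^sub>R f x = f x"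
          by (auto simp: eventually_sequentially intro!: exI[of _ N])
      qed
    qed (use f int in \<open>auto simp: indicator_def\<close>)
    then show ?thesis using zero LIMSEQ_unique[OF _ tendsto_const] by simp
  qed
  have borel: "(LINT x|lebesgue. indicator A x *\<^sub>R f x) = 0" if "A \<in> sets borel" for A
  proof -
    have sets: "sets borel = sigma_sets UNIV (range (\<lambda>(a, b). box a b :: (real^3) set))"
      unfolding borel_eq_box by simp
    have IS: "Int_stable (range (\<lambda>(a, b). box a b :: (real^3) set))"
      by (auto simp: Int_stable_def box_Int_box)
    have "range (\<lambda>(a, b). box a b :: (real^3) set) \<subseteq> Pow UNIV" by simp
    moreover have "A \<in> sigma_sets UNIV (range (\<lambda>(a, b). box a b :: (real^3) set))"
      using that sets by simp
    ultimately show ?thesis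
    proof (induction rule: sigma_sets_induct_disjoint[OF IS, consumes 2, case_names basic empty compl union])
      case (basic A) then show ?case using zero by auto
    next
      case empty show ?case by simp
    next
      case (compl A)
      then have A: "A \<in> sets borel" using sets by simp
      have "indicator (UNIV - A) x *\<^sub>R f x = f x - indicator A x *\<^sub>R f x" for x
        by (auto simp: indicator_def)
      with compl.IH UNIV0 int[OF A] f show ?case by simp
    next
      case (union A)
      then have A: "A i \<in> sets borel" for i using sets by auto
      have "(LINT x:(\<Union>i. A i)|lebesgue. f x) = (\<Sum>i. LINT x:A i|lebesgue. f x)"
        using union(1) A f by (intro lebesgue_integral_countable_add)
          (auto simp: disjoint_family_on_def set_integrable_def intro!: integrable_mult_indicator)
      with union(3) show ?case by (simp add: set_lebesgue_integral_def)
    qed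
  qed
  fix A :: "(real^3) set" assume "A \<in> sets lebesgue"
  then obtain C T where C: "C \<in> sets borel" "negligible T" "C \<union> T = A"
    using sets_lebesgue_almost_borel by blast
  have "AE x in lebesgue. x \<notin> T"
    using C(2) by (simp add: negligible_iff_null_sets AE_not_in)
  then have "(LINT x|lebesgue. indicator A x *\<^sub>R f x) = (LINT x|lebesgue. indicator C x *\<^sub>R f x)"
    using C(3)
    by (intro integral_cong_AE borel_measurable_integrable[OF int[OF C(1)]]
        borel_measurable_integrable[OF integrable_mult_indicator[OF \<open>A \<in> sets lebesgue\<close> f]])
      (auto simp: indicator_def elim!: eventually_mono)
  then show "set_lebesgue_integral lebesgue A f = 0"
    using borel[OF C(1)] by (simp add: set_lebesgue_integral_def)
qed

text \<open>
  The fundamental lemma of the calculus of variations. It makes weak gradients unique almost everywhere,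
  which is what identifies the representative chosen by \<open>weak_grad\<close> for a smooth function.
\<close>

lemma AE_zero_of_test_integrals_zero:
  assumes \<Omega>: "open \<Omega>" and f: "integrable (lebesgue_on \<Omega>) f"
    and zero: "\<And>\<phi>. \<phi> \<in> test_functions \<Omega> \<Longrightarrow> (LINT x|lebesgue_on \<Omega>. f x * \<phi> x) = 0"
  shows "AE x in lebesgue_on \<Omega>. f x = 0"
proof -
  have \<Omega>m [measurable]: "\<Omega> \<in> sets lebesgue" "\<Omega> \<in> sets borel" using \<Omega> by auto
  have f': "integrable lebesgue (\<lambda>x. indicator \<Omega> x *\<^sub>R f x)"
    using f by (simp add: integrable_restrict_space)
  have box0: "(LINT x|lebesgue. indicator (box l u) x *\<^sub>R (indicator \<Omega> x *\<^sub>R f x)) = 0"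
    if sub: "cbox l u \<subseteq> \<Omega>" for l u
  proof -
    have "(\<lambda>n. LINT x|lebesgue. (indicator \<Omega> x *\<^sub>R f x) * bump l u n x) \<longlonglongrightarrow>
        (LINT x|lebesgue. (indicator \<Omega> x *\<^sub>R f x) * indicator (box l u) x)"
    proof (rule integral_dominated_convergence[where w = "\<lambda>x. cmod (indicator \<Omega> x *\<^sub>R f x)"])
      show "AE x in lebesgue. (\<lambda>n. (indicator \<Omega> x *\<^sub>R f x) * bump l u n x) \<longlonglongrightarrow>
          (indicator \<Omega> x *\<^sub>R f x) * indicator (box l u) x"
        by (intro always_eventually allI tendsto_mult tendsto_const bump_tendsto)
      show "AE x in lebesgue. cmod ((indicator \<Omega> x *\<^sub>R f x) * bump l u n x) \<le> cmod (indicator \<Omega> x *\<^sub>R f x)" for n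
        unfolding norm_mult
        by (intro always_eventually allI mult_right_le_one_le norm_ge_zero cmod_bump_le_1)
      have "bump l u n \<in> borel_measurable borel" for n
        by (intro borel_measurable_continuous_onI smooth_continuous_on smooth_bump)
      then have bm: "bump l u n \<in> borel_measurable lebesgue" for n
        by (intro measurable_completion) simp
      show "(\<lambda>x. (indicator \<Omega> x *\<^sub>R f x) * bump l u n x) \<in> borel_measurable lebesgue" for n
        by (intro borel_measurable_times borel_measurable_integrable[OF f'] bm)
      show "(\<lambda>x. (indicator \<Omega> x *\<^sub>R f x) * indicator (box l u) x) \<in> borel_measurable lebesgue"
        by (intro borel_measurable_times borel_measurable_integrable[OF f'] borel_measurable_indicator) auto
    qed (rule integrable_norm[OF f'])
    moreover have "(LINT x|lebesgue. (indicator \<Omega> x *\<^sub>R f x) * bump l u n x) = 0" for n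
      using zero[OF bump_in_test_functions[OF sub, of n]] by (simp add: integral_restrict_space)
    ultimately have "(LINT x|lebesgue. (indicator \<Omega> x *\<^sub>R f x) * indicator (box l u) x) = 0"
      using LIMSEQ_unique[OF _ tendsto_const] by auto
    moreover have "(indicator \<Omega> x *\<^sub>R f x) * indicator (box l u) x =
        indicator (box l u) x *\<^sub>R (indicator \<Omega> x *\<^sub>R f x)" for x
      by (simp add: indicator_def)
    ultimately show ?thesis by simp
  qed
  have cb: "AE x in lebesgue. x \<in> cbox l u \<longrightarrow> f x = 0" if sub: "cbox l u \<subseteq> \<Omega>" for l u
  proof -
    have "AE x in lebesgue. indicator (box l u) x *\<^sub>R (indicator \<Omega> x *\<^sub>R f x) = 0"
    proof (rule AE_zero_of_box_integrals_zero)
      show "integrable lebesgue (\<lambda>x. indicator (box l u) x *\<^sub>R (indicator \<Omega> x *\<^sub>R f x))"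
        by (rule integrable_mult_indicator[OF _ f']) auto
      \<comment> \<open>Cutting off with one box keeps all intersections compactly inside \<open>\<Omega>\<close>.\<close>
      fix l' u' :: "real^3"
      obtain l2 u2 where lu: "box l' u' \<inter> box l u = box l2 u2" using box_Int_box[of l' u' l u] by blast
      show "(LINT x|lebesgue. indicator (box l' u') x *\<^sub>R (indicator (box l u) x *\<^sub>R (indicator \<Omega> x *\<^sub>R f x))) = 0"
      proof (cases "box l2 u2 = {}")
        case True
        then have "(\<lambda>x. indicator (box l' u') x *\<^sub>R (indicator (box l u) x *\<^sub>R (indicator \<Omega> x *\<^sub>R f x))) = (\<lambda>x. 0)"
          using lu by (intro ext) (auto split: split_indicator)
        then show ?thesis by (simp only: integral_zero)
      next
        case False
        then have "cbox l2 u2 = closure (box l2 u2)" by simp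
        also have "\<dots> \<subseteq> cbox l u" using lu by (intro closure_minimal closed_cbox) (use box_subset_cbox in blast)
        finally have "cbox l2 u2 \<subseteq> \<Omega>" using sub by blast
        then show ?thesis using box0[of l2 u2] by (simp add: lu[symmetric] indicator_inter_arith mult_ac)
      qed
    qed
    moreover have "AE x in lebesgue. x \<notin> cbox l u - box l u"
      using negligible_frontier_interval[of l u] unfolding negligible_iff_null_sets by (rule AE_not_in)
    ultimately show ?thesis
      by eventually_elim (use sub in \<open>auto simp: indicator_def split: if_splits\<close>)
  qed
  obtain \<D> where D: "countable \<D>" "\<D> \<subseteq> Pow \<Omega>" "\<And>X. X \<in> \<D> \<Longrightarrow> \<exists>a b. X = cbox a b" "\<Union>\<D> = \<Omega>"
    using open_countable_Union_open_cbox[OF \<Omega>] by metis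
  have "AE x in lebesgue. \<forall>X\<in>\<D>. x \<in> X \<longrightarrow> f x = 0"
    using D(1,2,3) cb by (subst AE_ball_countable) (auto, blast)
  then have "AE x in lebesgue. x \<in> \<Omega> \<longrightarrow> f x = 0"
    by eventually_elim (use D(4) in auto)
  then show ?thesis by (simp add: AE_restrict_space_iff)
qed

section \<open>Flux through the boundary of a bounded open set\<close>

text \<open>
  The region passed over when \<open>A\<close> moves by \<open>h e\<close>. For the boundary of \<open>\<Omega>\<close> it contains the symmetric
  difference of \<open>\<Omega>\<close> and its translate.
\<close>

definition swept :: "'a::real_normed_vector \<Rightarrow> real \<Rightarrow> 'a set \<Rightarrow> 'a set" where
  "swept e h A = {x. \<exists>t\<in>{0..h}. x - t *\<^sub>R e \<in> A}"

lemma compact_swept: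
  assumes "compact A"
  shows "compact (swept e h A)"
proof -
  have "swept e h A = (\<lambda>(a, t). a + t *\<^sub>R e) ` (A \<times> {0..h})"
  proof (intro set_eqI iffI)
    fix x assume "x \<in> swept e h A"
    then obtain t where "t \<in> {0..h}" "x - t *\<^sub>R e \<in> A" by (auto simp: swept_def)
    then show "x \<in> (\<lambda>(a, t). a + t *\<^sub>R e) ` (A \<times> {0..h})"
      by (intro image_eqI[of _ _ "(x - t *\<^sub>R e, t)"]) auto
  next
    fix x assume "x \<in> (\<lambda>(a, t). a + t *\<^sub>R e) ` (A \<times> {0..h})"
    then obtain a t where "a \<in> A" "t \<in> {0..h}" "x = a + t *\<^sub>R e" by auto
    then show "x \<in> swept e h A" unfolding swept_def by (intro CollectI bexI[of _ t]) auto
  qed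
  moreover have "compact ((\<lambda>(a, t). a + t *\<^sub>R e) ` (A \<times> {0..h}))"
    by (intro compact_continuous_image compact_Times assms)
      (auto simp: split_beta intro!: continuous_intros)
  ultimately show ?thesis by simp
qed

text \<open>
  A set of diameter \<open>d\<close> lies in a cube of side \<open>2 d\<close>, so the swept region lies in a box with sides
  \<open>2 d\<close>, \<open>2 d\<close> and \<open>2 d + h\<close>. The assumption \<open>d \<le> h\<close> makes its volume of order \<open>h d\<^sup>2\<close>, the scaling of
  two-dimensional Hausdorff measure.
\<close>

lemma emeasure_swept_small:
  fixes C :: "(real^3) set"
  assumes C: "bounded C" "diameter C \<le> h" and h: "0 \<le> h"
  shows "\<exists>B\<in>sets borel. swept (axis i 1) h C \<subseteq> B \<and>
    emeasure lborel B \<le> ennreal (16 * h) * ennreal ((diameter C)\<^sup>2)"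
proof (cases "C = {}")
  case True
  then show ?thesis by (intro bexI[of _ "{}"]) (auto simp: swept_def)
next
  case False
  then obtain y where y: "y \<in> C" by blast
  define d where "d = diameter C"
  have d: "0 \<le> d" "d \<le> h" using C by (auto simp: d_def diameter_ge_0)
  define l where "l = (\<chi> j. y $ j - d)"
  define u where "u = (\<chi> j. y $ j + (if j = i then d + h else d))"
  have "swept (axis i 1) h C \<subseteq> cbox l u"
  proof
    fix x assume "x \<in> swept (axis i 1) h C"
    then obtain t where t: "0 \<le> t" "t \<le> h" "x - t *\<^sub>R axis i 1 \<in> C" by (auto simp: swept_def)
    have "norm (x - t *\<^sub>R axis i 1 - y) \<le> d"
      using diameter_bounded_bound[OF C(1) t(3) y] by (simp add: d_def dist_norm)
    then have "\<bar>(x - t *\<^sub>R axis i 1 - y) $ j\<bar> \<le> d" for j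
      using component_le_norm_cart order_trans by blast
    then have "\<bar>x $ j - (if j = i then t else 0) - y $ j\<bar> \<le> d" for j
      by (simp add: axis_def if_distrib cong: if_cong)
    with t h show "x \<in> cbox l u"
      by (auto simp: mem_box_cart l_def u_def abs_le_iff split: if_splits)
        (smt (verit))+
  qed
  moreover have "emeasure lborel (cbox l u) \<le> ennreal (16 * h) * ennreal (d\<^sup>2)"
  proof -
    have "emeasure lborel (cbox l u) = ennreal (\<Prod>j\<in>UNIV. u $ j - l $ j)"
    proof -
      have "\<forall>j. l $ j \<le> u $ j" using d h by (auto simp: l_def u_def)
      then have "measure lborel (cbox l u) = (\<Prod>j\<in>UNIV. u $ j - l $ j)"
        by (subst content_cbox_cart) (auto simp: interval_ne_empty_cart)
      then show ?thesis
        using emeasure_lborel_cbox_finite[of l u] by (subst emeasure_eq_ennreal_measure) auto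
    qed
    also have "(\<Prod>j\<in>UNIV. u $ j - l $ j) = (2 * d + h) * (2 * d)\<^sup>2"
    proof -
      have "(\<Prod>j\<in>UNIV. u $ j - l $ j) = (u $ i - l $ i) * (\<Prod>j\<in>UNIV - {i}. u $ j - l $ j)"
        by (subst prod.remove[of _ i]) auto
      also have "(\<Prod>j\<in>UNIV - {i}. u $ j - l $ j) = (\<Prod>j\<in>UNIV - {i}. 2 * d)"
        by (intro prod.cong) (auto simp: u_def l_def)
      finally show ?thesis by (simp add: card_Diff_singleton u_def l_def)
    qed
    also have "ennreal ((2 * d + h) * (2 * d)\<^sup>2) \<le> ennreal ((16 * h) * d\<^sup>2)"
    proof (rule ennreal_leI)
      have "(2 * d + h) * (4 * d\<^sup>2) \<le> (4 * h) * (4 * d\<^sup>2)"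
        using d by (intro mult_right_mono) auto
      then show "(2 * d + h) * (2 * d)\<^sup>2 \<le> (16 * h) * d\<^sup>2" by (simp add: power2_eq_square algebra_simps)
    qed
    also have "\<dots> = ennreal (16 * h) * ennreal (d\<^sup>2)" using h by (intro ennreal_mult) auto
    finally show ?thesis .
  qed
  ultimately show ?thesis by (intro bexI[of _ "cbox l u"]) (auto simp: d_def)
qed

text \<open>
  Covers by sets of diameter at most \<open>h\<close> are admissible for the pre-measure at scale \<open>h\<close>, which is below
  the Hausdorff measure. The constant is \<open>16\<close> from a single covering set times \<open>4 / \<pi>\<close> from the
  normalisation of the measure. Compactness of \<open>A\<close> serves to make the swept set measurable.
\<close>

lemma emeasure_swept_le:
  fixes A :: "(real^3) set"
  assumes A: "compact A" and h: "0 < h"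
  shows "emeasure lborel (swept (axis i 1) h A) \<le> ennreal (64 / pi * h) * emeasure hausdorff2 A"
proof -
  let ?V = "emeasure lborel (swept (axis i 1) h A)" and ?c = "ennreal (64 / pi * h)"
  have cover: "?V \<le> ?c * (\<Sum>j. ennreal (pi / 4 * (diameter (C j))\<^sup>2))"
    if C: "A \<subseteq> (\<Union>j. C j)" "\<And>j::nat. bounded (C j) \<and> diameter (C j) \<le> h" for C
  proof -
    have "\<exists>B\<in>sets borel. swept (axis i 1) h (C j) \<subseteq> B \<and>
        emeasure lborel B \<le> ennreal (16 * h) * ennreal ((diameter (C j))\<^sup>2)" for j
      using C(2) h by (intro emeasure_swept_small) auto
    then obtain B where B: "\<And>j. B j \<in> sets borel" "\<And>j. swept (axis i 1) h (C j) \<subseteq> B j"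
      "\<And>j. emeasure lborel (B j) \<le> ennreal (16 * h) * ennreal ((diameter (C j))\<^sup>2)" by metis
    have "swept (axis i 1) h A \<subseteq> (\<Union>j. swept (axis i 1) h (C j))"
      using C(1) by (fastforce simp: swept_def)
    then have "swept (axis i 1) h A \<subseteq> (\<Union>j. B j)" using B(2) by blast
    then have "?V \<le> emeasure lborel (\<Union>j. B j)" using B(1) by (intro emeasure_mono) auto
    also have "\<dots> \<le> (\<Sum>j. emeasure lborel (B j))"
      using B(1) by (intro emeasure_subadditive_countably) auto
    also have "\<dots> \<le> (\<Sum>j. ?c * ennreal (pi / 4 * (diameter (C j))\<^sup>2))"
    proof (intro suminf_le allI)
      fix j
      have "ennreal (16 * h) * ennreal ((diameter (C j))\<^sup>2) = ?c * ennreal (pi / 4 * (diameter (C j))\<^sup>2)"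
        using h by (simp add: ennreal_mult[symmetric])
      with B(3)[of j] show "emeasure lborel (B j) \<le> ?c * ennreal (pi / 4 * (diameter (C j))\<^sup>2)" by simp
    qed auto
    finally show ?thesis by (simp add: ennreal_suminf_cmult)
  qed
  have c: "0 < ?c" using h by simp
  have "?V / ?c \<le> hausdorff2_pre h A"
    unfolding hausdorff2_pre_def
  proof (rule INF_greatest)
    fix C :: "nat \<Rightarrow> (real^3) set"
    assume "C \<in> {C. A \<subseteq> (\<Union>i. C i) \<and> (\<forall>i. bounded (C i) \<and> diameter (C i) \<le> h)}"
    then have "?V \<le> ?c * (\<Sum>j. ennreal (pi / 4 * (diameter (C j))\<^sup>2))"
      by (intro cover) auto
    then show "?V / ?c \<le> (\<Sum>j. ennreal (pi / 4 * (diameter (C j))\<^sup>2))"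
      by (rule divide_le_posI_ennreal[OF c])
  qed
  also have "hausdorff2_pre h A \<le> hausdorff2_outer A"
    unfolding hausdorff2_outer_def using h by (intro SUP_upper) auto
  also have "hausdorff2_outer A = emeasure hausdorff2 A"
    using A by (intro emeasure_hausdorff2[symmetric] borel_closed compact_imp_closed)
  finally have "?c * (?V / ?c) \<le> ?c * emeasure hausdorff2 A" by (rule mult_left_mono) simp
  moreover have "?c * (?V / ?c) = ?V"
    unfolding ennreal_times_divide mult.commute[of ?c ?V] using c by (intro ennreal_mult_divide_eq) auto
  ultimately show ?thesis by simp
qed

text \<open>
  Up to an error \<open>\<eta>\<close>, a value \<open>r\<close> is \<open>\<eta>\<close> times the number of levels \<open>k \<eta>\<close> not above it. This is the
  layer-cake formula in finite form.
\<close>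

lemma layer_count:
  fixes r \<eta> :: real
  assumes "0 \<le> r" "0 < \<eta>"
  shows "r < (real N + 1) * \<eta> \<Longrightarrow> r \<le> \<eta> * real (card {k. k \<le> N \<and> real k * \<eta> \<le> r})"
    and "\<eta> * real (card {k \<in> {1..N}. real k * \<eta> \<le> r}) \<le> r"
proof -
  define m where "m = nat \<lfloor>r / \<eta>\<rfloor>"
  have m: "real m \<le> r / \<eta>" "r / \<eta> < real m + 1"
    using assms by (auto simp: m_def of_nat_nat)
  have le: "real k * \<eta> \<le> r \<longleftrightarrow> k \<le> m" for k
  proof -
    have "real k * \<eta> \<le> r \<longleftrightarrow> real k \<le> r / \<eta>" using assms by (simp add: field_simps)
    also have "\<dots> \<longleftrightarrow> k \<le> m" using m by linarith
    finally show ?thesis .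
  qed
  show "r \<le> \<eta> * real (card {k. k \<le> N \<and> real k * \<eta> \<le> r})" if "r < (real N + 1) * \<eta>"
  proof -
    have "r / \<eta> < real N + 1" using that assms by (simp add: field_simps)
    then have "m \<le> N" using m by linarith
    then have "{k. k \<le> N \<and> real k * \<eta> \<le> r} = {..m}" by (auto simp: le)
    then show ?thesis using m assms by (simp add: field_simps)
  qed
  have "card {k \<in> {1..N}. real k * \<eta> \<le> r} \<le> card {1..m}"
    by (intro card_mono) (auto simp: le)
  then have "real (card {k \<in> {1..N}. real k * \<eta> \<le> r}) \<le> r / \<eta>" using m by simp
  then show "\<eta> * real (card {k \<in> {1..N}. real k * \<eta> \<le> r}) \<le> r" using assms by (simp add: field_simps)
qed

text \<open>
  The volume bound for sets passes to integrals by applying it to the superlevel sets of \<open>|f|\<close> on \<open>A\<close>.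
  They are compact, and moving along the sweep changes \<open>|f|\<close> by at most \<open>\<eta>\<close>. The level \<open>k = 0\<close> and this
  error account for the two additional terms \<open>\<eta> H\<^sup>2(A)\<close>.
\<close>

lemma nn_integral_swept_le:
  fixes f :: "real^3 \<Rightarrow> complex"
  assumes A: "compact A" and f: "continuous_on UNIV f" and \<eta>: "0 < \<eta>" and h: "0 < h"
    and close: "\<And>y t. y \<in> A \<Longrightarrow> 0 \<le> t \<Longrightarrow> t \<le> h \<Longrightarrow> cmod (f (y + t *\<^sub>R axis i 1)) \<le> cmod (f y) + \<eta>"
  shows "(\<integral>\<^sup>+x. ennreal (cmod (f x)) * indicator (swept (axis i 1) h A) x \<partial>lborel) \<le>
    ennreal (64 / pi * h) * ((\<integral>\<^sup>+y. ennreal (cmod (f y)) * indicator A y \<partial>hausdorff2) + ennreal (2 * \<eta>) * emeasure hausdorff2 A)"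
proof -
  let ?e = "axis i 1 :: real^3" and ?c = "ennreal (64 / pi * h)"
  let ?J = "\<integral>\<^sup>+y. ennreal (cmod (f y)) * indicator A y \<partial>hausdorff2"
  let ?H = "emeasure hausdorff2 :: (real^3) set \<Rightarrow> ennreal"
  have [measurable]: "f \<in> borel_measurable borel" using f by (rule borel_measurable_continuous_onI)
  have "compact (f ` A)" by (intro compact_continuous_image A continuous_on_subset[OF f]) auto
  then obtain B where B: "\<And>y. y \<in> A \<Longrightarrow> cmod (f y) \<le> B"
    using compact_imp_bounded bounded_iff by (metis image_eqI)
  obtain N where "B / \<eta> < real N" using reals_Archimedean2 by blast
  then have N: "B < (real N + 1) * \<eta>" using \<eta> by (simp add: field_simps)
  \<comment> \<open>\<open>N\<close> is so large that all values of \<open>|f|\<close> on \<open>A\<close> are below \<open>(N + 1) \<eta>\<close>.\<close>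
  define E where "E k = {y \<in> A. real k * \<eta> \<le> cmod (f y)}" for k
  have "closed {y. real k * \<eta> \<le> cmod (f y)}" for k
    by (intro closed_Collect_le continuous_intros f)
  then have E: "compact (E k)" for k
    unfolding E_def Collect_conj_eq Collect_mem_eq using A by (intro compact_Int_closed) auto
  have E0: "E 0 = A" by (auto simp: E_def)
  have meas [measurable]: "swept ?e h (E k) \<in> sets borel" "E k \<in> sets borel" for k
    by (auto intro!: borel_closed compact_imp_closed compact_swept E)
  have pt: "ennreal (cmod (f x)) * indicator (swept ?e h A) x \<le>
      ennreal \<eta> * indicator (swept ?e h (E 0)) x + (\<Sum>k\<le>N. ennreal \<eta> * indicator (swept ?e h (E k)) x)" for x
  proof (cases "x \<in> swept ?e h A")
    case True
    then obtain t where t: "0 \<le> t" "t \<le> h" "x - t *\<^sub>R ?e \<in> A" by (auto simp: swept_def)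
    define y where "y = x - t *\<^sub>R ?e"
    have "cmod (f x) \<le> \<eta> + cmod (f y)" using close[of y t] t by (simp add: y_def)
    also have "cmod (f y) \<le> \<eta> * real (card {k. k \<le> N \<and> real k * \<eta> \<le> cmod (f y)})"
      using B[of y] N t \<eta> by (intro layer_count) (auto simp: y_def)
    also have "\<dots> = (\<Sum>k\<le>N. \<eta> * of_bool (real k * \<eta> \<le> cmod (f y)))"
      by (simp add: sum_distrib_left[symmetric] of_bool_def sum.If_cases Int_def)
    also have "\<dots> \<le> (\<Sum>k\<le>N. \<eta> * indicator (swept ?e h (E k)) x)"
    proof (intro sum_mono mult_left_mono)
      fix k
      show "of_bool (real k * \<eta> \<le> cmod (f y)) \<le> (indicator (swept ?e h (E k)) x :: real)"
        using t by (auto simp: y_def E_def swept_def indicator_def)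
    qed (use \<eta> in auto)
    finally have "ennreal (cmod (f x)) \<le> ennreal (\<eta> + (\<Sum>k\<le>N. \<eta> * indicator (swept ?e h (E k)) x))"
      by (intro ennreal_leI) simp
    also have "\<dots> = ennreal \<eta> + (\<Sum>k\<le>N. ennreal (\<eta> * indicator (swept ?e h (E k)) x))"
      using \<eta> by (subst ennreal_plus) (auto intro!: sum_nonneg)
    also have "\<dots> = ennreal \<eta> * indicator (swept ?e h (E 0)) x + (\<Sum>k\<le>N. ennreal \<eta> * indicator (swept ?e h (E k)) x)"
      using True \<eta> by (simp add: E0 ennreal_mult ennreal_indicator)
    finally show ?thesis using True by simp
  qed simp
  have "(\<integral>\<^sup>+x. ennreal (cmod (f x)) * indicator (swept ?e h A) x \<partial>lborel) \<le>
      (\<integral>\<^sup>+x. ennreal \<eta> * indicator (swept ?e h (E 0)) x + (\<Sum>k\<le>N. ennreal \<eta> * indicator (swept ?e h (E k)) x) \<partial>lborel)"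
    by (intro nn_integral_mono pt)
  also have "\<dots> = ennreal \<eta> * emeasure lborel (swept ?e h (E 0)) + (\<Sum>k\<le>N. ennreal \<eta> * emeasure lborel (swept ?e h (E k)))"
    by (subst nn_integral_add, measurable, subst nn_integral_sum, measurable) (simp add: nn_integral_cmult)
  also have "\<dots> \<le> ennreal \<eta> * (?c * ?H (E 0)) + (\<Sum>k\<le>N. ennreal \<eta> * (?c * ?H (E k)))"
    by (intro add_mono sum_mono mult_left_mono emeasure_swept_le E h) auto
  also have "\<dots> = ?c * (ennreal \<eta> * ?H (E 0) + (\<Sum>k\<le>N. ennreal \<eta> * ?H (E k)))"
    by (simp only: distrib_left sum_distrib_left mult.left_commute)
  also have "(\<Sum>k\<le>N. ennreal \<eta> * ?H (E k)) =
      ennreal \<eta> * ?H (E 0) + (\<Sum>k\<in>{1..N}. ennreal \<eta> * ?H (E k))"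
    by (subst sum.remove[of _ 0]) (auto intro!: sum.cong arg_cong2[of _ _ _ _ "(+)"])
  finally have main: "(\<integral>\<^sup>+x. ennreal (cmod (f x)) * indicator (swept ?e h A) x \<partial>lborel) \<le>
      ?c * (ennreal \<eta> * ?H A + (ennreal \<eta> * ?H A +
        (\<Sum>k\<in>{1..N}. ennreal \<eta> * ?H (E k))))"
    unfolding E0 .
  have "(\<Sum>k\<in>{1..N}. ennreal \<eta> * ?H (E k)) \<le> ?J"
  proof -
    have "(\<Sum>k\<in>{1..N}. ennreal \<eta> * ?H (E k)) = (\<integral>\<^sup>+y. (\<Sum>k\<in>{1..N}. ennreal \<eta> * indicator (E k) y) \<partial>hausdorff2)"
      by (subst nn_integral_sum, measurable) (simp add: nn_integral_cmult)
    also have "\<dots> \<le> ?J"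
    proof (intro nn_integral_mono)
      fix y
      show "(\<Sum>k\<in>{1..N}. ennreal \<eta> * indicator (E k) y) \<le> ennreal (cmod (f y)) * indicator A y"
      proof (cases "y \<in> A")
        case True
        have "(\<Sum>k\<in>{1..N}. ennreal \<eta> * indicator (E k) y) = (\<Sum>k\<in>{1..N}. ennreal (\<eta> * of_bool (real k * \<eta> \<le> cmod (f y))))"
          using True by (intro sum.cong) (auto simp: E_def indicator_def)
        also have "\<dots> = ennreal (\<Sum>k\<in>{1..N}. \<eta> * of_bool (real k * \<eta> \<le> cmod (f y)))"
          using \<eta> by (intro sum_ennreal) auto
        also have "(\<Sum>k\<in>{1..N}. \<eta> * of_bool (real k * \<eta> \<le> cmod (f y))) = \<eta> * real (card {k \<in> {1..N}. real k * \<eta> \<le> cmod (f y)})"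
          by (simp add: sum_distrib_left[symmetric] of_bool_def sum.If_cases Int_def)
        also have "ennreal \<dots> \<le> ennreal (cmod (f y))"
          using \<eta> by (intro ennreal_leI layer_count) auto
        finally show ?thesis using True by simp
      qed (auto simp: E_def)
    qed
    finally show ?thesis .
  qed
  then have "?c * (ennreal \<eta> * ?H A + (ennreal \<eta> * ?H A +
        (\<Sum>k\<in>{1..N}. ennreal \<eta> * ?H (E k)))) \<le>
      ?c * (ennreal \<eta> * ?H A + (ennreal \<eta> * ?H A +
        ?J))"
    by (intro mult_left_mono add_left_mono) auto
  also have "ennreal \<eta> * ?H A + (ennreal \<eta> * ?H A +
        ?J) =
      ?J + ennreal (2 * \<eta>) * ?H A"
  proof -
    have "ennreal (2 * \<eta>) = ennreal \<eta> + ennreal \<eta>" using \<eta> by (simp add: ennreal_plus[symmetric])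
    then show ?thesis by (simp only: distrib_right add_ac)
  qed
  finally show ?thesis using main by (rule order_trans[rotated])
qed

lemma integral_lebesgue_on_eq_lborel:
  fixes g :: "'a::euclidean_space \<Rightarrow> 'b::euclidean_space"
  assumes "\<Omega> \<in> sets borel" "g \<in> borel_measurable borel"
  shows "integral\<^sup>L (lebesgue_on \<Omega>) g = (LINT x|lborel. indicator \<Omega> x *\<^sub>R g x)"
proof -
  have "integral\<^sup>L (lebesgue_on \<Omega>) g = (LINT x|lebesgue. indicator \<Omega> x *\<^sub>R g x)"
    using assms by (subst integral_restrict_space) auto
  also have "\<dots> = (LINT x|lborel. indicator \<Omega> x *\<^sub>R g x)"
    using assms by (intro integral_completion) simp
  finally show ?thesis .
qed

lemma integrable_indicator_continuous:
  fixes g :: "'a::euclidean_space \<Rightarrow> 'b::euclidean_space"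
  assumes "\<Omega> \<in> sets borel" "bounded \<Omega>" "continuous_on UNIV g"
  shows "integrable lborel (\<lambda>x. indicator \<Omega> x *\<^sub>R g x)"
proof -
  have "compact (g ` closure \<Omega>)"
    using assms by (intro compact_continuous_image continuous_on_subset[OF assms(3)]) auto
  then obtain B where "\<And>x. x \<in> closure \<Omega> \<Longrightarrow> norm (g x) \<le> B"
    using compact_imp_bounded bounded_iff by (metis image_eqI)
  then have "\<And>x. x \<in> \<Omega> \<Longrightarrow> norm (g x) \<le> B" using closure_subset by blast
  then show ?thesis
    using assms(1) borel_measurable_continuous_onI[OF assms(3)] emeasure_bounded_finite[OF assms(2)]
    by (intro integrableI_bounded_set_indicator[where B = B]) (auto simp: top.not_eq_extremum)
qed

lemma integrable_lebesgue_on_continuous: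
  fixes g :: "'a::euclidean_space \<Rightarrow> 'b::euclidean_space"
  assumes "\<Omega> \<in> sets borel" "bounded \<Omega>" "continuous_on UNIV g"
  shows "integrable (lebesgue_on \<Omega>) g"
proof -
  have "integrable lebesgue (\<lambda>x. indicator \<Omega> x *\<^sub>R g x)"
    using integrable_indicator_continuous[OF assms] by (subst integrable_completion) auto
  then show ?thesis using assms by (subst integrable_restrict_space) auto
qed

lemma cmod_difference_le:
  assumes f: "smooth f" and h: "0 < h"
    and B: "\<And>t. 0 \<le> t \<Longrightarrow> t \<le> h \<Longrightarrow> cmod (partial_deriv i f (x + t *\<^sub>R axis i 1)) \<le> B"
  shows "cmod (f (x + h *\<^sub>R axis i 1) - f x) \<le> B * h"
proof -
  have "cmod (f (x + h *\<^sub>R axis i 1) - f (x + 0 *\<^sub>R axis i 1)) \<le> B * h - B * 0"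
  proof (rule differentiable_bound_general[OF h])
    show "continuous_on {0..h} (\<lambda>t. f (x + t *\<^sub>R axis i 1))"
      by (rule continuous_on_compose2[OF smooth_continuous_on[OF f, of UNIV]]) (auto intro!: continuous_intros)
    show "((\<lambda>t. f (x + t *\<^sub>R axis i 1)) has_vector_derivative partial_deriv i f (x + t *\<^sub>R axis i 1)) (at t)" for t
      by (rule smooth_has_partial_deriv[OF f])
    show "((*) B has_vector_derivative B) (at t)" for t
      by (auto intro!: derivative_eq_intros simp: has_real_derivative_iff_has_vector_derivative[symmetric])
  qed (use B in \<open>auto intro!: continuous_intros\<close>)
  then show ?thesis by simp
qed

lemma crossing_in_swept:
  assumes "0 \<le> h" "(x - h *\<^sub>R e \<in> \<Omega>) \<noteq> (x \<in> \<Omega>)"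
  shows "x \<in> swept e h (frontier \<Omega>)"
proof -
  let ?S = "(\<lambda>t. x - t *\<^sub>R e) ` {0..h}"
  have "connected ?S"
    by (intro connected_continuous_image continuous_intros) auto
  moreover have "x \<in> ?S" "x - h *\<^sub>R e \<in> ?S" using assms(1) by (auto intro: image_eqI[of _ _ 0])
  then have "?S \<inter> \<Omega> \<noteq> {}" "?S - \<Omega> \<noteq> {}" using assms(2) by blast+
  ultimately have "?S \<inter> frontier \<Omega> \<noteq> {}" by (rule connected_Int_frontier)
  then show ?thesis by (auto simp: swept_def)
qed

lemma nn_integral_boundary_measure:
  assumes "f \<in> borel_measurable borel"
  shows "(\<integral>\<^sup>+y. f y \<partial>boundary_measure \<Omega>) = (\<integral>\<^sup>+y. f y * indicator (frontier \<Omega>) y \<partial>hausdorff2)"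
  unfolding boundary_measure_def by (subst nn_integral_restrict_space) auto

text \<open>
  A translation moves the shift from \<open>f\<close> to the indicator of \<open>\<Omega>\<close>. The difference of the two indicators is
  supported in the region swept by the boundary, because a segment that joins a point of \<open>\<Omega>\<close> to a point
  outside meets the boundary.
\<close>

lemma difference_quotient_flux_le:
  assumes \<Omega>: "open \<Omega>" "bounded \<Omega>" and f: "continuous_on UNIV f" and \<eta>: "0 < \<eta>" and h: "0 < h"
    and close: "\<And>y t. y \<in> frontier \<Omega> \<Longrightarrow> 0 \<le> t \<Longrightarrow> t \<le> h \<Longrightarrow> cmod (f (y + t *\<^sub>R axis i 1)) \<le> cmod (f y) + \<eta>"
  shows "ennreal (cmod (LINT x|lebesgue_on \<Omega>. (1 / h) *\<^sub>R (f (x + h *\<^sub>R axis i 1) - f x))) \<le>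
    ennreal (64 / pi) * ((\<integral>\<^sup>+y. ennreal (cmod (f y)) \<partial>boundary_measure \<Omega>) + ennreal (2 * \<eta>) * emeasure hausdorff2 (frontier \<Omega>))"
proof -
  let ?e = "axis i 1 :: real^3"
  let ?f1 = "\<lambda>x. indicator \<Omega> (x - h *\<^sub>R ?e) *\<^sub>R f x"
  let ?f2 = "\<lambda>x. indicator \<Omega> x *\<^sub>R f (x + h *\<^sub>R ?e)"
  let ?S = "\<integral>\<^sup>+x. ennreal (cmod (f x)) * indicator (swept ?e h (frontier \<Omega>)) x \<partial>lborel"
  have \<Omega>b [measurable]: "\<Omega> \<in> sets borel" using \<Omega> by auto
  have fm [measurable]: "f \<in> borel_measurable borel" using f by (rule borel_measurable_continuous_onI)
  have fh: "continuous_on UNIV (\<lambda>x. f (x + h *\<^sub>R ?e))"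
    by (rule continuous_on_compose2[OF f]) (auto intro!: continuous_intros)
  then have fhm: "(\<lambda>x. f (x + h *\<^sub>R ?e)) \<in> borel_measurable borel" by (rule borel_measurable_continuous_onI)
  have i1: "integrable lborel (\<lambda>x. ?f2 x)"
    by (rule integrable_indicator_continuous[OF \<Omega>b \<Omega>(2) fh])
  have i2: "integrable lborel (\<lambda>x. indicator \<Omega> x *\<^sub>R f x)"
    by (rule integrable_indicator_continuous[OF \<Omega>b \<Omega>(2) f])
  have shift: "(\<lambda>x. x + h *\<^sub>R ?e) \<in> borel_measurable borel" "(\<lambda>x. x - h *\<^sub>R ?e) \<in> borel_measurable borel"
    by (auto intro!: borel_measurable_continuous_onI continuous_intros)
  have ind: "(\<lambda>x. indicator \<Omega> (x - h *\<^sub>R ?e) :: real) \<in> borel_measurable borel"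
    using measurable_compose[OF shift(2) borel_measurable_indicator[OF \<Omega>b]] .
  have lb: "distr lborel borel (\<lambda>x. x + h *\<^sub>R ?e) = lborel"
    using lborel_distr_plus[of "h *\<^sub>R ?e"] unfolding add.commute[of "h *\<^sub>R ?e"] .
  have i3: "integrable lborel (\<lambda>x. ?f1 x)"
    and e3: "(LINT x|lborel. ?f1 x) = (LINT x|lborel. ?f2 x)"
  proof -
    have "integrable (distr lborel borel (\<lambda>x. x + h *\<^sub>R ?e)) (\<lambda>x. ?f1 x)"
      using i1 shift ind fm by (subst integrable_distr_eq) auto
    then show "integrable lborel (\<lambda>x. ?f1 x)" unfolding lb .
    have "(LINT x|distr lborel borel (\<lambda>x. x + h *\<^sub>R ?e). ?f1 x) = (LINT x|lborel. ?f2 x)"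
      using shift ind fm by (subst integral_distr) auto
    then show "(LINT x|lborel. ?f1 x) = (LINT x|lborel. ?f2 x)"
      unfolding lb .
  qed
  have "(LINT x|lebesgue_on \<Omega>. (1 / h) *\<^sub>R (f (x + h *\<^sub>R ?e) - f x)) =
      (1 / h) *\<^sub>R (LINT x|lborel. indicator \<Omega> x *\<^sub>R (f (x + h *\<^sub>R ?e) - f x))"
    using fhm by (simp add: integral_lebesgue_on_eq_lborel[OF \<Omega>b] del: scaleR_scaleR)
  also have "(LINT x|lborel. indicator \<Omega> x *\<^sub>R (f (x + h *\<^sub>R ?e) - f x)) =
      (LINT x|lborel. ?f1 x - indicator \<Omega> x *\<^sub>R f x)"
    using i1 i2 i3 by (simp add: scaleR_diff_right e3)
  finally have "ennreal (cmod (LINT x|lebesgue_on \<Omega>. (1 / h) *\<^sub>R (f (x + h *\<^sub>R ?e) - f x))) =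
      ennreal (1 / h) * ennreal (cmod (LINT x|lborel. ?f1 x - indicator \<Omega> x *\<^sub>R f x))"
    using h by (simp add: ennreal_mult[symmetric])
  also have "\<dots> \<le> ennreal (1 / h) * ?S"
  proof (rule mult_left_mono)
    have "ennreal (cmod (LINT x|lborel. ?f1 x - indicator \<Omega> x *\<^sub>R f x)) \<le>
        (\<integral>\<^sup>+x. ennreal (cmod (?f1 x - indicator \<Omega> x *\<^sub>R f x)) \<partial>lborel)"
      using i2 i3 by (intro integral_norm_bound_ennreal) auto
    also have "\<dots> \<le> ?S"
    proof (rule nn_integral_mono)
      fix x
      show "ennreal (cmod (?f1 x - indicator \<Omega> x *\<^sub>R f x)) \<le>
          ennreal (cmod (f x)) * indicator (swept ?e h (frontier \<Omega>)) x"
        using crossing_in_swept[of h x ?e \<Omega>] h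
        by (cases "x \<in> \<Omega>"; cases "x - h *\<^sub>R ?e \<in> \<Omega>") auto
    qed
    finally show "ennreal (cmod (LINT x|lborel. ?f1 x - indicator \<Omega> x *\<^sub>R f x)) \<le> \<dots>" .
  qed simp
  also have "\<dots> \<le> ennreal (1 / h) * (ennreal (64 / pi * h) *
      ((\<integral>\<^sup>+y. ennreal (cmod (f y)) * indicator (frontier \<Omega>) y \<partial>hausdorff2) + ennreal (2 * \<eta>) * emeasure hausdorff2 (frontier \<Omega>)))"
    using \<Omega>(2) by (intro mult_left_mono nn_integral_swept_le f \<eta> h close) (auto simp: compact_frontier_bounded)
  also have "\<dots> = ennreal (64 / pi) *
      ((\<integral>\<^sup>+y. ennreal (cmod (f y)) * indicator (frontier \<Omega>) y \<partial>hausdorff2) + ennreal (2 * \<eta>) * emeasure hausdorff2 (frontier \<Omega>))"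
  proof -
    have "ennreal (1 / h) * ennreal (64 / pi * h) = ennreal (64 / pi)"
      using h by (subst ennreal_mult[symmetric]) auto
    then show ?thesis by (simp only: mult.assoc[symmetric])
  qed
  finally show ?thesis by (simp add: nn_integral_boundary_measure)
qed

text \<open>
  The substitute for the divergence theorem: the limit \<open>h \<rightarrow> 0\<close> followed by \<open>\<eta> \<rightarrow> 0\<close> in the estimate for
  difference quotients. Finite area of the boundary is needed to remove the terms with \<open>\<eta>\<close>.
\<close>

lemma cmod_integral_partial_deriv_le:
  assumes \<Omega>: "open \<Omega>" "bounded \<Omega>" and f: "smooth f" and fin: "emeasure hausdorff2 (frontier \<Omega>) \<noteq> \<infinity>"
  shows "ennreal (cmod (LINT x|lebesgue_on \<Omega>. partial_deriv i f x)) \<le>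
    ennreal (64 / pi) * (\<integral>\<^sup>+y. ennreal (cmod (f y)) \<partial>boundary_measure \<Omega>)"
proof -
  let ?e = "axis i 1 :: real^3" and ?c = "64 / pi"
  let ?I = "\<integral>\<^sup>+y. ennreal (cmod (f y)) \<partial>boundary_measure \<Omega>"
  let ?H = "emeasure hausdorff2 (frontier \<Omega>)"
  have fc: "continuous_on S f" for S using f by (rule smooth_continuous_on)
  have pc: "continuous_on S (partial_deriv i f)" for S using f by (intro smooth_continuous_on smooth_partial_deriv)
  obtain R where R: "closure \<Omega> \<subseteq> cball 0 R"
    using bounded_closure[OF \<Omega>(2)] unfolding bounded_any_center[of _ 0] by (auto simp: subset_iff)
  have "compact (partial_deriv i f ` cball 0 (R + 1))" by (intro compact_continuous_image pc) auto
  then obtain M where M: "\<And>x. x \<in> cball 0 (R + 1) \<Longrightarrow> cmod (partial_deriv i f x) \<le> M"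
    using compact_imp_bounded bounded_iff by (metis image_eqI)
  have near: "x + t *\<^sub>R ?e \<in> cball 0 (R + 1)" if "x \<in> closure \<Omega>" "0 \<le> t" "t \<le> 1" for x t
    using that R norm_triangle_ineq[of x "t *\<^sub>R ?e"] by (fastforce simp: norm_axis_1)
  define q where "q n x = (1 / inverse (real (Suc n))) *\<^sub>R (f (x + inverse (real (Suc n)) *\<^sub>R ?e) - f x)" for n x
  have h: "0 < inverse (real (Suc n))" "inverse (real (Suc n)) \<le> 1" for n
    by (auto intro: inverse_le_1_iff[THEN iffD2])
  have qc: "continuous_on UNIV (q n)" for n
    unfolding q_def by (intro continuous_intros fc continuous_on_compose2[OF fc[of UNIV]]) auto
  have lim: "(\<lambda>n. LINT x|lebesgue_on \<Omega>. q n x) \<longlonglongrightarrow> (LINT x|lebesgue_on \<Omega>. partial_deriv i f x)"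
  proof (rule integral_dominated_convergence[where w = "\<lambda>_. M"])
    have "integrable (lebesgue_on \<Omega>) g" if "continuous_on UNIV g" for g :: "real^3 \<Rightarrow> 'z::euclidean_space"
      using \<Omega> that by (intro integrable_lebesgue_on_continuous) auto
    then show "q n \<in> borel_measurable (lebesgue_on \<Omega>)" "partial_deriv i f \<in> borel_measurable (lebesgue_on \<Omega>)"
      "integrable (lebesgue_on \<Omega>) (\<lambda>_. M)" for n
      using qc pc by (blast intro: borel_measurable_integrable continuous_on_const)+
    show "AE x in lebesgue_on \<Omega>. (\<lambda>n. q n x) \<longlonglongrightarrow> partial_deriv i f x"
    proof (rule AE_I2)
      fix x
      have "((\<lambda>t. (1 / t) *\<^sub>R (f (x + t *\<^sub>R ?e) - f x)) \<longlongrightarrow> partial_deriv i f x) (at 0)"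
      proof (rule Lim_null[THEN iffD2], rule tendsto_norm_zero_cancel)
        have "((\<lambda>t. norm (f (x + t *\<^sub>R ?e) - f x - t *\<^sub>R partial_deriv i f x) / norm t) \<longlongrightarrow> 0) (at 0)"
          using smooth_has_partial_deriv_at_0[OF f, of x i]
          by (simp add: has_vector_derivative_def has_derivative_iff_norm)
        moreover have "\<forall>\<^sub>F t in at 0. norm (f (x + t *\<^sub>R ?e) - f x - t *\<^sub>R partial_deriv i f x) / norm t =
            norm ((1 / t) *\<^sub>R (f (x + t *\<^sub>R ?e) - f x) - partial_deriv i f x)"
          unfolding eventually_at_filter
        proof (rule always_eventually, intro allI impI)
          fix t :: real assume "t \<noteq> 0"
          then have "(1 / t) *\<^sub>R (f (x + t *\<^sub>R ?e) - f x) - partial_deriv i f x =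
              (1 / t) *\<^sub>R (f (x + t *\<^sub>R ?e) - f x - t *\<^sub>R partial_deriv i f x)"
            by (simp add: scaleR_diff_right)
          then show "norm (f (x + t *\<^sub>R ?e) - f x - t *\<^sub>R partial_deriv i f x) / norm t =
              norm ((1 / t) *\<^sub>R (f (x + t *\<^sub>R ?e) - f x) - partial_deriv i f x)"
            by simp
        qed
        ultimately show "((\<lambda>t. norm ((1 / t) *\<^sub>R (f (x + t *\<^sub>R ?e) - f x) - partial_deriv i f x)) \<longlongrightarrow> 0) (at 0)"
          by (rule Lim_transform_eventually)
      qed
      then show "(\<lambda>n. q n x) \<longlonglongrightarrow> partial_deriv i f x"
        unfolding q_def by (rule filterlim_compose)
          (use LIMSEQ_inverse_real_of_nat in \<open>auto simp: filterlim_at\<close>)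
    qed
    show "AE x in lebesgue_on \<Omega>. cmod (q n x) \<le> M" for n
    proof (rule AE_I2)
      fix x assume "x \<in> space (lebesgue_on \<Omega>)"
      then have "x \<in> closure \<Omega>" using closure_subset by auto
      then have "cmod (f (x + inverse (real (Suc n)) *\<^sub>R ?e) - f x) \<le> M * inverse (real (Suc n))"
        using h[of n] by (intro cmod_difference_le f M near) auto
      then have "cmod (f (x + inverse (real (Suc n)) *\<^sub>R ?e) - f x) / inverse (real (Suc n)) \<le> M"
        by (simp only: pos_divide_le_eq[OF h(1)])
      then show "cmod (q n x) \<le> M"
        unfolding q_def norm_scaleR abs_divide abs_of_pos[OF h(1)] by simp
    qed
  qed
  have \<eta>: "ennreal (cmod (LINT x|lebesgue_on \<Omega>. partial_deriv i f x)) \<le> ennreal ?c * (?I + ennreal (2 * \<eta>) * ?H)"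
    if "0 < \<eta>" for \<eta>
  proof -
    have "uniformly_continuous_on (cball 0 (R + 1)) f"
      by (intro compact_uniformly_continuous fc) auto
    then obtain d where d: "0 < d" "\<And>x x'. x \<in> cball 0 (R + 1) \<Longrightarrow> x' \<in> cball 0 (R + 1) \<Longrightarrow> dist x' x < d \<Longrightarrow> dist (f x') (f x) < \<eta>"
      using \<open>0 < \<eta>\<close> unfolding uniformly_continuous_on_def by meson
    have "\<forall>\<^sub>F n in sequentially. inverse (real (Suc n)) < d"
      using d(1) LIMSEQ_inverse_real_of_nat by (rule order_tendstoD(2)[rotated])
    then have ev: "\<forall>\<^sub>F n in sequentially. ennreal (cmod (LINT x|lebesgue_on \<Omega>. q n x)) \<le> ennreal ?c * (?I + ennreal (2 * \<eta>) * ?H)"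
    proof eventually_elim
      case (elim n)
      show ?case
        unfolding q_def
      proof (rule difference_quotient_flux_le[OF \<Omega> fc that h(1)])
        fix y t assume y: "y \<in> frontier \<Omega>" and t: "0 \<le> t" "t \<le> inverse (real (Suc n))"
        have y': "y \<in> closure \<Omega>" using y by (simp add: frontier_def)
        have "dist (f (y + t *\<^sub>R ?e)) (f y) < \<eta>"
          using near[OF y', of t] near[OF y', of 0] t h[of n] elim
          by (intro d(2)) (auto simp: dist_norm norm_axis_1)
        then show "cmod (f (y + t *\<^sub>R ?e)) \<le> cmod (f y) + \<eta>"
          unfolding dist_norm using norm_triangle_sub[of "f (y + t *\<^sub>R ?e)" "f y"] by linarith
      qed
    qed
    have "(\<lambda>n. ennreal (cmod (LINT x|lebesgue_on \<Omega>. q n x))) \<longlonglongrightarrow> ennreal (cmod (LINT x|lebesgue_on \<Omega>. partial_deriv i f x))"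
      by (intro tendsto_ennrealI tendsto_norm lim)
    then show ?thesis by (rule tendsto_upperbound[OF _ ev]) simp
  qed
  obtain H where H: "?H = ennreal H" "0 \<le> H" using fin by (cases ?H) auto
  show ?thesis
  proof (rule ennreal_le_epsilon)
    fix r :: real assume r: "0 < r"
    \<comment> \<open>The summand \<open>1\<close> avoids division by zero for a boundary of area zero.\<close>
  define X where "X = ?c * 2 * (H + 1)"
    define \<eta> where "\<eta> = r / X"
    have X: "0 < X" using H by (simp add: X_def)
    have pos: "0 < \<eta>" unfolding \<eta>_def using r X by (intro divide_pos_pos)
    have "?c * (2 * \<eta> * H) \<le> ?c * (2 * \<eta> * (H + 1))" using pos by (intro mult_left_mono) auto
    also have "\<dots> = \<eta> * X" by (simp add: X_def)
    also have "\<dots> = r" using X by (simp add: \<eta>_def)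
    finally have "ennreal (?c * (2 * \<eta> * H)) \<le> ennreal r" by (rule ennreal_leI)
    moreover have "ennreal ?c * (ennreal (2 * \<eta>) * ennreal H) = ennreal (?c * (2 * \<eta> * H))"
    proof -
      have "ennreal (2 * \<eta>) * ennreal H = ennreal (2 * \<eta> * H)" using pos H by (intro ennreal_mult[symmetric]) auto
      moreover have "ennreal ?c * ennreal (2 * \<eta> * H) = ennreal (?c * (2 * \<eta> * H))"
        using pos H by (intro ennreal_mult[symmetric]) auto
      ultimately show ?thesis by (simp only:)
    qed
    ultimately have "ennreal ?c * (ennreal (2 * \<eta>) * ennreal H) \<le> ennreal r" by simp
    then have "ennreal ?c * ?I + ennreal ?c * (ennreal (2 * \<eta>) * ennreal H) \<le> ennreal ?c * ?I + ennreal r"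
      by (rule add_left_mono)
    with \<eta>[OF pos] show "ennreal (cmod (LINT x|lebesgue_on \<Omega>. partial_deriv i f x)) \<le> ennreal ?c * ?I + ennreal r"
      unfolding H(1) distrib_left by (rule order_trans)
  qed
qed

section \<open>Finite area of a twice differentiable boundary\<close>

lemma Ck_imp_continuous_on:
  assumes "Ck n f"
  shows "continuous_on S f"
proof -
  have "continuous_on UNIV f"
  proof (cases n)
    case 0
    with assms show ?thesis by simp
  next
    case (Suc m)
    from assms[unfolded Suc] show ?thesis unfolding Ck.simps by (rule conjunct1)
  qed
  then show ?thesis by (rule continuous_on_subset) simp
qed

lemma Ck2_lipschitz_on_square:
  fixes g :: "real \<times> real \<Rightarrow> real"
  assumes g: "Ck 2 g" and R: "0 \<le> R"
  shows "\<exists>M\<ge>0. \<forall>a\<in>{-R..R}. \<forall>b\<in>{-R..R}. \<forall>a'\<in>{-R..R}. \<forall>b'\<in>{-R..R}.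
    \<bar>g (a, b) - g (a', b')\<bar> \<le> M * (\<bar>a - a'\<bar> + \<bar>b - b'\<bar>)"
proof -
  let ?S = "{-R..R} \<times> {-R..R}"
  have g1: "Ck (Suc 1) g" using g by (simp only: Suc_1)
  have cS: "compact ?S" by (intro compact_Times) auto
  have basis: "(1, 0) \<in> (Basis :: (real \<times> real) set)" "(0, 1) \<in> (Basis :: (real \<times> real) set)"
    by (auto simp: Basis_prod_def)
  obtain g1 where d1: "\<And>x. ((\<lambda>t. g (x + t *\<^sub>R (1, 0))) has_vector_derivative g1 x) (at 0)" "Ck 1 g1"
    using Ck_SucE[OF g1 basis(1)] by blast
  obtain g2 where d2: "\<And>x. ((\<lambda>t. g (x + t *\<^sub>R (0, 1))) has_vector_derivative g2 x) (at 0)" "Ck 1 g2"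
    using Ck_SucE[OF g1 basis(2)] by blast
  have bdd: "\<exists>B. \<forall>x\<in>?S. norm (h x) \<le> B" if "Ck 1 h" for h :: "real \<times> real \<Rightarrow> real"
  proof -
    have "compact (h ` ?S)" by (intro compact_continuous_image cS Ck_imp_continuous_on[OF that])
    then have "bounded (h ` ?S)" by (rule compact_imp_bounded)
    then show ?thesis unfolding bounded_iff by blast
  qed
  obtain B1 B2 where B: "\<And>x. x \<in> ?S \<Longrightarrow> norm (g1 x) \<le> B1" "\<And>x. x \<in> ?S \<Longrightarrow> norm (g2 x) \<le> B2"
    using bdd[OF d1(2)] bdd[OF d2(2)] by blast
  have e1: "((\<lambda>a. g (a, b)) has_vector_derivative g1 (a, b)) (at a)" for a b
  proof -
    have "(((\<lambda>t. g ((a, b) + t *\<^sub>R (1, 0))) \<circ> (\<lambda>s. s - a)) has_vector_derivative 1 *\<^sub>R g1 (a, b)) (at a)"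
      by (rule vector_diff_chain_at) (use d1(1)[of "(a, b)"] in \<open>auto intro!: derivative_eq_intros\<close>)
    then show ?thesis by (simp add: o_def)
  qed
  have e2: "((\<lambda>b. g (a, b)) has_vector_derivative g2 (a, b)) (at b)" for a b
  proof -
    have "(((\<lambda>t. g ((a, b) + t *\<^sub>R (0, 1))) \<circ> (\<lambda>s. s - b)) has_vector_derivative 1 *\<^sub>R g2 (a, b)) (at b)"
      by (rule vector_diff_chain_at) (use d2(1)[of "(a, b)"] in \<open>auto intro!: derivative_eq_intros\<close>)
    then show ?thesis by (simp add: o_def)
  qed
  have m1: "\<bar>g (a, b) - g (a', b)\<bar> \<le> B1 * \<bar>a - a'\<bar>"
    if "a \<in> {-R..R}" "a' \<in> {-R..R}" "b \<in> {-R..R}" for a a' b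
  proof -
    have "norm (g (a, b) - g (a', b)) \<le> B1 * norm (a - a')"
    proof (rule field_differentiable_bound[of "{-R..R}" "\<lambda>a. g (a, b)" "\<lambda>a. g1 (a, b)"])
      show "((\<lambda>a. g (a, b)) has_field_derivative g1 (x, b)) (at x within {-R..R})" for x
        using e1[of b x] by (simp add: has_real_derivative_iff_has_vector_derivative has_vector_derivative_at_within)
    qed (use that B(1) in auto)
    then show ?thesis by simp
  qed
  have m2: "\<bar>g (a, b) - g (a, b')\<bar> \<le> B2 * \<bar>b - b'\<bar>"
    if "b \<in> {-R..R}" "b' \<in> {-R..R}" "a \<in> {-R..R}" for a b b'
  proof -
    have "norm (g (a, b) - g (a, b')) \<le> B2 * norm (b - b')"
    proof (rule field_differentiable_bound[of "{-R..R}" "\<lambda>b. g (a, b)" "\<lambda>b. g2 (a, b)"])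
      show "((\<lambda>b. g (a, b)) has_field_derivative g2 (a, x)) (at x within {-R..R})" for x
        using e2[of a x] by (simp add: has_real_derivative_iff_has_vector_derivative has_vector_derivative_at_within)
    qed (use that B(2) in auto)
    then show ?thesis by simp
  qed
  have "\<bar>g (a, b) - g (a', b')\<bar> \<le> (\<bar>B1\<bar> + \<bar>B2\<bar>) * (\<bar>a - a'\<bar> + \<bar>b - b'\<bar>)"
    if "a \<in> {-R..R}" "b \<in> {-R..R}" "a' \<in> {-R..R}" "b' \<in> {-R..R}" for a b a' b'
  proof -
    have "\<bar>g (a, b) - g (a', b')\<bar> \<le> B1 * \<bar>a - a'\<bar> + B2 * \<bar>b - b'\<bar>"
      using m1[OF that(1,3,2)] m2[OF that(2,4,3)] by linarith
    also have "\<dots> \<le> (\<bar>B1\<bar> + \<bar>B2\<bar>) * \<bar>a - a'\<bar> + (\<bar>B1\<bar> + \<bar>B2\<bar>) * \<bar>b - b'\<bar>"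
      by (intro add_mono mult_right_mono) auto
    finally show ?thesis by (simp add: distrib_left)
  qed
  then show ?thesis by (intro exI[of _ "\<bar>B1\<bar> + \<bar>B2\<bar>"]) auto
qed

text \<open>
  Dividing the square into \<open>n\<^sup>2\<close> equal cells gives images whose diameter is at most a constant times \<open>1 / n\<close>,
  so the sum of the squared diameters is bounded independently of \<open>n\<close>.
\<close>

lemma hausdorff2_outer_lipschitz_square:
  fixes \<Phi> :: "real \<times> real \<Rightarrow> 'a::real_normed_vector"
  assumes R: "0 < R" and L: "0 \<le> L"
    and lip: "\<And>a b a' b'. a \<in> {-R..R} \<Longrightarrow> b \<in> {-R..R} \<Longrightarrow> a' \<in> {-R..R} \<Longrightarrow> b' \<in> {-R..R} \<Longrightarrow>
      dist (\<Phi> (a, b)) (\<Phi> (a', b')) \<le> L * (\<bar>a - a'\<bar> + \<bar>b - b'\<bar>)"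
  shows "hausdorff2_outer (\<Phi> ` ({-R..R} \<times> {-R..R})) \<le> ennreal (4 * pi * L\<^sup>2 * R\<^sup>2)"
  unfolding hausdorff2_outer_def
proof (rule SUP_least)
  fix \<epsilon> :: real assume "\<epsilon> \<in> {0<..}"
  then have \<epsilon>: "0 < \<epsilon>" by simp
  obtain n where "4 * L * R / \<epsilon> < real n" using reals_Archimedean2 by blast
  then have "4 * L * R / \<epsilon> < real (Suc n)" by simp
  then obtain n where n: "0 < n" "4 * L * R / \<epsilon> < real n" by blast
  \<comment> \<open>With this number of cells the images have diameter at most \<open>\<epsilon>\<close>.\<close>
  define w where "w = 2 * R / real n"
  have w: "0 < w" "real n * w = 2 * R" using R n by (auto simp: w_def)
  have wL: "2 * L * w \<le> \<epsilon>" using n \<epsilon> by (simp add: w_def field_simps)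
  define J where "J i = {- R + real i * w .. - R + (real i + 1) * w}" for i
  define Cell where "Cell k = \<Phi> ` (J (k div n) \<times> J (k mod n))" for k
  define C where "C k = (if k < n * n then Cell k else {})" for k
  have Jsub: "J i \<subseteq> {-R..R}" if "i < n" for i
  proof -
    have "0 \<le> real i * w" using w by simp
    moreover have "(real i + 1) * w \<le> real n * w" using that w by (intro mult_right_mono) auto
    ultimately show ?thesis using w by (auto simp: J_def)
  qed
  have cover: "\<exists>i<n. a \<in> J i" if a: "a \<in> {-R..R}" for a
  proof (cases "a = R")
    case True
    have "real (n - 1) = real n - 1" using n by simp
    then have "a \<in> J (n - 1)" using True w by (auto simp: J_def algebra_simps)
    then show ?thesis using n by (intro exI[of _ "n - 1"]) auto
  next
    case False
    define i where "i = nat \<lfloor>(a + R) / w\<rfloor>"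
    have "0 \<le> (a + R) / w" using a w by auto
    then have i: "real i \<le> (a + R) / w" "(a + R) / w < real i + 1" by (auto simp: i_def)
    then have i': "real i * w \<le> a + R" "a + R \<le> (real i + 1) * w" using w by (auto simp: field_simps)
    have "(a + R) / w < real n" using a False w by (simp add: divide_less_eq)
    then have "i < n" using i by linarith
    then show ?thesis using i' by (intro exI[of _ i]) (auto simp: J_def)
  qed
  have dist: "dist p q \<le> 2 * L * w" if k: "k < n * n" and pq: "p \<in> Cell k" "q \<in> Cell k" for p q k
  proof -
    have kn: "k div n < n" "k mod n < n" using k n by (auto simp: less_mult_imp_div_less)
    obtain a b a' b' where ab: "p = \<Phi> (a, b)" "q = \<Phi> (a', b')" "a \<in> J (k div n)" "a' \<in> J (k div n)"
      "b \<in> J (k mod n)" "b' \<in> J (k mod n)" using pq by (auto simp: Cell_def)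
    have "dist p q \<le> L * (\<bar>a - a'\<bar> + \<bar>b - b'\<bar>)"
      unfolding ab(1,2) using ab Jsub[OF kn(1)] Jsub[OF kn(2)] by (intro lip) auto
    also have "\<dots> \<le> L * (w + w)"
      using ab L by (intro mult_left_mono add_mono) (auto simp: J_def distrib_right)
    finally show ?thesis by simp
  qed
  have bd: "bounded (Cell k) \<and> diameter (Cell k) \<le> 2 * L * w" if "k < n * n" for k
  proof
    show "bounded (Cell k)"
      unfolding bounded_def
    proof (cases "Cell k = {}")
      case False
      then obtain p where "p \<in> Cell k" by blast
      then show "\<exists>x e. \<forall>y\<in>Cell k. dist x y \<le> e" using dist[OF that] by blast
    qed simp
    show "diameter (Cell k) \<le> 2 * L * w"
      using dist[OF that] L w by (intro diameter_le) (auto simp: dist_norm)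
  qed
  have "hausdorff2_pre \<epsilon> (\<Phi> ` ({-R..R} \<times> {-R..R})) \<le> (\<Sum>k. ennreal (pi / 4 * (diameter (C k))\<^sup>2))"
    unfolding hausdorff2_pre_def
  proof (rule INF_lower, intro CollectI conjI allI)
    show "\<Phi> ` ({-R..R} \<times> {-R..R}) \<subseteq> (\<Union>k. C k)"
    proof
      fix y assume "y \<in> \<Phi> ` ({-R..R} \<times> {-R..R})"
      then obtain a b where ab: "y = \<Phi> (a, b)" "a \<in> {-R..R}" "b \<in> {-R..R}" by auto
      obtain i j where ij: "i < n" "a \<in> J i" "j < n" "b \<in> J j" using cover ab by metis
      have "i * n + j < n * n"
      proof -
        have "i * n + j < Suc i * n" using ij by simp
        also have "\<dots> \<le> n * n" using ij by (intro mult_right_mono) auto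
        finally show ?thesis .
      qed
      then have "y \<in> C (i * n + j)" using ij ab by (auto simp: C_def Cell_def)
      then show "y \<in> (\<Union>k. C k)" by blast
    qed
    show "bounded (C k)" for k using bd[of k] by (simp add: C_def)
    show "diameter (C k) \<le> \<epsilon>" for k
    proof (cases "k < n * n")
      case True then show ?thesis using bd[OF True] wL by (simp add: C_def)
    next
      case False then show ?thesis using \<epsilon> by (simp add: C_def)
    qed
  qed
  also have "\<dots> = (\<Sum>k<n * n. ennreal (pi / 4 * (diameter (C k))\<^sup>2))"
    by (intro suminf_finite) (auto simp: C_def)
  also have "\<dots> \<le> (\<Sum>k<n * n. ennreal (pi / 4 * (2 * L * w)\<^sup>2))"
  proof (intro sum_mono ennreal_leI mult_left_mono power_mono)
    fix k assume "k \<in> {..<n * n}"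
    then have "C k = Cell k" "k < n * n" by (auto simp: C_def)
    then show "diameter (C k) \<le> 2 * L * w" "0 \<le> diameter (C k)"
      using bd[of k] diameter_ge_0[of "Cell k"] by simp_all
  qed simp
  also have "\<dots> = ennreal (real (n * n) * (pi / 4 * (2 * L * w)\<^sup>2))"
    by (simp only: sum_constant card_lessThan ennreal_of_nat_eq_real_of_nat) (rule ennreal_mult[symmetric], auto)
  also have "real (n * n) * (pi / 4 * (2 * L * w)\<^sup>2) = pi * L\<^sup>2 * (real n * w)\<^sup>2"
    by (simp add: power_mult_distrib) (simp add: power2_eq_square)
  also have "\<dots> = 4 * pi * L\<^sup>2 * R\<^sup>2" unfolding w(2) by (simp add: power2_eq_square)
  finally show "hausdorff2_pre \<epsilon> (\<Phi> ` ({-R..R} \<times> {-R..R})) \<le> ennreal (4 * pi * L\<^sup>2 * R\<^sup>2)" .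
qed

text \<open>
  Near each of its points the boundary lies in the graph of a function that is Lipschitz on bounded sets,
  and finitely many such neighbourhoods cover the compact boundary.
\<close>

lemma emeasure_hausdorff2_frontier_finite:
  assumes "bounded_C2_domain \<Omega>"
  shows "emeasure hausdorff2 (frontier \<Omega>) \<noteq> \<infinity>"
proof -
  have \<Omega>: "open \<Omega>" "bounded \<Omega>" "C2_boundary \<Omega>" using assms unfolding bounded_C2_domain_def by blast+
  have loc: "\<exists>r>0. emeasure hausdorff2 (frontier \<Omega> \<inter> ball x0 r) < \<infinity>" if x0: "x0 \<in> frontier \<Omega>" for x0
  proof -
    obtain r T g where r: "r > 0" and T: "orthogonal_transformation (T :: real^3 \<Rightarrow> real^3)" and g: "Ck 2 g"
      and graph: "\<Omega> \<inter> ball x0 r = {x \<in> ball x0 r. T x $ 3 > g (T x $ 1, T x $ 2)}"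
      using bspec[OF \<Omega>(3)[unfolded C2_boundary_def] x0] by (elim exE conjE)
    have Tc: "continuous_on UNIV T"
      by (intro linear_continuous_on linear_conv_bounded_linear[THEN iffD1] orthogonal_transformation_linear T)
    have gc: "continuous_on UNIV (\<lambda>x. g (T x $ 1, T x $ 2))"
      by (rule continuous_on_compose2[OF Ck_imp_continuous_on[OF g, of UNIV]]) (auto intro!: continuous_intros Tc)
    have on_graph: "T y $ 3 = g (T y $ 1, T y $ 2)" if y: "y \<in> frontier \<Omega>" "y \<in> ball x0 r" for y
    proof (rule linorder_cases)
      assume "g (T y $ 1, T y $ 2) < T y $ 3"
      then have "y \<in> \<Omega>" using graph y(2) by blast
      with y(1) \<Omega>(1) show ?thesis by (simp add: frontier_def interior_open)
    next
      assume lt: "T y $ 3 < g (T y $ 1, T y $ 2)"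
      let ?W = "ball x0 r \<inter> {z. T z $ 3 < g (T z $ 1, T z $ 2)}"
      have "open ?W" by (intro open_Int open_ball open_Collect_less continuous_intros Tc gc)
      moreover have "?W \<inter> \<Omega> = {}"
      proof (rule equals0I)
        fix z assume z: "z \<in> ?W \<inter> \<Omega>"
        then have "z \<in> \<Omega> \<inter> ball x0 r" by blast
        then have "g (T z $ 1, T z $ 2) < T z $ 3" unfolding graph by blast
        moreover have "T z $ 3 < g (T z $ 1, T z $ 2)" using z by blast
        ultimately show False by simp
      qed
      ultimately have "?W \<inter> closure \<Omega> = {}" by (simp add: open_Int_closure_eq_empty)
      with y lt show ?thesis by (auto simp: frontier_def)
    qed simp
    define R where "R = norm x0 + r"
    have R: "0 < R" using r by (simp add: R_def add_nonneg_pos)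
    obtain M where M: "M \<ge> 0" "\<And>a b a' b'. a \<in> {-R..R} \<Longrightarrow> b \<in> {-R..R} \<Longrightarrow> a' \<in> {-R..R} \<Longrightarrow> b' \<in> {-R..R} \<Longrightarrow>
        \<bar>g (a, b) - g (a', b')\<bar> \<le> M * (\<bar>a - a'\<bar> + \<bar>b - b'\<bar>)"
      using Ck2_lipschitz_on_square[OF g less_imp_le[OF R]] by blast
    define \<Phi> where "\<Phi> = (\<lambda>(a, b). inv T (vector [a, b, g (a, b)] :: real^3))"
    have bT: "bij T" using T by (rule orthogonal_transformation_bij)
    have iT: "orthogonal_transformation (inv T)" using T by (rule orthogonal_transformation_inv)
    have "dist (\<Phi> (a, b)) (\<Phi> (a', b')) \<le> (1 + M) * (\<bar>a - a'\<bar> + \<bar>b - b'\<bar>)"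
      if "a \<in> {-R..R}" "b \<in> {-R..R}" "a' \<in> {-R..R}" "b' \<in> {-R..R}" for a b a' b'
    proof -
      have "dist (\<Phi> (a, b)) (\<Phi> (a', b')) = norm ((vector [a, b, g (a, b)] :: real^3) - vector [a', b', g (a', b')])"
        unfolding \<Phi>_def prod.case dist_norm
        by (simp add: linear_diff[OF orthogonal_transformation_linear[OF iT], symmetric]
            orthogonal_transformation_norm[OF iT])
      also have "\<dots> \<le> \<bar>a - a'\<bar> + \<bar>b - b'\<bar> + \<bar>g (a, b) - g (a', b')\<bar>"
        by (rule order_trans[OF norm_le_l1_cart]) (simp add: sum_3 vector_3)
      also have "\<dots> \<le> (1 + M) * (\<bar>a - a'\<bar> + \<bar>b - b'\<bar>)"
        using M(2)[OF that] by (simp add: distrib_right)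
      finally show ?thesis .
    qed
    then have "hausdorff2_outer (\<Phi> ` ({-R..R} \<times> {-R..R})) \<le> ennreal (4 * pi * (1 + M)\<^sup>2 * R\<^sup>2)"
      using R M(1) by (intro hausdorff2_outer_lipschitz_square) auto
    moreover have "frontier \<Omega> \<inter> ball x0 r \<subseteq> \<Phi> ` ({-R..R} \<times> {-R..R})"
    proof
      fix y assume y: "y \<in> frontier \<Omega> \<inter> ball x0 r"
      have "norm (T y) \<le> R"
        using y norm_triangle_sub[of y x0] T
        by (auto simp: R_def dist_norm norm_minus_commute orthogonal_transformation_norm)
      then have "\<bar>T y $ i\<bar> \<le> R" for i using component_le_norm_cart order_trans by blast
      then have "(T y $ 1, T y $ 2) \<in> {-R..R} \<times> {-R..R}" by (auto simp: abs_le_iff minus_le_iff)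
      moreover have "T y = vector [T y $ 1, T y $ 2, g (T y $ 1, T y $ 2)]"
        using on_graph[of y] y by (simp add: vec_eq_iff forall_3 vector_3)
      then have "y = \<Phi> (T y $ 1, T y $ 2)"
        unfolding \<Phi>_def prod.case using bT by (metis bij_inv_eq_iff)
      ultimately show "y \<in> \<Phi> ` ({-R..R} \<times> {-R..R})" by blast
    qed
    ultimately have "hausdorff2_outer (frontier \<Omega> \<inter> ball x0 r) \<le> ennreal (4 * pi * (1 + M)\<^sup>2 * R\<^sup>2)"
      using hausdorff2_outer_mono order_trans by blast
    moreover have "frontier \<Omega> \<inter> ball x0 r \<in> sets borel" by auto
    ultimately have "emeasure hausdorff2 (frontier \<Omega> \<inter> ball x0 r) < \<infinity>"
      by (simp add: emeasure_hausdorff2 le_less_trans)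
    with r show ?thesis by blast
  qed
  then obtain r where r: "\<And>x0. x0 \<in> frontier \<Omega> \<Longrightarrow> r x0 > 0 \<and> emeasure hausdorff2 (frontier \<Omega> \<inter> ball x0 (r x0)) < \<infinity>"
    by metis
  have cpt: "compact (frontier \<Omega>)" using \<Omega>(2) by (rule compact_frontier_bounded)
  have cov: "frontier \<Omega> \<subseteq> (\<Union>x0\<in>frontier \<Omega>. ball x0 (r x0))" using r by force
  obtain X where X: "X \<subseteq> frontier \<Omega>" "finite X" "frontier \<Omega> \<subseteq> (\<Union>x0\<in>X. ball x0 (r x0))"
    by (rule compactE_image[OF cpt _ cov]) (simp, blast)
  have piece: "frontier \<Omega> \<inter> ball x0 (r x0) \<in> sets hausdorff2" for x0
    unfolding sets_hausdorff2 by (intro sets.Int borel_closed borel_open frontier_closed open_ball)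
  have "emeasure hausdorff2 (frontier \<Omega>) \<le> emeasure hausdorff2 (\<Union>x0\<in>X. frontier \<Omega> \<inter> ball x0 (r x0))"
    using X by (intro emeasure_mono sets.finite_UN piece) auto
  also have "\<dots> \<le> (\<Sum>x0\<in>X. emeasure hausdorff2 (frontier \<Omega> \<inter> ball x0 (r x0)))"
    using X piece by (intro emeasure_subadditive_finite) auto
  also have "\<dots> < \<infinity>" using r X by (auto simp: ennreal_sum_less_top subset_iff)
  finally show ?thesis by simp
qed

section \<open>Plane waves and Green's formula\<close>

definition plane_wave :: "real^3 \<Rightarrow> real^3 \<Rightarrow> real^3 \<Rightarrow> complex" where
  "plane_wave a b x = exp (Complex (x \<bullet> a) (x \<bullet> b))"

lemma plane_wave_has_directional_derivative:
  "((\<lambda>t. plane_wave a b (x + t *\<^sub>R e)) has_vector_derivative Complex (e \<bullet> a) (e \<bullet> b) * plane_wave a b x) (at 0)"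
proof -
  have "((\<lambda>z. exp (Complex (x \<bullet> a) (x \<bullet> b) + z * Complex (e \<bullet> a) (e \<bullet> b))) has_field_derivative
      Complex (e \<bullet> a) (e \<bullet> b) * plane_wave a b x) (at (of_real 0))"
    by (auto intro!: derivative_eq_intros simp: plane_wave_def)
  then have "((\<lambda>t. exp (Complex (x \<bullet> a) (x \<bullet> b) + of_real t * Complex (e \<bullet> a) (e \<bullet> b))) has_vector_derivative
      Complex (e \<bullet> a) (e \<bullet> b) * plane_wave a b x) (at 0)"
    by (rule has_vector_derivative_real_field)
  moreover have "plane_wave a b (x + t *\<^sub>R e) = exp (Complex (x \<bullet> a) (x \<bullet> b) + of_real t * Complex (e \<bullet> a) (e \<bullet> b))" for t
    unfolding plane_wave_def by (rule arg_cong[where f = exp]) (simp add: inner_add_left complex_eq_iff)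
  ultimately show ?thesis by simp
qed

lemma continuous_on_plane_wave: "continuous_on S (plane_wave a b)"
  unfolding plane_wave_def Complex_eq by (intro continuous_intros)

lemma Ck_plane_wave: "Ck n (\<lambda>x. c * plane_wave a b x)"
proof (induction n arbitrary: c)
  case 0
  then show ?case by (auto intro!: continuous_intros continuous_on_plane_wave)
next
  case (Suc n)
  have "((\<lambda>t. c * plane_wave a b (x + t *\<^sub>R e)) has_vector_derivative c * Complex (e \<bullet> a) (e \<bullet> b) * plane_wave a b x) (at 0)" for x e
    using has_vector_derivative_mult_right[OF plane_wave_has_directional_derivative[of a b x e], of c]
    by (simp add: mult.assoc)
  with Suc show ?case
    unfolding Ck.simps
    by (intro conjI ballI exI[of _ "\<lambda>x. c * Complex (e \<bullet> a) (e \<bullet> b) * plane_wave a b x" for e] allI)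
      (auto intro!: continuous_intros continuous_on_plane_wave)
qed

lemma smooth_plane_wave: "smooth (plane_wave a b)"
  using Ck_plane_wave[of _ 1 a b] by (simp add: smooth_def)

lemma partial_deriv_plane_wave: "partial_deriv i (plane_wave a b) x = Complex (a $ i) (b $ i) * plane_wave a b x"
  using plane_wave_has_directional_derivative[of a b x "axis i 1"]
  by (intro partial_deriv_eqI) (simp add: inner_axis' )

text \<open>
  The eigenvalue is the bilinear square \<open>(a + \<i> b) \<bullet> (a + \<i> b)\<close>, whose imaginary part is \<open>2 (a \<bullet> b)\<close>.
\<close>

lemma plane_wave_helmholtz:
  assumes "a \<bullet> b = 0"
  shows "(\<Sum>i\<in>UNIV. partial_deriv i (partial_deriv i (plane_wave a b)) x) = of_real (a \<bullet> a - b \<bullet> b) * plane_wave a b x"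
proof -
  have "partial_deriv i (partial_deriv i (plane_wave a b)) x = (Complex (a $ i) (b $ i))\<^sup>2 * plane_wave a b x" for i
  proof -
    have "partial_deriv i (plane_wave a b) = (\<lambda>x. Complex (a $ i) (b $ i) * plane_wave a b x)"
      by (rule ext) (rule partial_deriv_plane_wave)
    moreover have "partial_deriv i (\<lambda>x. Complex (a $ i) (b $ i) * plane_wave a b x) x =
        Complex (a $ i) (b $ i) * partial_deriv i (plane_wave a b) x + partial_deriv i (\<lambda>x. Complex (a $ i) (b $ i)) x * plane_wave a b x"
      by (intro partial_deriv_mult smooth_const smooth_plane_wave)
    moreover have "partial_deriv i (\<lambda>x. Complex (a $ i) (b $ i)) x = 0"
      by (rule partial_deriv_eqI) simp
    ultimately show ?thesis by (simp add: partial_deriv_plane_wave power2_eq_square)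
  qed
  then have "(\<Sum>i\<in>UNIV. partial_deriv i (partial_deriv i (plane_wave a b)) x) =
      (\<Sum>i\<in>UNIV. (Complex (a $ i) (b $ i))\<^sup>2) * plane_wave a b x"
    by (simp add: sum_distrib_right)
  also have "(\<Sum>i\<in>UNIV. (Complex (a $ i) (b $ i))\<^sup>2) = of_real (a \<bullet> a - b \<bullet> b)"
    using assms by (auto simp: sum_3 inner_vec_def complex_eq_iff power2_eq_square algebra_simps)
  finally show ?thesis .
qed

lemma integrable_L2_times_bounded:
  assumes "finite_measure M" "L2 M f" "g \<in> borel_measurable M" "\<And>x. x \<in> space M \<Longrightarrow> cmod (g x) \<le> B"
  shows "integrable M (\<lambda>x. f x * g x)"
proof (rule Bochner_Integration.integrable_bound)
  interpret finite_measure M by fact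
  show "integrable M (\<lambda>x. B * (1 + (cmod (f x))\<^sup>2))"
    using assms(2) by (intro integrable_mult_right Bochner_Integration.integrable_add) (auto simp: L2_def)
  show "(\<lambda>x. f x * g x) \<in> borel_measurable M" using assms(2,3) by (auto simp: L2_def)
  show "AE x in M. norm (f x * g x) \<le> norm (B * (1 + (cmod (f x))\<^sup>2))"
  proof (rule AE_I2)
    fix x assume "x \<in> space M"
    then have B: "cmod (g x) \<le> B" by (rule assms(4))
    have "0 \<le> (1 - cmod (f x))\<^sup>2 + (cmod (f x))\<^sup>2 + 1" by simp
    then have "cmod (f x) \<le> 1 + (cmod (f x))\<^sup>2" by (simp add: power2_eq_square algebra_simps)
    then have "cmod (f x) * cmod (g x) \<le> (1 + (cmod (f x))\<^sup>2) * B"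
      using B by (intro mult_mono) auto
    also have "\<dots> \<le> norm (B * (1 + (cmod (f x))\<^sup>2))" by (simp add: mult.commute)
    finally show "norm (f x * g x) \<le> norm (B * (1 + (cmod (f x))\<^sup>2))" by (simp add: norm_mult)
  qed
qed

text \<open>
  On a finite measure space \<open>t \<le> e + t\<^sup>2 / e\<close> with small \<open>e\<close> replaces the Cauchy-Schwarz inequality.
\<close>

lemma L2_converges_imp_L1:
  assumes "finite_measure M" "L2_converges M f g" "\<And>n. (\<lambda>x. f n x - g x) \<in> borel_measurable M"
  shows "(\<lambda>n. \<integral>\<^sup>+x. ennreal (cmod (f n x - g x)) \<partial>M) \<longlonglongrightarrow> 0"
proof (rule order_tendstoI)
  interpret finite_measure M by fact
  fix a :: ennreal assume "0 < a"
  then obtain b where b: "0 < b" "b < a" using dense by blast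
  then obtain r where r: "b = ennreal r" "0 < r" by (cases b) auto
  define m where "m = measure M (space M)"
  have m: "0 \<le> m" "emeasure M (space M) = ennreal m" by (auto simp: m_def emeasure_eq_measure)
  define m1 where "m1 = m + 1"
  define e where "e = r / (2 * m1)"
  have m1: "0 < m1" using m by (simp add: m1_def)
  have e: "0 < e" using r m1 by (simp add: e_def)
  have "e * m \<le> e * m1" using e by (simp add: m1_def)
  also have "\<dots> = r / 2" using m1 by (simp add: e_def)
  finally have em: "e * m \<le> r / 2" .
  have "\<forall>\<^sub>F n in sequentially. (\<integral>\<^sup>+x. ennreal ((cmod (f n x - g x))\<^sup>2) \<partial>M) < ennreal (e * (r / 2))"
    using assms(2) unfolding L2_converges_def by (rule order_tendstoD) (use e r in simp)
  then show "\<forall>\<^sub>F n in sequentially. (\<integral>\<^sup>+x. ennreal (cmod (f n x - g x)) \<partial>M) < a"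
  proof eventually_elim
    case (elim n)
    have [measurable]: "(\<lambda>x. f n x - g x) \<in> borel_measurable M" by (rule assms(3))
    have "(\<integral>\<^sup>+x. ennreal (cmod (f n x - g x)) \<partial>M) \<le>
        (\<integral>\<^sup>+x. ennreal e + ennreal (1 / e) * ennreal ((cmod (f n x - g x))\<^sup>2) \<partial>M)"
    proof (rule nn_integral_mono)
      fix x
      let ?d = "cmod (f n x - g x)"
      have "?d \<le> e + 1 / e * ?d\<^sup>2"
      proof (cases "?d \<le> e")
        case False
        then have "e * ?d \<le> ?d\<^sup>2" unfolding power2_eq_square by (intro mult_right_mono) auto
        then have "e * ?d \<le> e * e + ?d\<^sup>2" using zero_le_square[of e] by linarith
        then show ?thesis using e by (simp add: field_simps)
      next
        case True
        moreover have "0 \<le> 1 / e * ?d\<^sup>2" using e by simp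
        ultimately show ?thesis by linarith
      qed
      then have "ennreal ?d \<le> ennreal (e + 1 / e * ?d\<^sup>2)" by (rule ennreal_leI)
      also have "\<dots> = ennreal e + ennreal (1 / e * ?d\<^sup>2)" using e by (intro ennreal_plus) auto
      also have "ennreal (1 / e * ?d\<^sup>2) = ennreal (1 / e) * ennreal (?d\<^sup>2)" using e by (intro ennreal_mult) auto
      finally show "ennreal ?d \<le> ennreal e + ennreal (1 / e) * ennreal (?d\<^sup>2)" .
    qed
    also have "\<dots> = ennreal e * ennreal m + ennreal (1 / e) * (\<integral>\<^sup>+x. ennreal ((cmod (f n x - g x))\<^sup>2) \<partial>M)"
      by (subst nn_integral_add, measurable) (simp add: nn_integral_cmult m)
    also have "\<dots> \<le> ennreal e * ennreal m + ennreal (1 / e) * ennreal (e * (r / 2))"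
      using elim by (intro add_left_mono mult_left_mono) auto
    also have "\<dots> = ennreal (e * m + 1 / e * (e * (r / 2)))"
    proof -
      have "ennreal (e * m + 1 / e * (e * (r / 2))) = ennreal (e * m) + ennreal (1 / e * (e * (r / 2)))"
        using e m r by (intro ennreal_plus) auto
      moreover have "ennreal (e * m) = ennreal e * ennreal m" using e m by (intro ennreal_mult) auto
      moreover have "ennreal (1 / e * (e * (r / 2))) = ennreal (1 / e) * ennreal (e * (r / 2))"
        using e r by (intro ennreal_mult) auto
      ultimately show ?thesis by (simp only:)
    qed
    also have "\<dots> \<le> ennreal r" using em e by (intro ennreal_leI) simp
    also have "\<dots> < a" using b r by simp
    finally show ?case .
  qed
qed simp

lemma L2_converges_integral_times:
  assumes M: "finite_measure M" and conv: "L2_converges M f g"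
    and m: "\<And>n. (\<lambda>x. f n x - g x) \<in> borel_measurable M"
    and X: "X \<in> borel_measurable M" "\<And>x. x \<in> space M \<Longrightarrow> cmod (X x) \<le> B"
    and int: "\<And>n. integrable M (\<lambda>x. f n x * X x)" "integrable M (\<lambda>x. g x * X x)"
  shows "(\<lambda>n. LINT x|M. f n x * X x) \<longlonglongrightarrow> (LINT x|M. g x * X x)"
proof -
  let ?D = "\<lambda>n. (LINT x|M. f n x * X x) - (LINT x|M. g x * X x)"
  let ?d = "\<lambda>n. \<integral>\<^sup>+x. ennreal (cmod (f n x - g x)) \<partial>M"
  have "(\<lambda>n. ennreal (cmod (?D n))) \<longlonglongrightarrow> 0"
  proof (rule tendsto_sandwich[OF _ _ tendsto_const])
    show "\<forall>\<^sub>F n in sequentially. ennreal (cmod (?D n))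
        \<le> ennreal (max B 0) * ?d n"
    proof (rule always_eventually, intro allI)
      fix n
      have [measurable]: "(\<lambda>x. f n x - g x) \<in> borel_measurable M" by (rule m)
      have "ennreal (cmod (?D n)) =
          ennreal (cmod (LINT x|M. f n x * X x - g x * X x))"
        using int by simp
      also have "\<dots> \<le> (\<integral>\<^sup>+x. ennreal (cmod (f n x * X x - g x * X x)) \<partial>M)"
        using int by (intro integral_norm_bound_ennreal Bochner_Integration.integrable_diff)
      also have "\<dots> \<le> (\<integral>\<^sup>+x. ennreal (max B 0) * ennreal (cmod (f n x - g x)) \<partial>M)"
      proof (rule nn_integral_mono)
        fix x assume "x \<in> space M"
        then have "cmod (X x) \<le> max B 0" using X(2) by (simp add: le_max_iff_disj)
        then have "cmod (f n x - g x) * cmod (X x) \<le> cmod (f n x - g x) * max B 0"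
          by (intro mult_left_mono) auto
        then have "ennreal (cmod (f n x * X x - g x * X x)) \<le> ennreal (max B 0 * cmod (f n x - g x))"
          by (intro ennreal_leI) (simp only: left_diff_distrib[symmetric] norm_mult mult.commute[of _ "max B 0"])
        then show "ennreal (cmod (f n x * X x - g x * X x)) \<le> ennreal (max B 0) * ennreal (cmod (f n x - g x))"
          by (subst (asm) ennreal_mult) (auto simp only: max.cobounded2 norm_ge_zero)
      qed
      also have "\<dots> = ennreal (max B 0) * ?d n"
        by (rule nn_integral_cmult) simp
      finally show "ennreal (cmod (?D n))
        \<le> ennreal (max B 0) * ?d n" .
    qed
    have "(\<lambda>n. ennreal (max B 0) * ?d n) \<longlonglongrightarrow> ennreal (max B 0) * 0"
      by (intro ennreal_tendsto_cmult L2_converges_imp_L1[OF M conv m]) simp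
    then show "(\<lambda>n. ennreal (max B 0) * ?d n) \<longlonglongrightarrow> 0" by simp
  qed simp
  then have "(\<lambda>n. cmod (?D n)) \<longlonglongrightarrow> 0"
    by (subst (asm) ennreal_tendsto_0_iff) (rule norm_ge_zero)
  then have "(\<lambda>n. (LINT x|M. f n x * X x) - (LINT x|M. g x * X x)) \<longlonglongrightarrow> 0"
    by (rule tendsto_norm_zero_cancel)
  then show ?thesis by (rule Lim_null[THEN iffD2])
qed

lemma finite_measure_lebesgue_on:
  fixes \<Omega> :: "'a::euclidean_space set"
  assumes "\<Omega> \<in> sets borel" "bounded \<Omega>"
  shows "finite_measure (lebesgue_on \<Omega>)"
proof
  have "emeasure (lebesgue_on \<Omega>) \<Omega> = emeasure lborel \<Omega>"
    using assms by (subst emeasure_restrict_space) auto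
  then show "emeasure (lebesgue_on \<Omega>) (space (lebesgue_on \<Omega>)) \<noteq> \<infinity>"
    using emeasure_bounded_finite[OF assms(2)] by simp
qed

lemma continuous_bounded_on_closure:
  fixes g :: "'a::heine_borel \<Rightarrow> complex"
  assumes "bounded \<Omega>" "continuous_on UNIV g"
  shows "\<exists>B\<ge>0. \<forall>x\<in>closure \<Omega>. cmod (g x) \<le> B"
proof -
  have "compact (g ` closure \<Omega>)"
    using assms by (intro compact_continuous_image continuous_on_subset[OF assms(2)]) auto
  then have "bounded (g ` closure \<Omega>)" by (rule compact_imp_bounded)
  then obtain B where "\<forall>x\<in>closure \<Omega>. cmod (g x) \<le> B" unfolding bounded_iff by blast
  then show ?thesis by (intro exI[of _ "max B 0"]) (auto simp: le_max_iff_disj)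
qed

text \<open>
  The property of the boundary behind the trace theory below is its finite area. It makes restrictions of smooth functions square integrable and square integrable functions integrable.
\<close>

locale trace_domain =
  fixes \<Omega> :: "(real^3) set"
  assumes open_dom: "open \<Omega>" and bounded_dom: "bounded \<Omega>"
    and boundary_finite: "emeasure hausdorff2 (frontier \<Omega>) \<noteq> \<infinity>"
begin

lemma borel_dom: "\<Omega> \<in> sets borel" using open_dom by simp

lemma finite_dom: "finite_measure (lebesgue_on \<Omega>)"
  by (rule finite_measure_lebesgue_on[OF borel_dom bounded_dom])

lemma finite_boundary: "finite_measure (boundary_measure \<Omega>)"
proof
  show "emeasure (boundary_measure \<Omega>) (space (boundary_measure \<Omega>)) \<noteq> \<infinity>"
    using boundary_finite by (simp add: boundary_measure_def emeasure_restrict_space space_restrict_space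
        measurable_cong_sets[OF sets_hausdorff2 refl] sets_eq_imp_space_eq[OF sets_hausdorff2])
qed

lemma smooth_bounded: "smooth v \<Longrightarrow> \<exists>B\<ge>0. \<forall>x\<in>closure \<Omega>. cmod (v x) \<le> B"
  by (intro continuous_bounded_on_closure bounded_dom smooth_continuous_on)

lemma smooth_integrable: "smooth v \<Longrightarrow> integrable (lebesgue_on \<Omega>) v"
  by (intro integrable_lebesgue_on_continuous borel_dom bounded_dom smooth_continuous_on)

lemma smooth_measurable: "smooth v \<Longrightarrow> v \<in> borel_measurable (lebesgue_on \<Omega>)"
  by (intro borel_measurable_integrable smooth_integrable)

lemma smooth_L2: "smooth v \<Longrightarrow> L2 (lebesgue_on \<Omega>) v"
  unfolding L2_def
  by (intro conjI smooth_measurable integrable_lebesgue_on_continuous borel_dom bounded_dom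
      continuous_intros smooth_continuous_on)

lemma smooth_L2_boundary: 
  assumes "smooth v"
  shows "L2 (boundary_measure \<Omega>) v"
proof -
  obtain B where B: "\<forall>x\<in>closure \<Omega>. cmod (v x) \<le> B" using smooth_bounded[OF assms] by blast
  have "v \<in> borel_measurable borel" by (intro borel_measurable_continuous_onI smooth_continuous_on assms)
  then have m: "v \<in> borel_measurable (boundary_measure \<Omega>)"
    unfolding boundary_measure_def
    by (intro measurable_restrict_space1) (simp add: measurable_cong_sets[OF sets_hausdorff2 refl])
  have "integrable (boundary_measure \<Omega>) (\<lambda>x. (cmod (v x))\<^sup>2)"
  proof (rule finite_measure.integrable_const_bound[OF finite_boundary])
    show "AE x in boundary_measure \<Omega>. norm ((cmod (v x))\<^sup>2) \<le> B\<^sup>2"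
    proof (rule AE_I2)
      fix x assume "x \<in> space (boundary_measure \<Omega>)"
      then have "x \<in> closure \<Omega>" by (simp add: boundary_measure_def space_restrict_space frontier_def)
      then show "norm ((cmod (v x))\<^sup>2) \<le> B\<^sup>2" using B by (simp add: power_mono)
    qed
  qed (use m in measurable)
  with m show ?thesis by (simp add: L2_def)
qed

text \<open>
  The flux estimate applied to \<open>v \<phi>\<close>, which vanishes on the boundary.
\<close>

lemma integration_by_parts_test:
  assumes v: "smooth v" and \<phi>: "\<phi> \<in> test_functions \<Omega>"
  shows "(LINT x|lebesgue_on \<Omega>. v x * partial_deriv i \<phi> x) = - (LINT x|lebesgue_on \<Omega>. partial_deriv i v x * \<phi> x)"
proof -
  have s\<phi>: "smooth \<phi>" and supp: "closure {x. \<phi> x \<noteq> 0} \<subseteq> \<Omega>" using \<phi> unfolding test_functions_def by blast+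
  have "\<phi> y = 0" if y: "y \<in> frontier \<Omega>" for y
  proof (rule ccontr)
    assume "\<phi> y \<noteq> 0"
    then have "y \<in> closure {x. \<phi> x \<noteq> 0}" using closure_subset[of "{x. \<phi> x \<noteq> 0}"] by blast
    then have "y \<in> interior \<Omega>" using supp interior_open[OF open_dom] by blast
    with y show False by (simp add: frontier_def)
  qed
  then have "(\<integral>\<^sup>+y. ennreal (cmod (v y * \<phi> y)) \<partial>boundary_measure \<Omega>) = (\<integral>\<^sup>+y. 0 \<partial>boundary_measure \<Omega>)"
    by (intro nn_integral_cong) (simp add: boundary_measure_def space_restrict_space)
  moreover have "ennreal (cmod (LINT x|lebesgue_on \<Omega>. partial_deriv i (\<lambda>x. v x * \<phi> x) x)) \<le>
      ennreal (64 / pi) * (\<integral>\<^sup>+y. ennreal (cmod (v y * \<phi> y)) \<partial>boundary_measure \<Omega>)"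
    by (intro cmod_integral_partial_deriv_le open_dom bounded_dom boundary_finite smooth_mult v s\<phi>)
  ultimately have "(LINT x|lebesgue_on \<Omega>. partial_deriv i (\<lambda>x. v x * \<phi> x) x) = 0" by simp
  then have "(LINT x|lebesgue_on \<Omega>. v x * partial_deriv i \<phi> x + partial_deriv i v x * \<phi> x) = 0"
    by (simp only: partial_deriv_mult[OF v s\<phi>])
  moreover have "integrable (lebesgue_on \<Omega>) (\<lambda>x. v x * partial_deriv i \<phi> x)"
    "integrable (lebesgue_on \<Omega>) (\<lambda>x. partial_deriv i v x * \<phi> x)"
    by (intro smooth_integrable smooth_mult v s\<phi> smooth_partial_deriv)+
  ultimately show ?thesis by (simp add: eq_neg_iff_add_eq_0)
qed

lemma weak_grad_is_weak_grad: "u \<in> H1 \<Omega> \<Longrightarrow> is_weak_grad \<Omega> u (weak_grad \<Omega> u)"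
  unfolding H1_def weak_grad_def by (simp add: someI_ex)

lemma is_weak_grad_smooth:
  assumes "smooth v"
  shows "is_weak_grad \<Omega> v (\<lambda>x. \<chi> i. partial_deriv i v x)"
  unfolding is_weak_grad_def
  using assms by (auto intro!: smooth_L2 smooth_partial_deriv integration_by_parts_test)

lemma smooth_in_H1: "smooth v \<Longrightarrow> v \<in> H1 \<Omega>"
  unfolding H1_def using smooth_L2 is_weak_grad_smooth by blast

lemma L2_times_smooth_integrable:
  assumes "L2 (lebesgue_on \<Omega>) f" "smooth v"
  shows "integrable (lebesgue_on \<Omega>) (\<lambda>x. f x * v x)"
proof -
  obtain B where "\<forall>x\<in>closure \<Omega>. cmod (v x) \<le> B" using smooth_bounded[OF assms(2)] by blast
  then show ?thesis
    using closure_subset[of \<Omega>] assms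
    by (intro integrable_L2_times_bounded[OF finite_dom, where B = B] smooth_measurable) auto
qed

lemma weak_grad_smooth_AE:
  assumes v: "smooth v"
  shows "AE x in lebesgue_on \<Omega>. weak_grad \<Omega> v x $ i = partial_deriv i v x"
proof -
  let ?G = "weak_grad \<Omega> v"
  have G: "is_weak_grad \<Omega> v ?G" by (intro weak_grad_is_weak_grad smooth_in_H1 v)
  then have L: "L2 (lebesgue_on \<Omega>) (\<lambda>x. ?G x $ i)" by (simp add: is_weak_grad_def)
  have "AE x in lebesgue_on \<Omega>. ?G x $ i - partial_deriv i v x = 0"
  proof (rule AE_zero_of_test_integrals_zero[OF open_dom])
    show "integrable (lebesgue_on \<Omega>) (\<lambda>x. ?G x $ i - partial_deriv i v x)"
    proof (rule Bochner_Integration.integrable_diff)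
      show "integrable (lebesgue_on \<Omega>) (\<lambda>x. ?G x $ i)"
        using L2_times_smooth_integrable[OF L smooth_const[of 1]] by simp
    qed (intro smooth_integrable smooth_partial_deriv v)
    fix \<phi> assume \<phi>: "\<phi> \<in> test_functions \<Omega>"
    then have s\<phi>: "smooth \<phi>" unfolding test_functions_def by blast
    have "(LINT x|lebesgue_on \<Omega>. ?G x $ i * \<phi> x) = (LINT x|lebesgue_on \<Omega>. partial_deriv i v x * \<phi> x)"
      using G \<phi> integration_by_parts_test[OF v \<phi>, of i] by (simp add: is_weak_grad_def)
    then show "(LINT x|lebesgue_on \<Omega>. (?G x $ i - partial_deriv i v x) * \<phi> x) = 0"
      using L2_times_smooth_integrable[OF L s\<phi>] smooth_integrable[OF smooth_mult[OF smooth_partial_deriv[OF v] s\<phi>]]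
      by (simp add: left_diff_distrib)
  qed
  then show ?thesis by eventually_elim simp
qed

text \<open>
  The constant sequence is an approximating sequence, once the chosen weak gradient is known to agree with
  the classical one. Hence smooth functions may be inserted into the weak normal derivative.
\<close>

lemma has_trace_smooth:
  assumes v: "smooth v"
  shows "has_trace \<Omega> v v"
  unfolding has_trace_def
proof (intro conjI exI[of _ "\<lambda>_. v"] allI smooth_in_H1 smooth_L2_boundary v)
  have self: "L2_converges M (\<lambda>_. v) v" for M :: "(real^3) measure" by (simp add: L2_converges_def)
  show "L2_converges (lebesgue_on \<Omega>) (\<lambda>_. v) v" "L2_converges (boundary_measure \<Omega>) (\<lambda>_. v) v"
    by (rule self)+
  fix i
  have "(\<integral>\<^sup>+x. ennreal ((cmod (partial_deriv i v x - weak_grad \<Omega> v x $ i))\<^sup>2) \<partial>lebesgue_on \<Omega>) =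
      (\<integral>\<^sup>+x. 0 \<partial>lebesgue_on \<Omega>)"
    using weak_grad_smooth_AE[OF v, of i] by (intro nn_integral_cong_AE) (auto elim!: eventually_mono)
  then show "L2_converges (lebesgue_on \<Omega>) (\<lambda>n. partial_deriv i v) (\<lambda>x. weak_grad \<Omega> v x $ i)"
    by (simp add: L2_converges_def)
qed

lemma helmholtz_form_smooth:
  assumes u: "u \<in> H1 \<Omega>" and F: "L2 (lebesgue_on \<Omega>) F" and v: "smooth v"
  shows "helmholtz_form \<Omega> k F u v =
    (\<Sum>i\<in>UNIV. LINT x|lebesgue_on \<Omega>. weak_grad \<Omega> u x $ i * partial_deriv i v x)
    - (complex_of_real k)\<^sup>2 * (LINT x|lebesgue_on \<Omega>. u x * v x) + (LINT x|lebesgue_on \<Omega>. F x * v x)"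
proof -
  let ?M = "lebesgue_on \<Omega>"
  let ?g = "\<lambda>i x. weak_grad \<Omega> u x $ i * partial_deriv i v x"
  have G: "L2 ?M (\<lambda>x. weak_grad \<Omega> u x $ i)" "L2 ?M (\<lambda>x. weak_grad \<Omega> v x $ i)" for i
    using weak_grad_is_weak_grad[OF u] weak_grad_is_weak_grad[OF smooth_in_H1[OF v]] by (simp_all add: is_weak_grad_def)
  have uL: "L2 ?M u" using u by (simp add: H1_def)
  have int: "integrable ?M (\<lambda>x. ?g i x)" "integrable ?M (\<lambda>x. u x * v x)"
    "integrable ?M (\<lambda>x. F x * v x)" for i
    by (intro L2_times_smooth_integrable G uL F smooth_partial_deriv v)+
  have mG: "(\<lambda>x. weak_grad \<Omega> u x $ i) \<in> borel_measurable ?M" "(\<lambda>x. weak_grad \<Omega> v x $ i) \<in> borel_measurable ?M" for i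
    using G by (simp_all add: L2_def)
  have mm: "u \<in> borel_measurable ?M" "F \<in> borel_measurable ?M" "v \<in> borel_measurable ?M"
    "partial_deriv i v \<in> borel_measurable ?M" for i
    using uL F smooth_measurable[OF v] smooth_measurable[OF smooth_partial_deriv[OF v]] by (auto simp: L2_def)
  have "helmholtz_form \<Omega> k F u v = (LINT x|?M. (\<Sum>i\<in>UNIV. ?g i x)
      - (complex_of_real k)\<^sup>2 * u x * v x + F x * v x)"
    unfolding helmholtz_form_def
  proof (rule integral_cong_AE)
    have "AE x in ?M. \<forall>i\<in>UNIV. weak_grad \<Omega> v x $ i = partial_deriv i v x"
      using weak_grad_smooth_AE[OF v] by (subst AE_ball_countable) auto
    then show "AE x in ?M. (\<Sum>i\<in>UNIV. weak_grad \<Omega> u x $ i * weak_grad \<Omega> v x $ i) - (complex_of_real k)\<^sup>2 * u x * v x + F x * v x =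
        (\<Sum>i\<in>UNIV. ?g i x) - (complex_of_real k)\<^sup>2 * u x * v x + F x * v x"
      by eventually_elim simp
  qed (intro borel_measurable_add borel_measurable_diff borel_measurable_sum borel_measurable_times
      borel_measurable_const mG mm)+
  also have "\<dots> = (LINT x|?M. (\<Sum>i\<in>UNIV. ?g i x)
      - (complex_of_real k)\<^sup>2 * (u x * v x) + F x * v x)"
    by (simp only: mult.assoc)
  also have "\<dots> = (LINT x|?M. (\<Sum>i\<in>UNIV. ?g i x))
      - (LINT x|?M. (complex_of_real k)\<^sup>2 * (u x * v x)) + (LINT x|?M. F x * v x)"
  proof -
    have i1: "integrable ?M (\<lambda>x. \<Sum>i\<in>UNIV. ?g i x)"
      by (intro Bochner_Integration.integrable_sum int)
    have i2: "integrable ?M (\<lambda>x. (complex_of_real k)\<^sup>2 * (u x * v x))"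
      by (intro integrable_mult_right int)
    show ?thesis
      unfolding Bochner_Integration.integral_add[OF Bochner_Integration.integrable_diff[OF i1 i2] int(3)]
        Bochner_Integration.integral_diff[OF i1 i2] ..
  qed
  also have "\<dots> = (\<Sum>i\<in>UNIV. LINT x|?M. ?g i x)
      - (complex_of_real k)\<^sup>2 * (LINT x|?M. u x * v x) + (LINT x|?M. F x * v x)"
    using int by (simp add: Bochner_Integration.integral_sum)
  finally show ?thesis .
qed

text \<open>
  For smooth \<open>\<phi>\<close> the product rule and the equation \<open>\<Delta>v = c v\<close> turn \<open>\<integral> \<nabla>\<phi> \<bullet> \<nabla>v + c \<phi> v\<close> into the integral of a
  divergence. The left-hand side is continuous with respect to convergence in \<open>H\<^sup>1\<close>.
\<close>

lemma green_pairing_limit: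
  assumes u: "u \<in> H1 \<Omega>" and \<phi>: "\<And>n. smooth (\<phi> n)"
    and conv: "L2_converges (lebesgue_on \<Omega>) \<phi> u"
      "\<And>i. L2_converges (lebesgue_on \<Omega>) (\<lambda>n. partial_deriv i (\<phi> n)) (\<lambda>x. weak_grad \<Omega> u x $ i)"
    and v: "smooth v" and helm: "\<And>x. (\<Sum>i\<in>UNIV. partial_deriv i (partial_deriv i v) x) = c * v x"
  shows "(\<lambda>n. \<Sum>i\<in>UNIV. LINT x|lebesgue_on \<Omega>. partial_deriv i (\<lambda>x. \<phi> n x * partial_deriv i v x) x) \<longlonglongrightarrow>
    (\<Sum>i\<in>UNIV. LINT x|lebesgue_on \<Omega>. weak_grad \<Omega> u x $ i * partial_deriv i v x) + c * (LINT x|lebesgue_on \<Omega>. u x * v x)"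
proof -
  let ?M = "lebesgue_on \<Omega>"
  have uL: "L2 ?M u" using u by (simp add: H1_def)
  have G: "L2 ?M (\<lambda>x. weak_grad \<Omega> u x $ i)" for i
    using weak_grad_is_weak_grad[OF u] by (simp add: is_weak_grad_def)
  have dv: "smooth (partial_deriv i v)" "smooth (partial_deriv i (partial_deriv i v))" for i
    by (intro smooth_partial_deriv v)+
  have lim: "(\<lambda>n. LINT x|?M. f n x * w x) \<longlonglongrightarrow> (LINT x|?M. g x * w x)"
    if f: "\<And>n. smooth (f n)" and g: "L2 ?M g" and fg: "L2_converges ?M f g" and w: "smooth w" for f g w
  proof -
    obtain B where B: "\<forall>x\<in>closure \<Omega>. cmod (w x) \<le> B" using smooth_bounded[OF w] by blast
    show ?thesis
    proof (rule L2_converges_integral_times[OF finite_dom fg, where B = B])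
      have "g \<in> borel_measurable ?M" using g by (simp add: L2_def)
      then show "(\<lambda>x. f n x - g x) \<in> borel_measurable ?M" for n
        using smooth_measurable[OF f[of n]] by (rule borel_measurable_diff[rotated])
      show "cmod (w x) \<le> B" if "x \<in> space ?M" for x using that B closure_subset[of \<Omega>] by auto
    qed (intro smooth_measurable smooth_integrable smooth_mult f w L2_times_smooth_integrable g)+
  qed
  have "(\<Sum>i\<in>UNIV. LINT x|?M. partial_deriv i (\<lambda>x. \<phi> n x * partial_deriv i v x) x) =
      (\<Sum>i\<in>UNIV. LINT x|?M. partial_deriv i (\<phi> n) x * partial_deriv i v x) + c * (LINT x|?M. \<phi> n x * v x)" for n
  proof -
    have int1: "integrable ?M (\<lambda>x. \<phi> n x * partial_deriv i (partial_deriv i v) x)"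
      and int2: "integrable ?M (\<lambda>x. partial_deriv i (\<phi> n) x * partial_deriv i v x)" for i
      by (intro smooth_integrable smooth_mult \<phi> dv smooth_partial_deriv)+
    have "(LINT x|?M. partial_deriv i (\<lambda>x. \<phi> n x * partial_deriv i v x) x) =
        (LINT x|?M. \<phi> n x * partial_deriv i (partial_deriv i v) x) + (LINT x|?M. partial_deriv i (\<phi> n) x * partial_deriv i v x)" for i
      unfolding partial_deriv_mult[OF \<phi> dv(1)] by (rule Bochner_Integration.integral_add[OF int1 int2])
    moreover have "(\<Sum>i\<in>UNIV. LINT x|?M. \<phi> n x * partial_deriv i (partial_deriv i v) x) = c * (LINT x|?M. \<phi> n x * v x)"
    proof -
      have "(\<Sum>i\<in>UNIV. LINT x|?M. \<phi> n x * partial_deriv i (partial_deriv i v) x) =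
          (LINT x|?M. (\<Sum>i\<in>UNIV. \<phi> n x * partial_deriv i (partial_deriv i v) x))"
        by (rule Bochner_Integration.integral_sum[symmetric]) (rule int1)
      also have "\<dots> = (LINT x|?M. c * (\<phi> n x * v x))"
        by (simp only: sum_distrib_left[symmetric] helm mult.left_commute)
      finally show ?thesis by simp
    qed
    ultimately show ?thesis by (simp add: sum.distrib)
  qed
  moreover have "(\<lambda>n. (\<Sum>i\<in>UNIV. LINT x|?M. partial_deriv i (\<phi> n) x * partial_deriv i v x) + c * (LINT x|?M. \<phi> n x * v x)) \<longlonglongrightarrow>
      (\<Sum>i\<in>UNIV. LINT x|?M. weak_grad \<Omega> u x $ i * partial_deriv i v x) + c * (LINT x|?M. u x * v x)"
    by (intro tendsto_add tendsto_sum tendsto_mult tendsto_const lim smooth_partial_deriv \<phi> G uL conv v)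
  ultimately show ?thesis by simp
qed

lemma boundary_flux_tendsto_0:
  assumes \<psi>: "\<And>n. smooth (\<psi> n)" and w: "smooth w"
    and conv: "(\<lambda>n. \<integral>\<^sup>+y. ennreal (cmod (\<psi> n y)) \<partial>boundary_measure \<Omega>) \<longlonglongrightarrow> 0"
  shows "(\<lambda>n. LINT x|lebesgue_on \<Omega>. partial_deriv i (\<lambda>x. \<psi> n x * w x) x) \<longlonglongrightarrow> 0"
proof -
  let ?b = "boundary_measure \<Omega>"
  let ?F = "\<lambda>n. LINT x|lebesgue_on \<Omega>. partial_deriv i (\<lambda>x. \<psi> n x * w x) x"
  let ?P = "\<lambda>n. \<integral>\<^sup>+y. ennreal (cmod (\<psi> n y)) \<partial>?b"
  obtain B where B: "0 \<le> B" "\<forall>x\<in>closure \<Omega>. cmod (w x) \<le> B" using smooth_bounded[OF w] by blast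
  have "(\<lambda>n. ennreal (cmod (?F n))) \<longlonglongrightarrow> 0"
  proof (rule tendsto_sandwich[OF _ _ tendsto_const])
    show "\<forall>\<^sub>F n in sequentially. ennreal (cmod (?F n)) \<le>
        ennreal (64 / pi) * (ennreal B * (?P n))"
    proof (rule always_eventually, intro allI)
      fix n
      have "ennreal (cmod (?F n)) \<le>
          ennreal (64 / pi) * (\<integral>\<^sup>+y. ennreal (cmod (\<psi> n y * w y)) \<partial>?b)"
        by (intro cmod_integral_partial_deriv_le open_dom bounded_dom boundary_finite smooth_mult \<psi> w)
      also have "(\<integral>\<^sup>+y. ennreal (cmod (\<psi> n y * w y)) \<partial>?b) \<le> (\<integral>\<^sup>+y. ennreal B * ennreal (cmod (\<psi> n y)) \<partial>?b)"
      proof (rule nn_integral_mono)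
        fix y assume "y \<in> space ?b"
        then have "y \<in> closure \<Omega>" by (simp add: boundary_measure_def space_restrict_space frontier_def)
        then have "cmod (\<psi> n y * w y) \<le> B * cmod (\<psi> n y)"
          using B by (simp add: norm_mult mult.commute[of B] mult_left_mono)
        then have "ennreal (cmod (\<psi> n y * w y)) \<le> ennreal (B * cmod (\<psi> n y))" by (rule ennreal_leI)
        also have "\<dots> = ennreal B * ennreal (cmod (\<psi> n y))" using B by (intro ennreal_mult) auto
        finally show "ennreal (cmod (\<psi> n y * w y)) \<le> ennreal B * ennreal (cmod (\<psi> n y))" .
      qed
      also have "\<dots> = ennreal B * (?P n)"
      proof (rule nn_integral_cmult)
        have "\<psi> n \<in> borel_measurable ?b" using smooth_L2_boundary[OF \<psi>[of n]] by (simp add: L2_def)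
        then show "(\<lambda>y. ennreal (cmod (\<psi> n y))) \<in> borel_measurable ?b" by measurable
      qed
      finally show "ennreal (cmod (?F n)) \<le>
          ennreal (64 / pi) * (ennreal B * (?P n))"
        by (simp add: mult_left_mono)
    qed
    have "(\<lambda>n. ennreal (64 / pi) * (ennreal B * (?P n))) \<longlonglongrightarrow> ennreal (64 / pi) * (ennreal B * 0)"
      by (intro ennreal_tendsto_cmult conv) simp_all
    then show "(\<lambda>n. ennreal (64 / pi) * (ennreal B * (?P n))) \<longlonglongrightarrow> 0" by simp
  qed simp
  then have "(\<lambda>n. cmod (?F n)) \<longlonglongrightarrow> 0"
    by (subst (asm) ennreal_tendsto_0_iff) (rule norm_ge_zero)
  then show ?thesis by (rule tendsto_norm_zero_cancel)
qed

text \<open>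
  The limits of the divergence integrals for the two approximating sequences agree, since the difference of
  the sequences tends to zero on the boundary. So \<open>\<integral> \<nabla>u \<bullet> \<nabla>v - k\<^sup>2 u v\<close> is the same for \<open>u1\<close> and \<open>u2\<close>, and the
  common normal derivative, tested with \<open>v\<close>, leaves equality of the source terms.
\<close>

lemma source_moments_eq:
  assumes c1: "has_cauchy_data \<Omega> k F1 u1 (\<gamma>, \<Lambda>)" and c2: "has_cauchy_data \<Omega> k F2 u2 (\<gamma>, \<Lambda>)"
    and F1: "L2 (lebesgue_on \<Omega>) F1" and F2: "L2 (lebesgue_on \<Omega>) F2" and v: "smooth v"
    and helm: "\<And>x. (\<Sum>i\<in>UNIV. partial_deriv i (partial_deriv i v) x) = - (complex_of_real k)\<^sup>2 * v x"
  shows "(LINT x|lebesgue_on \<Omega>. F1 x * v x) = (LINT x|lebesgue_on \<Omega>. F2 x * v x)"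
proof -
  let ?M = "lebesgue_on \<Omega>" and ?b = "boundary_measure \<Omega>"
  let ?P = "\<lambda>u. (\<Sum>i\<in>UNIV. LINT x|?M. weak_grad \<Omega> u x $ i * partial_deriv i v x) + - (complex_of_real k)\<^sup>2 * (LINT x|?M. u x * v x)"
  let ?J = "\<lambda>\<phi>. \<Sum>i\<in>UNIV. LINT x|?M. partial_deriv i (\<lambda>x. \<phi> x * partial_deriv i v x) x"
  let ?d = "\<lambda>\<phi>. \<integral>\<^sup>+y. ennreal (cmod (\<phi> y - \<gamma> y)) \<partial>?b"
  have t1: "has_trace \<Omega> u1 \<gamma>" and n1: "has_normal_derivative \<Omega> k F1 u1 \<Lambda>"
    and t2: "has_trace \<Omega> u2 \<gamma>" and n2: "has_normal_derivative \<Omega> k F2 u2 \<Lambda>"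
    using c1 c2 by (simp_all add: has_cauchy_data_def)
  have u: "u1 \<in> H1 \<Omega>" "u2 \<in> H1 \<Omega>" and \<gamma>: "L2 ?b \<gamma>" using t1 t2 unfolding has_trace_def by blast+
  obtain \<phi>1 where \<phi>1: "\<And>n::nat. smooth (\<phi>1 n)" "L2_converges ?M \<phi>1 u1"
    "\<And>i. L2_converges ?M (\<lambda>n. partial_deriv i (\<phi>1 n)) (\<lambda>x. weak_grad \<Omega> u1 x $ i)" "L2_converges ?b \<phi>1 \<gamma>"
    using t1 unfolding has_trace_def by blast
  obtain \<phi>2 where \<phi>2: "\<And>n::nat. smooth (\<phi>2 n)" "L2_converges ?M \<phi>2 u2"
    "\<And>i. L2_converges ?M (\<lambda>n. partial_deriv i (\<phi>2 n)) (\<lambda>x. weak_grad \<Omega> u2 x $ i)" "L2_converges ?b \<phi>2 \<gamma>"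
    using t2 unfolding has_trace_def by blast
  have l1: "(\<lambda>n. ?J (\<phi>1 n)) \<longlonglongrightarrow> ?P u1" by (rule green_pairing_limit[OF u(1) \<phi>1(1-3) v helm])
  have l2: "(\<lambda>n. ?J (\<phi>2 n)) \<longlonglongrightarrow> ?P u2" by (rule green_pairing_limit[OF u(2) \<phi>2(1-3) v helm])
  have dv: "smooth (partial_deriv i v)" for i by (rule smooth_partial_deriv[OF v])
  have mb: "(\<lambda>x. \<phi> x - \<gamma> x) \<in> borel_measurable ?b" if "smooth \<phi>" for \<phi>
    using smooth_L2_boundary[OF that] \<gamma> by (intro borel_measurable_diff) (simp_all add: L2_def)
  have traces: "(\<lambda>n. \<integral>\<^sup>+y. ennreal (cmod (\<phi>1 n y - \<phi>2 n y)) \<partial>?b) \<longlonglongrightarrow> 0"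
  proof (rule tendsto_sandwich[OF _ _ tendsto_const])
    show "\<forall>\<^sub>F n in sequentially. (\<integral>\<^sup>+y. ennreal (cmod (\<phi>1 n y - \<phi>2 n y)) \<partial>?b) \<le>
        ?d (\<phi>1 n) + ?d (\<phi>2 n)"
    proof (rule always_eventually, intro allI)
      fix n
      have "(\<integral>\<^sup>+y. ennreal (cmod (\<phi>1 n y - \<phi>2 n y)) \<partial>?b) \<le>
          (\<integral>\<^sup>+y. ennreal (cmod (\<phi>1 n y - \<gamma> y)) + ennreal (cmod (\<phi>2 n y - \<gamma> y)) \<partial>?b)"
      proof (rule nn_integral_mono)
        fix y
        have "cmod (\<phi>1 n y - \<phi>2 n y) \<le> cmod (\<phi>1 n y - \<gamma> y) + cmod (\<phi>2 n y - \<gamma> y)"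
          using norm_triangle_ineq4[of "\<phi>1 n y - \<gamma> y" "\<phi>2 n y - \<gamma> y"] by simp
        then have "ennreal (cmod (\<phi>1 n y - \<phi>2 n y)) \<le> ennreal (cmod (\<phi>1 n y - \<gamma> y) + cmod (\<phi>2 n y - \<gamma> y))"
          by (rule ennreal_leI)
        then show "ennreal (cmod (\<phi>1 n y - \<phi>2 n y)) \<le> ennreal (cmod (\<phi>1 n y - \<gamma> y)) + ennreal (cmod (\<phi>2 n y - \<gamma> y))"
          by simp
      qed
      also have "\<dots> = ?d (\<phi>1 n) + ?d (\<phi>2 n)"
        by (intro nn_integral_add measurable_compose[OF _ measurable_ennreal] measurable_compose[OF mb borel_measurable_norm] \<phi>1(1) \<phi>2(1))
      finally show "(\<integral>\<^sup>+y. ennreal (cmod (\<phi>1 n y - \<phi>2 n y)) \<partial>?b) \<le> \<dots>" .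
    qed
    have "(\<lambda>n. ?d (\<phi>1 n) + ?d (\<phi>2 n)) \<longlonglongrightarrow> 0 + 0"
      by (intro tendsto_add L2_converges_imp_L1[OF finite_boundary] mb \<phi>1 \<phi>2)
    then show "(\<lambda>n. ?d (\<phi>1 n) + ?d (\<phi>2 n)) \<longlonglongrightarrow> 0" by simp
  qed simp
  have "(\<lambda>n. LINT x|?M. partial_deriv i (\<lambda>x. (\<phi>1 n x - \<phi>2 n x) * partial_deriv i v x) x) \<longlonglongrightarrow> 0" for i
    by (rule boundary_flux_tendsto_0[OF smooth_diff[OF \<phi>1(1) \<phi>2(1)] dv traces])
  then have "(\<lambda>n. ?J (\<lambda>x. \<phi>1 n x - \<phi>2 n x)) \<longlonglongrightarrow> (\<Sum>i\<in>(UNIV::3 set). 0)"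
    by (rule tendsto_sum)
  moreover have "?J (\<lambda>x. \<phi>1 n x - \<phi>2 n x) = ?J (\<phi>1 n) - ?J (\<phi>2 n)" for n
  proof -
    have "(LINT x|?M. partial_deriv i (\<lambda>x. (\<phi>1 n x - \<phi>2 n x) * partial_deriv i v x) x) =
        (LINT x|?M. partial_deriv i (\<lambda>x. \<phi>1 n x * partial_deriv i v x) x) - (LINT x|?M. partial_deriv i (\<lambda>x. \<phi>2 n x * partial_deriv i v x) x)" for i
      unfolding left_diff_distrib partial_deriv_diff[OF smooth_mult[OF \<phi>1(1) dv] smooth_mult[OF \<phi>2(1) dv]]
      by (intro Bochner_Integration.integral_diff smooth_integrable smooth_partial_deriv smooth_mult \<phi>1(1) \<phi>2(1) dv)
    then show ?thesis by (simp add: sum_subtractf)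
  qed
  ultimately have "(\<lambda>n. ?J (\<phi>1 n) - ?J (\<phi>2 n)) \<longlonglongrightarrow> 0" by simp
  then have P: "?P u1 - ?P u2 = 0" by (rule LIMSEQ_unique[OF tendsto_diff[OF l1 l2]])
  have "helmholtz_form \<Omega> k F1 u1 v = helmholtz_form \<Omega> k F2 u2 v"
    using n1 n2 smooth_in_H1[OF v] has_trace_smooth[OF v] unfolding has_normal_derivative_def by metis
  with P show ?thesis
    unfolding helmholtz_form_smooth[OF u(1) F1 v] helmholtz_form_smooth[OF u(2) F2 v] by (simp add: algebra_simps)
qed

end

section \<open>Lebesgue measure in orthonormal coordinates\<close>

definition unit_frame :: "real^3 \<Rightarrow> real^3 \<Rightarrow> real^3 \<Rightarrow> bool" where
  "unit_frame a b c \<longleftrightarrow> a \<bullet> a = 1 \<and> b \<bullet> b = 1 \<and> c \<bullet> c = 1 \<and> a \<bullet> b = 0 \<and> a \<bullet> c = 0 \<and> b \<bullet> c = 0"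

text \<open>
  Identifies the product measure on triples with Lebesgue measure on vectors, so that Fubini becomes
  available in three-dimensional space.
\<close>

lemma lborel_vector3:
  "distr lborel borel (\<lambda>(s, a, b). vector [s, a, b] :: real^3) = (lborel :: (real^3) measure)"
proof (rule lborel_eqI[symmetric])
  let ?f = "\<lambda>(s::real, a::real, b::real). vector [s, a, b] :: real^3"
  have "?f = (\<lambda>x. fst x *\<^sub>R axis 1 1 + fst (snd x) *\<^sub>R axis 2 1 + snd (snd x) *\<^sub>R axis 3 1)"
    by (auto simp: vec_eq_iff forall_3 vector_3 axis_def)
  then have "continuous_on UNIV ?f" by (simp only:) (intro continuous_intros)
  then have m [measurable]: "?f \<in> borel_measurable borel" by (rule borel_measurable_continuous_onI)
  fix l u :: "real^3" assume le: "\<And>b. b \<in> Basis \<Longrightarrow> l \<bullet> b \<le> u \<bullet> b"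
  have le': "l $ i \<le> u $ i" for i using le[of "axis i 1"] by (simp add: axis_in_Basis_iff inner_axis)
  let ?l = "(l $ 1, l $ 2, l $ 3)" and ?u = "(u $ 1, u $ 2, u $ 3)"
  have "emeasure (distr lborel borel ?f) (box l u) = emeasure lborel (?f -` box l u)"
    using m by (subst emeasure_distr) auto
  also have "?f -` box l u = box ?l ?u"
    by (rule set_eqI) (auto simp: mem_box_cart forall_3 vector_3 box_prod)
  also have "emeasure lborel (box ?l ?u) = ennreal ((u $ 1 - l $ 1) * ((u $ 2 - l $ 2) * (u $ 3 - l $ 3)))"
  proof -
    have eq: "box ?l ?u = {l $ 1<..<u $ 1} \<times> ({l $ 2<..<u $ 2} \<times> {l $ 3<..<u $ 3})"
      by (simp add: box_prod box_real)
    have "emeasure lborel (box ?l ?u) = emeasure (lborel \<Otimes>\<^sub>M (lborel \<Otimes>\<^sub>M lborel))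
        ({l $ 1<..<u $ 1} \<times> ({l $ 2<..<u $ 2} \<times> {l $ 3<..<u $ 3}))"
      unfolding eq by (simp add: lborel_prod)
    also have "\<dots> = ennreal (u $ 1 - l $ 1) * emeasure (lborel \<Otimes>\<^sub>M lborel) ({l $ 2<..<u $ 2} \<times> {l $ 3<..<u $ 3})"
      using le' by (simp only: lborel_prod) (subst lborel_prod[symmetric], subst lborel.emeasure_pair_measure_Times, auto intro!: borel_open open_Times)
    also have "emeasure (lborel \<Otimes>\<^sub>M lborel) ({l $ 2<..<u $ 2} \<times> {l $ 3<..<u $ 3}) = ennreal (u $ 2 - l $ 2) * ennreal (u $ 3 - l $ 3)"
      using le' by (subst lborel.emeasure_pair_measure_Times) auto
    also have "ennreal (u $ 1 - l $ 1) * (ennreal (u $ 2 - l $ 2) * ennreal (u $ 3 - l $ 3)) =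
        ennreal ((u $ 1 - l $ 1) * ((u $ 2 - l $ 2) * (u $ 3 - l $ 3)))"
      using le' by (subst ennreal_mult[symmetric], simp, simp, subst ennreal_mult[symmetric]) auto
    finally show ?thesis .
  qed
  also have "(u $ 1 - l $ 1) * ((u $ 2 - l $ 2) * (u $ 3 - l $ 3)) = (\<Prod>i\<in>UNIV. u $ i - l $ i)"
    by (simp only: prod.insert finite.intros UNIV_3) (simp add: mult.assoc)
  also have "\<dots> = (\<Prod>b\<in>Basis. (u - l) \<bullet> b)"
  proof -
    have "(\<Prod>b\<in>Basis. (u - l) \<bullet> b) = (\<Prod>b\<in>range (\<lambda>i. axis i 1). (u - l) \<bullet> b)"
      by (intro prod.cong) (auto simp: Basis_vec_def)
    also have "\<dots> = (\<Prod>i\<in>UNIV. (u - l) \<bullet> axis i 1)"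
      by (subst prod.reindex) (auto simp: inj_on_def axis_eq_axis)
    finally show ?thesis by (simp add: inner_axis)
  qed
  finally show "emeasure (distr lborel borel ?f) (box l u) = (\<Prod>b\<in>Basis. (u - l) \<bullet> b)" by simp
qed simp

lemma unit_frame_expansion:
  assumes "unit_frame a b c"
  shows "x = (x \<bullet> a) *\<^sub>R a + (x \<bullet> b) *\<^sub>R b + (x \<bullet> c) *\<^sub>R c"
proof -
  have ne: "a \<noteq> b" "a \<noteq> c" "b \<noteq> c" "a \<noteq> 0" "b \<noteq> 0" "c \<noteq> 0" using assms by (auto simp: unit_frame_def)
  have orth: "pairwise orthogonal {a, b, c}"
    using assms by (auto simp: pairwise_def orthogonal_def unit_frame_def inner_commute)
  then have "independent {a, b, c}" using ne by (intro pairwise_orthogonal_independent) auto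
  moreover have "card {a, b, c} = 3" using ne by simp
  ultimately have "span {a, b, c} = UNIV"
    using card_ge_dim_independent[of "{a, b, c}" UNIV] by (auto simp: dim_UNIV)
  moreover define y where "y = x - ((x \<bullet> a) *\<^sub>R a + (x \<bullet> b) *\<^sub>R b + (x \<bullet> c) *\<^sub>R c)"
  have "orthogonal y z" if "z \<in> {a, b, c}" for z
    using that assms
    by (auto simp: y_def orthogonal_def unit_frame_def inner_diff_left inner_add_left
        inner_commute[of c a] inner_commute[of c b] inner_commute[of b a])
  ultimately have "orthogonal y y" using orthogonal_to_span[of y "{a, b, c}" y] by auto
  then show ?thesis by (simp add: y_def orthogonal_self)
qed

lemma lborel_unit_frame:
  assumes fr: "unit_frame e1 e2 e3"
  shows "distr lborel borel (\<lambda>(s, a, b). s *\<^sub>R e1 + a *\<^sub>R e2 + b *\<^sub>R e3) = (lborel :: (real^3) measure)"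
proof -
  define T where "T x = x $ 1 *\<^sub>R e1 + x $ 2 *\<^sub>R e2 + x $ 3 *\<^sub>R e3" for x :: "real^3"
  have lin: "linear T"
    by (rule linearI) (simp_all add: T_def algebra_simps)
  have "norm (T x) = norm x" for x
  proof -
    have "T x \<bullet> T x = x \<bullet> x"
      using fr by (simp add: T_def unit_frame_def inner_add_left inner_add_right inner_vec_def[of x x] sum_3
          inner_commute[of e2 e1] inner_commute[of e3 e1] inner_commute[of e3 e2])
    then show ?thesis by (simp add: norm_eq_sqrt_inner)
  qed
  with lin have orth: "orthogonal_transformation T" by (simp add: orthogonal_transformation)
  have Tc: "continuous_on UNIV T" unfolding T_def by (intro continuous_intros)
  then have Tm [measurable]: "T \<in> borel_measurable borel" by (rule borel_measurable_continuous_onI)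
  have iT: "orthogonal_transformation (inv T)" using orth by (rule orthogonal_transformation_inv)
  have bT: "bij T" using orth by (rule orthogonal_transformation_bij)
  have "(lborel :: (real^3) measure) = distr lborel borel T"
  proof (rule lborel_eqI)
    fix l u :: "real^3" assume le: "\<And>b. b \<in> Basis \<Longrightarrow> l \<bullet> b \<le> u \<bullet> b"
    have "emeasure (distr lborel borel T) (box l u) = emeasure lborel (T -` box l u)"
      by (subst emeasure_distr) auto
    also have "T -` box l u = inv T ` box l u" using bT by (simp add: bij_vimage_eq_inv_image)
    also have "emeasure lborel (inv T ` box l u) = emeasure lebesgue (inv T ` box l u)"
    proof -
      have "T -` box l u \<in> sets borel" using measurable_sets[OF Tm, of "box l u"] by simp
      then show ?thesis using bT by (simp add: bij_vimage_eq_inv_image)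
    qed
    also have "\<dots> = ennreal (measure lebesgue (inv T ` box l u))"
    proof (rule emeasure_eq_ennreal_measure)
      have "inv T ` box l u \<in> lmeasurable" using iT by (intro measurable_orthogonal_image) auto
      then show "emeasure lebesgue (inv T ` box l u) \<noteq> top" by (rule fmeasurableD2)
    qed
    also have "measure lebesgue (inv T ` box l u) = measure lebesgue (box l u)"
      using iT by (intro measure_orthogonal_image) auto
    also have "ennreal (measure lebesgue (box l u)) = (\<Prod>b\<in>Basis. (u - l) \<bullet> b)"
      using le by simp
    finally show "emeasure (distr lborel borel T) (box l u) = (\<Prod>b\<in>Basis. (u - l) \<bullet> b)" .
  qed simp
  also have "\<dots> = distr (distr lborel borel (\<lambda>(s, a, b). vector [s, a, b] :: real^3)) borel T"
    by (simp only: lborel_vector3)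
  also have "\<dots> = distr lborel borel (T \<circ> (\<lambda>(s, a, b). vector [s, a, b]))"
  proof (rule distr_distr)
    have "(\<lambda>(s::real, a::real, b::real). vector [s, a, b] :: real^3) =
        (\<lambda>x. fst x *\<^sub>R axis 1 1 + fst (snd x) *\<^sub>R axis 2 1 + snd (snd x) *\<^sub>R axis 3 1)"
      by (auto simp: vec_eq_iff forall_3 vector_3 axis_def)
    then have "continuous_on UNIV (\<lambda>(s::real, a::real, b::real). vector [s, a, b] :: real^3)"
      by (simp only:) (intro continuous_intros)
    then show "(\<lambda>(s::real, a::real, b::real). vector [s, a, b] :: real^3) \<in> borel_measurable lborel"
      by (simp add: borel_measurable_continuous_onI)
  qed simp
  also have "T \<circ> (\<lambda>(s, a, b). vector [s, a, b]) = (\<lambda>(s, a, b). s *\<^sub>R e1 + a *\<^sub>R e2 + b *\<^sub>R e3)"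
    by (auto simp: T_def vector_3)
  finally show ?thesis by simp
qed

lemma
  fixes F :: "'a::euclidean_space \<Rightarrow> 'b::{banach, second_countable_topology}"
  assumes c: "0 < c" and F: "F \<in> borel_measurable borel"
  shows integral_lborel_affine: "integral\<^sup>L lborel F = (c ^ DIM('a)) *\<^sub>R (LINT x|lborel. F (t + c *\<^sub>R x))"
    and integrable_lborel_affine: "integrable lborel F \<longleftrightarrow> integrable lborel (\<lambda>x. F (t + c *\<^sub>R x))"
proof -
  have m: "(\<lambda>x::'a. t + c *\<^sub>R x) \<in> borel_measurable borel"
    by (intro borel_measurable_continuous_onI continuous_intros)
  have eq: "(lborel :: 'a measure) = density (distr lborel borel (\<lambda>x. t + c *\<^sub>R x)) (\<lambda>_. ennreal (c ^ DIM('a)))"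
    using lborel_affine[of c t] c by simp
  have "integral\<^sup>L lborel F = (LINT x|distr lborel borel (\<lambda>x. t + c *\<^sub>R x). (c ^ DIM('a)) *\<^sub>R F x)"
    using c F by (subst eq, subst integral_density) auto
  also have "\<dots> = (LINT x|lborel. (c ^ DIM('a)) *\<^sub>R F (t + c *\<^sub>R x))"
    using F m by (subst integral_distr) auto
  finally show "integral\<^sup>L lborel F = (c ^ DIM('a)) *\<^sub>R (LINT x|lborel. F (t + c *\<^sub>R x))" by simp
  have "integrable lborel F \<longleftrightarrow> integrable (distr lborel borel (\<lambda>x. t + c *\<^sub>R x)) (\<lambda>x. (c ^ DIM('a)) *\<^sub>R F x)"
    using c F by (subst eq, subst integrable_density) auto
  also have "\<dots> \<longleftrightarrow> integrable lborel (\<lambda>x. (c ^ DIM('a)) *\<^sub>R F (t + c *\<^sub>R x))"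
    using F m by (subst integrable_distr_eq) auto
  also have "\<dots> \<longleftrightarrow> integrable lborel (\<lambda>x. F (t + c *\<^sub>R x))"
  proof
    assume "integrable lborel (\<lambda>x. (c ^ DIM('a)) *\<^sub>R F (t + c *\<^sub>R x))"
    then have "integrable lborel (\<lambda>x. inverse (c ^ DIM('a)) *\<^sub>R ((c ^ DIM('a)) *\<^sub>R F (t + c *\<^sub>R x)))"
      by (rule integrable_scaleR_right)
    moreover have "inverse (c ^ DIM('a)) *\<^sub>R ((c ^ DIM('a)) *\<^sub>R v) = v" for v :: 'b
      using c by simp
    ultimately show "integrable lborel (\<lambda>x. F (t + c *\<^sub>R x))" by (simp only:)
  qed (intro integrable_scaleR_right)
  finally show "integrable lborel F \<longleftrightarrow> integrable lborel (\<lambda>x. F (t + c *\<^sub>R x))" .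
qed

section \<open>The Laplace transform of a cone\<close>

lemma integrable_power2_exp: "integrable lborel (\<lambda>s::real. indicator {0..} s * (s\<^sup>2 * exp (- s)))"
proof (rule integrableI_nonneg)
  have "(\<integral>\<^sup>+s. ennreal (indicator {0..} s * (s\<^sup>2 * exp (- s))) \<partial>lborel) = (\<integral>\<^sup>+s. ennreal (s ^ 2 * exp (- s)) * indicator {0..} s \<partial>lborel)"
    by (intro nn_integral_cong) (auto simp: indicator_def)
  also have "\<dots> < \<infinity>" by (subst nn_intergal_power_times_exp_Ici) auto
  finally show "(\<integral>\<^sup>+s. ennreal (indicator {0..} s * (s\<^sup>2 * exp (- s))) \<partial>lborel) < \<infinity>" .
qed auto

lemma laplace_power2:
  fixes z :: complex
  assumes z: "Re z = 1"
  shows "(LINT s|lborel. indicator {0..} s *\<^sub>R (of_real (s\<^sup>2) * exp (- (of_real s * z)))) = 2 / z ^ 3"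
proof -
  have z0: "z \<noteq> 0" using z by auto
  let ?f = "\<lambda>s::real. of_real (s\<^sup>2) * exp (- (of_real s * z))"
  \<comment> \<open>An antiderivative of the integrand, obtained by integrating by parts twice.\<close>
  define P where "P = (\<lambda>w::complex. - (w\<^sup>2 / z + 2 * w / z\<^sup>2 + 2 / z ^ 3) * exp (- (w * z)))"
  have norm_exp: "norm (exp (- (of_real s * z))) = exp (- s)" for s
    using z by simp
  have der: "((\<lambda>s. P (of_real s)) has_vector_derivative ?f s) (at s within S)" for s S
  proof -
    have "(P has_field_derivative (of_real s)\<^sup>2 * exp (- (of_real s * z))) (at (of_real s))"
      unfolding P_def using z0
      by (auto intro!: derivative_eq_intros simp: field_simps power2_eq_square power3_eq_cube)
    then have "((\<lambda>s. P (of_real s)) has_vector_derivative (of_real s)\<^sup>2 * exp (- (of_real s * z))) (at s)"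
      by (rule has_vector_derivative_real_field)
    then show ?thesis by (simp add: has_vector_derivative_at_within)
  qed
  have fin: "(LINT s|lborel. indicator {0..real n} s *\<^sub>R ?f s) = P (of_real (real n)) - P 0" for n
  proof -
    have "has_bochner_integral lborel (\<lambda>s. indicator {0..real n} s *\<^sub>R ?f s) (P (of_real (real n)) - P (of_real 0))"
      by (rule has_bochner_integral_FTC_Icc[OF _ der]) (auto intro!: continuous_intros)
    then show ?thesis by (simp add: has_bochner_integral_integral_eq)
  qed
  have "(\<lambda>n. LINT s|lborel. indicator {0..real n} s *\<^sub>R ?f s) \<longlonglongrightarrow> (LINT s|lborel. indicator {0..} s *\<^sub>R ?f s)"
  proof (rule integral_dominated_convergence[where w = "\<lambda>s. indicator {0..} s * (s\<^sup>2 * exp (- s))"])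
    have "?f \<in> borel_measurable borel" by (intro borel_measurable_continuous_onI continuous_intros)
    then show "(\<lambda>s. indicator {0..real n} s *\<^sub>R ?f s) \<in> borel_measurable lborel"
      "(\<lambda>s. indicator {0..} s *\<^sub>R ?f s) \<in> borel_measurable lborel" for n
      by (simp_all add: borel_measurable_scaleR)
    show "AE s in lborel. (\<lambda>n. indicator {0..real n} s *\<^sub>R ?f s) \<longlonglongrightarrow> indicator {0..} s *\<^sub>R ?f s"
    proof (intro AE_I2 tendsto_eventually)
      fix s :: real
      obtain N where "s < real N" using reals_Archimedean2 by blast
      then show "\<forall>\<^sub>F n in sequentially. indicator {0..real n} s *\<^sub>R ?f s = indicator {0..} s *\<^sub>R ?f s"
        by (auto simp: eventually_sequentially indicator_def intro!: exI[of _ N])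
    qed
    show "AE s in lborel. norm (indicator {0..real n} s *\<^sub>R ?f s) \<le> indicator {0..} s * (s\<^sup>2 * exp (- s))" for n
      by (intro AE_I2) (auto simp: norm_mult norm_exp norm_power indicator_def simp del: norm_exp_eq_Re)
  qed (rule integrable_power2_exp)
  moreover have "(\<lambda>n. P (of_real (real n)) - P 0) \<longlonglongrightarrow> 0 - P 0"
  proof (intro tendsto_diff tendsto_const, rule tendsto_norm_zero_cancel)
    have lim: "(\<lambda>n. real n ^ k * exp (- real n)) \<longlonglongrightarrow> 0" for k
      using filterlim_compose[OF tendsto_power_div_exp_0[of k] filterlim_real_sequentially]
      by (simp add: exp_minus divide_inverse)
    have "(\<lambda>n. norm (1 / z) * (real n ^ 2 * exp (- real n)) + norm (2 / z\<^sup>2) * (real n ^ 1 * exp (- real n))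
        + norm (2 / z ^ 3) * (real n ^ 0 * exp (- real n))) \<longlonglongrightarrow> norm (1 / z) * 0 + norm (2 / z\<^sup>2) * 0 + norm (2 / z ^ 3) * 0"
      by (intro tendsto_intros lim)
    then have up: "(\<lambda>n. norm (1 / z) * (real n ^ 2 * exp (- real n)) + norm (2 / z\<^sup>2) * (real n ^ 1 * exp (- real n))
        + norm (2 / z ^ 3) * (real n ^ 0 * exp (- real n))) \<longlonglongrightarrow> 0" by simp
    show "(\<lambda>n. norm (P (of_real (real n)))) \<longlonglongrightarrow> 0"
    proof (rule tendsto_sandwich[OF _ _ tendsto_const up])
      show "\<forall>\<^sub>F n in sequentially. norm (P (of_real (real n))) \<le> norm (1 / z) * (real n ^ 2 * exp (- real n))
          + norm (2 / z\<^sup>2) * (real n ^ 1 * exp (- real n)) + norm (2 / z ^ 3) * (real n ^ 0 * exp (- real n))"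
      proof (rule always_eventually, intro allI)
        fix n
        let ?w = "complex_of_real (real n)"
        have "norm (P ?w) = norm (1 / z * ?w\<^sup>2 + 2 / z\<^sup>2 * ?w + 2 / z ^ 3) * exp (- real n)"
          unfolding P_def norm_mult norm_exp norm_minus_cancel by (simp add: mult.commute)
        also have "\<dots> \<le> (norm (1 / z * ?w\<^sup>2) + norm (2 / z\<^sup>2 * ?w) + norm (2 / z ^ 3)) * exp (- real n)"
          by (intro mult_right_mono order_trans[OF norm_triangle_ineq] add_mono norm_triangle_ineq) auto
        also have "\<dots> = norm (1 / z) * (real n ^ 2 * exp (- real n))
          + norm (2 / z\<^sup>2) * (real n ^ 1 * exp (- real n)) + norm (2 / z ^ 3) * (real n ^ 0 * exp (- real n))"
          by (simp add: norm_mult norm_divide norm_power distrib_right)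
        finally show "norm (P ?w) \<le> \<dots>" .
      qed
    qed simp
  qed
  ultimately have "(LINT s|lborel. indicator {0..} s *\<^sub>R ?f s) = 0 - P 0"
    unfolding fin by (rule LIMSEQ_unique)
  then show ?thesis by (simp add: P_def)
qed

text \<open>
  The geometry at a single tip, separated from the set \<open>D\<close> and its density because the constant of the cone
  depends on the cone alone.
\<close>

locale conical_tip =
  fixes \<omega> p :: "real^3" and \<delta> :: real and Q :: "(real^3) set"
  assumes unit: "\<omega> \<in> sphere 0 1" and height: "0 < \<delta>" and base: "cone_base \<omega> (p \<bullet> \<omega> - \<delta>) Q"
begin

text \<open>
  The infinite cone spanned by \<open>Q - p\<close>. A vector \<open>y\<close> with \<open>y \<bullet> \<omega> < 0\<close> has exactly one positive multiple
  ending in the plane of the base when attached to \<open>p\<close>, namely the multiple by \<open>- \<delta> / (y \<bullet> \<omega>)\<close>.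
\<close>

definition tangent_cone :: "(real^3) set" where
  "tangent_cone = {y. y \<bullet> \<omega> < 0 \<and> p - (\<delta> / (y \<bullet> \<omega>)) *\<^sub>R y \<in> Q}"

text \<open>
  The Laplace transform of the indicator of the cone at the complex frequency \<open>\<omega> + \<i> \<theta>\<close>. In contrast to
  the integrals over slices, its domain of integration does not involve \<open>\<theta>\<close>.
\<close>

definition cone_transform :: "real^3 \<Rightarrow> complex" where
  "cone_transform \<theta> = (LINT y|lborel. indicator tangent_cone y *\<^sub>R plane_wave \<omega> \<theta> y)"

lemma borel_base: "Q \<in> sets borel"
proof -
  obtain U where U: "open U" "Q = U \<inter> plane \<omega> (p \<bullet> \<omega> - \<delta>)"
    using base by (auto simp: cone_base_def openin_open Int_commute)
  have "closed (plane \<omega> (p \<bullet> \<omega> - \<delta>))"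
    unfolding plane_def using closed_hyperplane[of \<omega> "p \<bullet> \<omega> - \<delta>"] by (simp add: inner_commute)
  with U show ?thesis by (auto intro!: sets.Int borel_open borel_closed)
qed

lemma borel_tangent_cone: "tangent_cone \<in> sets borel"
proof -
  have "(\<lambda>y. p - (\<delta> / (y \<bullet> \<omega>)) *\<^sub>R y) \<in> borel_measurable borel"
    by measurable
  then have "(\<lambda>y. p - (\<delta> / (y \<bullet> \<omega>)) *\<^sub>R y) -` Q \<inter> space borel \<in> sets borel"
    by (rule measurable_sets) (rule borel_base)
  then have "{y. y \<bullet> \<omega> < 0} \<inter> ((\<lambda>y. p - (\<delta> / (y \<bullet> \<omega>)) *\<^sub>R y) -` Q \<inter> space borel) \<in> sets borel"
    by (rule sets.Int[rotated]) simp
  then show ?thesis by (simp add: tangent_cone_def Int_def vimage_def)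
qed

lemma unit_frame_tangent:
  assumes "\<theta> \<in> orthogonal_circle \<omega>"
  shows "unit_frame (- \<omega>) \<theta> (cross3 \<omega> \<theta>)"
proof -
  have w: "\<omega> \<bullet> \<omega> = 1" "\<theta> \<bullet> \<theta> = 1" "\<omega> \<bullet> \<theta> = 0"
    using unit assms by (auto simp: orthogonal_circle_def norm_eq_1)
  then have "(norm (cross3 \<omega> \<theta>))\<^sup>2 = 1"
    using norm_cross[of \<omega> \<theta>] by (simp add: power2_norm_eq_inner)
  then show ?thesis
    using w by (simp add: unit_frame_def power2_norm_eq_inner dot_cross_self)
qed

definition base_coords :: "real^3 \<Rightarrow> (real \<times> real) set" where
  "base_coords \<theta> = {q. p - \<delta> *\<^sub>R \<omega> + fst q *\<^sub>R \<theta> + snd q *\<^sub>R cross3 \<omega> \<theta> \<in> Q}"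

lemma borel_base_coords: "base_coords \<theta> \<in> sets borel"
proof -
  have "(\<lambda>q::real \<times> real. p - \<delta> *\<^sub>R \<omega> + fst q *\<^sub>R \<theta> + snd q *\<^sub>R cross3 \<omega> \<theta>) \<in> borel_measurable borel"
    by (intro borel_measurable_continuous_onI continuous_intros)
  from measurable_sets[OF this borel_base] show ?thesis by (simp add: base_coords_def vimage_def)
qed

lemma bounded_base_coords:
  assumes \<theta>: "\<theta> \<in> orthogonal_circle \<omega>"
  shows "bounded (base_coords \<theta>)"
proof -
  have fr: "unit_frame (- \<omega>) \<theta> (cross3 \<omega> \<theta>)" by (rule unit_frame_tangent[OF \<theta>])
  obtain R where R: "\<And>z. z \<in> Q \<Longrightarrow> norm z \<le> R"
    using base unfolding cone_base_def bounded_iff by blast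
  define B where "B = R + norm (p - \<delta> *\<^sub>R \<omega>)"
  have "base_coords \<theta> \<subseteq> {-B..B} \<times> {-B..B}"
  proof
    fix q assume q: "q \<in> base_coords \<theta>"
    define v where "v = fst q *\<^sub>R \<theta> + snd q *\<^sub>R cross3 \<omega> \<theta>"
    have "norm (p - \<delta> *\<^sub>R \<omega> + v) \<le> R"
      using q by (intro R) (simp add: base_coords_def v_def add.assoc)
    then have v: "norm v \<le> B"
      unfolding B_def using norm_triangle_ineq4[of "p - \<delta> *\<^sub>R \<omega> + v" "p - \<delta> *\<^sub>R \<omega>"] by simp
    have comp: "\<bar>v \<bullet> e\<bar> \<le> B" if "e \<bullet> e = 1" for e
      using Cauchy_Schwarz_ineq2[of v e] v that by (simp add: norm_eq_1[symmetric])
    have "v \<bullet> \<theta> = fst q" "v \<bullet> cross3 \<omega> \<theta> = snd q"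
      using fr by (simp_all add: v_def unit_frame_def inner_add_left inner_commute[of "cross3 \<omega> \<theta>" \<theta>])
    then have "\<bar>fst q\<bar> \<le> B" "\<bar>snd q\<bar> \<le> B"
      using comp[of \<theta>] comp[of "cross3 \<omega> \<theta>"] fr by (simp_all add: unit_frame_def)
    then show "q \<in> {-B..B} \<times> {-B..B}" by (cases q) (auto simp: abs_le_iff)
  qed
  then show ?thesis by (rule bounded_subset[rotated]) (intro bounded_Times bounded_closed_interval)
qed

text \<open>
  The first coordinate is the depth \<open>s\<close> below the tip; the other two are coordinates in the slice.
\<close>

definition frame_map :: "real^3 \<Rightarrow> real \<times> real \<times> real \<Rightarrow> real^3" where
  "frame_map \<theta> = (\<lambda>(s, a, b). s *\<^sub>R (- \<omega>) + a *\<^sub>R \<theta> + b *\<^sub>R cross3 \<omega> \<theta>)"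

lemma frame_map_measurable: "frame_map \<theta> \<in> borel_measurable borel"
  unfolding frame_map_def split_beta by (intro borel_measurable_continuous_onI continuous_intros)

lemma inner_frame_map:
  assumes "\<theta> \<in> orthogonal_circle \<omega>"
  shows "frame_map \<theta> (s, q) \<bullet> \<omega> = - s" "frame_map \<theta> (s, q) \<bullet> \<theta> = fst q"
  using unit_frame_tangent[OF assms]
  by (simp_all add: frame_map_def split_beta unit_frame_def inner_add_left inner_diff_left inner_minus_left
      inner_commute[of \<theta> \<omega>] inner_commute[of "cross3 \<omega> \<theta>" \<omega>] inner_commute[of "cross3 \<omega> \<theta>" \<theta>])

lemma frame_map_in_tangent_cone:
  assumes \<theta>: "\<theta> \<in> orthogonal_circle \<omega>"
  shows "frame_map \<theta> (s, q) \<in> tangent_cone \<longleftrightarrow> 0 < s \<and> (\<delta> / s) *\<^sub>R q \<in> base_coords \<theta>"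
proof (cases "0 < s")
  case True
  have "p - (\<delta> / (- s)) *\<^sub>R frame_map \<theta> (s, q) =
      p - \<delta> *\<^sub>R \<omega> + fst ((\<delta> / s) *\<^sub>R q) *\<^sub>R \<theta> + snd ((\<delta> / s) *\<^sub>R q) *\<^sub>R cross3 \<omega> \<theta>"
    using True by (simp add: frame_map_def split_beta algebra_simps)
  with True show ?thesis
    unfolding base_coords_def mem_Collect_eq
    by (simp only: tangent_cone_def mem_Collect_eq inner_frame_map[OF \<theta>] neg_less_0_iff_less simp_thms)
qed (simp add: tangent_cone_def inner_frame_map[OF \<theta>])

definition cone_kernel :: "real^3 \<Rightarrow> real \<Rightarrow> real \<times> real \<Rightarrow> complex" where
  "cone_kernel \<theta> s q = indicator tangent_cone (frame_map \<theta> (s, q)) *\<^sub>R plane_wave \<omega> \<theta> (frame_map \<theta> (s, q))"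

lemma cone_kernel_measurable: "(\<lambda>x. cone_kernel \<theta> (fst x) (snd x)) \<in> borel_measurable borel"
proof -
  have "(\<lambda>y. indicator tangent_cone y *\<^sub>R plane_wave \<omega> \<theta> y) \<in> borel_measurable borel"
    by (intro borel_measurable_scaleR borel_measurable_indicator borel_tangent_cone
        borel_measurable_continuous_onI continuous_on_plane_wave)
  from measurable_compose[OF frame_map_measurable this] show ?thesis by (simp add: cone_kernel_def)
qed

lemma cone_kernel_eq:
  assumes \<theta>: "\<theta> \<in> orthogonal_circle \<omega>"
  shows "cone_kernel \<theta> s q = (if 0 < s then indicator (base_coords \<theta>) ((\<delta> / s) *\<^sub>R q) *\<^sub>R exp (Complex (- s) (fst q)) else 0)"
  by (simp add: cone_kernel_def plane_wave_def indicator_def frame_map_in_tangent_cone[OF \<theta>] inner_frame_map[OF \<theta>])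

text \<open>
  The slice at depth \<open>s\<close> is the base scaled by \<open>s / \<delta>\<close>. Scaling back to the base produces the factor
  \<open>(s / \<delta>)\<^sup>2\<close> and moves the dependence on \<open>s\<close> from the domain into the integrand.
\<close>

lemma cone_kernel_slice:
  assumes \<theta>: "\<theta> \<in> orthogonal_circle \<omega>"
  shows "integrable lborel (cone_kernel \<theta> s) \<and>
    (LINT q|lborel. cmod (cone_kernel \<theta> s q)) = indicator {0..} s * (s\<^sup>2 * exp (- s)) * (measure lborel (base_coords \<theta>) / \<delta>\<^sup>2) \<and>
    (LINT q|lborel. cone_kernel \<theta> s q) = (LINT q|lborel. (indicator {0..} s * indicator (base_coords \<theta>) q) *\<^sub>R
        (of_real (s\<^sup>2 / \<delta>\<^sup>2) * exp (- (of_real s * Complex 1 (- (fst q / \<delta>))))))"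
proof (cases "0 < s")
  case False
  then have "cone_kernel \<theta> s = (\<lambda>q. 0)" by (auto simp: cone_kernel_eq[OF \<theta>])
  moreover have "indicator {0..} s * s\<^sup>2 = 0" using False by (auto simp: indicator_def)
  moreover have "(indicator {0..} s * indicator (base_coords \<theta>) q) *\<^sub>R (of_real (s\<^sup>2 / \<delta>\<^sup>2) * w) = (0::complex)" for q w
    using False by (auto simp: indicator_def)
  ultimately show ?thesis by (auto simp: mult.assoc[symmetric])
next
  case True
  define c where "c = s / \<delta>"
  have c: "0 < c" "\<delta> / s * c = 1" using True height by (auto simp: c_def)
  have m: "cone_kernel \<theta> s \<in> borel_measurable borel"
    using measurable_compose[OF _ cone_kernel_measurable, of "\<lambda>q. (s, q)" borel]
    by (simp add: borel_measurable_continuous_onI continuous_on_Pair)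
  have k: "cone_kernel \<theta> s (0 + c *\<^sub>R q) = indicator (base_coords \<theta>) q *\<^sub>R exp (Complex (- s) (c * fst q))" for q
    by (simp only: cone_kernel_eq[OF \<theta>] True if_True add_0 scaleR_scaleR c(2) scaleR_one fst_scaleR real_scaleR_def)
  have ce: "continuous_on UNIV (\<lambda>q::real \<times> real. exp (Complex (- s) (c * fst q)))"
    unfolding Complex_eq by (intro continuous_intros)
  have i1: "integrable lborel (\<lambda>q. indicator (base_coords \<theta>) q *\<^sub>R exp (Complex (- s) (c * fst q)))"
    by (rule integrable_indicator_continuous[OF borel_base_coords bounded_base_coords[OF \<theta>] ce])
  then have "integrable lborel (cone_kernel \<theta> s)"
    using integrable_lborel_affine[OF c(1) m, of 0] by (simp only: k)
  moreover have "(LINT q|lborel. cmod (cone_kernel \<theta> s q)) = c\<^sup>2 * (LINT q|lborel. cmod (cone_kernel \<theta> s (0 + c *\<^sub>R q)))"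
    using integral_lborel_affine[OF c(1), of "\<lambda>q. cmod (cone_kernel \<theta> s q)" 0] m by (simp add: power2_eq_square)
  then have "(LINT q|lborel. cmod (cone_kernel \<theta> s q)) = indicator {0..} s * (s\<^sup>2 * exp (- s)) * (measure lborel (base_coords \<theta>) / \<delta>\<^sup>2)"
    using True unfolding k by (simp add: c_def power_divide)
  moreover have "(LINT q|lborel. cone_kernel \<theta> s q) = c\<^sup>2 *\<^sub>R (LINT q|lborel. cone_kernel \<theta> s (0 + c *\<^sub>R q))"
    using integral_lborel_affine[OF c(1) m, of 0] by (simp add: power2_eq_square)
  then have "(LINT q|lborel. cone_kernel \<theta> s q) = (LINT q|lborel. c\<^sup>2 *\<^sub>R (indicator (base_coords \<theta>) q *\<^sub>R exp (Complex (- s) (c * fst q))))"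
    unfolding k by (simp only: integral_scaleR_right)
  then have "(LINT q|lborel. cone_kernel \<theta> s q) =
    (LINT q|lborel. (indicator {0..} s * indicator (base_coords \<theta>) q) *\<^sub>R
      (of_real (s\<^sup>2 / \<delta>\<^sup>2) * exp (- (of_real s * Complex 1 (- (fst q / \<delta>))))))"
  proof (rule trans, intro Bochner_Integration.integral_cong refl)
    fix q :: "real \<times> real"
    have "Complex (- s) (c * fst q) = - (of_real s * Complex 1 (- (fst q / \<delta>)))"
      by (simp add: complex_eq_iff c_def)
    then show "c\<^sup>2 *\<^sub>R (indicator (base_coords \<theta>) q *\<^sub>R exp (Complex (- s) (c * fst q))) =
      (indicator {0..} s * indicator (base_coords \<theta>) q) *\<^sub>R
      (of_real (s\<^sup>2 / \<delta>\<^sup>2) * exp (- (of_real s * Complex 1 (- (fst q / \<delta>)))))"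
      using True by (simp add: c_def power_divide scaleR_conv_of_real)
  qed
  ultimately show ?thesis by blast
qed

lemma integrable_cone_kernel:
  assumes \<theta>: "\<theta> \<in> orthogonal_circle \<omega>"
  shows "integrable (lborel \<Otimes>\<^sub>M lborel) (\<lambda>(s, q). cone_kernel \<theta> s q)"
proof (rule lborel_pair.Fubini_integrable)
  show "(\<lambda>(s, q). cone_kernel \<theta> s q) \<in> borel_measurable (lborel \<Otimes>\<^sub>M lborel)"
    using cone_kernel_measurable[of \<theta>] by (simp add: lborel_prod split_beta)
  show "integrable lborel (\<lambda>s. LINT q|lborel. norm (case (s, q) of (s, q) \<Rightarrow> cone_kernel \<theta> s q))"
    using integrable_power2_exp cone_kernel_slice[OF \<theta>] by simp
  show "AE s in lborel. integrable lborel (\<lambda>q. case (s, q) of (s, q) \<Rightarrow> cone_kernel \<theta> s q)"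
    using cone_kernel_slice[OF \<theta>] by simp
qed

lemma lborel_frame_map:
  assumes "\<theta> \<in> orthogonal_circle \<omega>"
  shows "distr lborel borel (frame_map \<theta>) = lborel"
  unfolding frame_map_def by (rule lborel_unit_frame[OF unit_frame_tangent[OF assms]])

lemma tangent_wave_measurable: "(\<lambda>y. indicator tangent_cone y *\<^sub>R plane_wave \<omega> \<theta> y) \<in> borel_measurable borel"
  by (intro borel_measurable_scaleR borel_measurable_indicator borel_tangent_cone
      borel_measurable_continuous_onI continuous_on_plane_wave)

lemma integrable_tangent_wave:
  assumes \<theta>: "\<theta> \<in> orthogonal_circle \<omega>"
  shows "integrable lborel (\<lambda>y. indicator tangent_cone y *\<^sub>R plane_wave \<omega> \<theta> y)"
proof -
  have "integrable lborel (\<lambda>x. indicator tangent_cone (frame_map \<theta> x) *\<^sub>R plane_wave \<omega> \<theta> (frame_map \<theta> x))"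
    using integrable_cone_kernel[OF \<theta>] by (simp add: lborel_prod case_prod_unfold cone_kernel_def)
  then have "integrable (distr lborel borel (frame_map \<theta>)) (\<lambda>y. indicator tangent_cone y *\<^sub>R plane_wave \<omega> \<theta> y)"
    using frame_map_measurable tangent_wave_measurable by (subst integrable_distr_eq) auto
  then show ?thesis unfolding lborel_frame_map[OF \<theta>] .
qed

text \<open>
  After scaling all slices to the base, Fubini allows the integral over the depth to be taken first, and
  \<open>\<integral> s\<^sup>2 exp (- s z) ds = 2 / z\<^sup>3\<close> with \<open>z = 1 - \<i> a / \<delta>\<close> yields the integrand of the definition of the constant.
\<close>

lemma cone_transform_eq_cone_const:
  assumes \<theta>: "\<theta> \<in> orthogonal_circle \<omega>"
  shows "cone_const p \<omega> \<delta> Q \<theta> = cone_transform \<theta>"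
proof -
  let ?A = "base_coords \<theta>"
  let ?D = "\<lambda>q::real \<times> real. complex_of_real \<delta> - \<i> * complex_of_real (fst q)"
  let ?G = "\<lambda>s q. (indicator {0..} s * indicator ?A q) *\<^sub>R
        (of_real (s\<^sup>2 / \<delta>\<^sup>2) * exp (- (of_real s * Complex 1 (- (fst q / \<delta>)))))"
  have "cone_transform \<theta> = (LINT y|distr lborel borel (frame_map \<theta>). indicator tangent_cone y *\<^sub>R plane_wave \<omega> \<theta> y)"
    unfolding cone_transform_def lborel_frame_map[OF \<theta>] ..
  also have "\<dots> = (LINT x|lborel. cone_kernel \<theta> (fst x) (snd x))"
    using frame_map_measurable tangent_wave_measurable by (subst integral_distr) (auto simp: cone_kernel_def)
  also have "\<dots> = (LINT s|lborel. LINT q|lborel. cone_kernel \<theta> s q)"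
    using lborel_pair.integral_fst[OF integrable_cone_kernel[OF \<theta>]] by (simp add: lborel_prod case_prod_unfold)
  also have "\<dots> = (LINT s|lborel. LINT q|lborel. ?G s q)"
    by (simp only: cone_kernel_slice[OF \<theta>])
  also have "\<dots> = (LINT q|lborel. LINT s|lborel. ?G s q)"
  proof (rule lborel_pair.Fubini_integral[symmetric], rule lborel_pair.Fubini_integrable)
    have "continuous_on UNIV (\<lambda>x::real \<times> real \<times> real. complex_of_real ((fst x)\<^sup>2 / \<delta>\<^sup>2) *
        exp (- (complex_of_real (fst x) * Complex 1 (- (fst (snd x) / \<delta>)))))"
      unfolding Complex_eq using height by (intro continuous_intros) auto
    then have mc: "(\<lambda>x::real \<times> real \<times> real. complex_of_real ((fst x)\<^sup>2 / \<delta>\<^sup>2) *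
        exp (- (complex_of_real (fst x) * Complex 1 (- (fst (snd x) / \<delta>))))) \<in> borel_measurable borel"
      by (rule borel_measurable_continuous_onI)
    have mi: "(\<lambda>x::real \<times> real \<times> real. indicator {0..} (fst x) * indicator ?A (snd x) :: real) \<in> borel_measurable borel"
    proof (intro borel_measurable_times)
      show "(\<lambda>x::real \<times> real \<times> real. indicator {0..} (fst x) :: real) \<in> borel_measurable borel"
        by (rule measurable_compose[of fst _ borel]) (auto intro!: borel_measurable_continuous_onI continuous_intros)
      show "(\<lambda>x::real \<times> real \<times> real. indicator ?A (snd x) :: real) \<in> borel_measurable borel"
        by (rule measurable_compose[of snd _ borel])
          (auto intro!: borel_measurable_continuous_onI continuous_intros borel_measurable_indicator borel_base_coords)
    qed
    show "(\<lambda>(s, q). ?G s q) \<in> borel_measurable (lborel \<Otimes>\<^sub>M lborel)"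
      using borel_measurable_scaleR[OF mi mc]
      by (simp only: case_prod_unfold lborel_prod measurable_lborel1 measurable_lborel2)
    have nG: "norm (?G s q) = (indicator {0..} s * (s\<^sup>2 * exp (- s)) / \<delta>\<^sup>2) * indicator ?A q" for s q
      by (simp add: norm_mult indicator_def norm_divide norm_power)
    have e: "(LINT q|lborel. norm (case (s, q) of (s, q) \<Rightarrow> ?G s q)) =
        indicator {0..} s * (s\<^sup>2 * exp (- s)) / \<delta>\<^sup>2 * (LINT q|lborel. indicator ?A q)" for s
      unfolding prod.case nG by (rule integral_mult_right_zero)
    show "integrable lborel (\<lambda>s. LINT q|lborel. norm (case (s, q) of (s, q) \<Rightarrow> ?G s q))"
      unfolding e by (intro integrable_mult_left integrable_divide integrable_power2_exp)
    have "integrable lborel (?G s)" for s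
    proof -
      have "integrable lborel (\<lambda>q. indicator {0..} s *\<^sub>R (indicator ?A q *\<^sub>R
          (complex_of_real (s\<^sup>2 / \<delta>\<^sup>2) * exp (- (of_real s * Complex 1 (- (fst q / \<delta>)))))))"
        unfolding Complex_eq using height
        by (intro integrable_scaleR_right integrable_indicator_continuous borel_base_coords
            bounded_base_coords[OF \<theta>] continuous_intros) auto
      then show ?thesis by simp
    qed
    then show "AE s in lborel. integrable lborel (\<lambda>q. case (s, q) of (s, q) \<Rightarrow> ?G s q)" by simp
  qed
  also have "\<dots> = (LINT q|lborel. (2 * complex_of_real \<delta>) * (indicator ?A q *\<^sub>R (1 / (?D q) ^ 3)))"
  proof (intro Bochner_Integration.integral_cong refl)
    fix q :: "real \<times> real"
    let ?z = "Complex 1 (- (fst q / \<delta>))"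
    have "(LINT s|lborel. ?G s q) = (LINT s|lborel. (indicator ?A q *\<^sub>R of_real (1 / \<delta>\<^sup>2)) *
        (indicator {0..} s *\<^sub>R (of_real (s\<^sup>2) * exp (- (of_real s * ?z)))))"
      by (intro Bochner_Integration.integral_cong refl) (simp add: indicator_def)
    also have "\<dots> = (indicator ?A q *\<^sub>R of_real (1 / \<delta>\<^sup>2)) * (2 / ?z ^ 3)"
      by (subst integral_mult_right_zero) (subst laplace_power2, simp_all)
    also have "\<dots> = (2 * complex_of_real \<delta>) * (indicator ?A q *\<^sub>R (1 / (?D q) ^ 3))"
    proof -
      have z: "?z = (?D q) / of_real \<delta>"
        using height by (simp add: complex_eq_iff)
      show ?thesis
        unfolding z using height by (simp add: power_divide indicator_def power2_eq_square power3_eq_cube)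
    qed
    finally show "(LINT s|lborel. ?G s q) = \<dots>" .
  qed
  also have "\<dots> = 2 * complex_of_real \<delta> *
    (LINT q|lborel. indicator ?A q *\<^sub>R (1 / (?D q) ^ 3))"
    by (rule integral_mult_right_zero)
  also have "(LINT q|lborel. indicator ?A q *\<^sub>R (1 / (?D q) ^ 3)) =
      (LINT z : Q | plane_measure (p - \<delta> *\<^sub>R \<omega>) \<theta> (cross3 \<omega> \<theta>).
       1 / (complex_of_real \<delta> - \<i> * complex_of_real ((z - p) \<bullet> \<theta>)) ^ 3)"
  proof -
    let ?f = "\<lambda>q::real \<times> real. p - \<delta> *\<^sub>R \<omega> + fst q *\<^sub>R \<theta> + snd q *\<^sub>R cross3 \<omega> \<theta>"
    have pm: "plane_measure (p - \<delta> *\<^sub>R \<omega>) \<theta> (cross3 \<omega> \<theta>) = distr lborel borel ?f"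
      by (simp add: plane_measure_def case_prod_unfold)
    have fm: "?f \<in> borel_measurable borel"
      by (intro borel_measurable_continuous_onI continuous_intros)
    have "(\<lambda>z. complex_of_real \<delta> - \<i> * complex_of_real ((z - p) \<bullet> \<theta>)) \<in> borel_measurable borel"
      by (intro borel_measurable_continuous_onI continuous_intros)
    then have gm: "(\<lambda>z. indicator Q z *\<^sub>R (1 / (complex_of_real \<delta> - \<i> * complex_of_real ((z - p) \<bullet> \<theta>)) ^ 3)) \<in> borel_measurable borel"
      by (intro borel_measurable_scaleR borel_measurable_indicator borel_base borel_measurable_divide
          borel_measurable_power borel_measurable_const)
    have ip: "(?f q - p) \<bullet> \<theta> = fst q" for q
      using unit_frame_tangent[OF \<theta>]
      by (simp add: unit_frame_def inner_add_left inner_diff_left inner_commute[of "cross3 \<omega> \<theta>" \<theta>])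
    show ?thesis
      unfolding pm set_lebesgue_integral_def integral_distr[OF fm[folded measurable_lborel2] gm] ip
      by (simp add: base_coords_def indicator_def)
  qed
  also have "2 * complex_of_real \<delta> * \<dots> = cone_integral p \<omega> \<delta> Q \<theta> (\<delta> / 2)"
    using height by (intro cone_integral_eq[symmetric] unit \<theta> base) auto
  also have "\<dots> = cone_const p \<omega> \<delta> Q \<theta>"
    using height by (intro cone_const_eq[symmetric] unit \<theta> base) auto
  finally show ?thesis by simp
qed

lemma cmod_plane_wave: "cmod (plane_wave a b y) = exp (y \<bullet> a)"
  by (simp add: plane_wave_def)

lemma integrable_tangent_decay:
  assumes "\<theta> \<in> orthogonal_circle \<omega>"
  shows "integrable lborel (\<lambda>y. indicator tangent_cone y * exp (y \<bullet> \<omega>))"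
  using integrable_norm[OF integrable_tangent_wave[OF assms]] by (simp add: cmod_plane_wave)

text \<open>
  The modulus of the integrand does not depend on \<open>\<theta>\<close>, so dominated convergence applies.
\<close>

lemma cone_transform_continuous:
  assumes \<theta>0: "\<theta>' \<in> orthogonal_circle \<omega>" and lim: "\<theta> \<longlonglongrightarrow> \<theta>'"
  shows "(\<lambda>n. cone_transform (\<theta> n)) \<longlonglongrightarrow> cone_transform \<theta>'"
  unfolding cone_transform_def
proof (rule integral_dominated_convergence[where w = "\<lambda>y. indicator tangent_cone y * exp (y \<bullet> \<omega>)"])
  show "AE y in lborel. (\<lambda>n. indicator tangent_cone y *\<^sub>R plane_wave \<omega> (\<theta> n) y) \<longlonglongrightarrow> indicator tangent_cone y *\<^sub>R plane_wave \<omega> \<theta>' y"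
    unfolding plane_wave_def Complex_eq by (intro AE_I2 tendsto_intros lim)
  show "AE y in lborel. norm (indicator tangent_cone y *\<^sub>R plane_wave \<omega> (\<theta> n) y) \<le> indicator tangent_cone y * exp (y \<bullet> \<omega>)" for n
    by (simp add: cmod_plane_wave)
qed (use tangent_wave_measurable integrable_tangent_decay[OF \<theta>0] in auto)

end

section \<open>Blow-up at the tip\<close>

lemma plane_wave_add: "plane_wave a b (x + y) = plane_wave a b x * plane_wave a b y"
proof -
  have "Complex ((x + y) \<bullet> a) ((x + y) \<bullet> b) = Complex (x \<bullet> a) (x \<bullet> b) + Complex (y \<bullet> a) (y \<bullet> b)"
    by (simp add: inner_add_left complex_eq_iff)
  then show ?thesis by (simp only: plane_wave_def exp_add)
qed

lemma plane_wave_scale: "plane_wave (s *\<^sub>R a) (t *\<^sub>R b) ((1 / s) *\<^sub>R y) = plane_wave a ((t / s) *\<^sub>R b) y" if "s \<noteq> 0"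
  using that by (simp add: plane_wave_def)

lemma holder_on_imp_continuous_on:
  assumes "0 < \<alpha>" "holder_on \<alpha> S f"
  shows "continuous_on S f"
  unfolding continuous_on_def
proof
  fix x assume x: "x \<in> S"
  obtain L where L: "\<forall>x\<in>S. \<forall>y\<in>S. cmod (f x - f y) \<le> L * dist x y powr \<alpha>"
    using assms(2) unfolding holder_on_def by blast
  have "((\<lambda>y. L * dist y x powr \<alpha>) \<longlongrightarrow> L * 0) (at x within S)"
    using assms(1) by (intro tendsto_mult tendsto_const tendsto_zero_powrI[where b = \<alpha>])
      (auto intro!: tendsto_eq_intros)
  moreover have "\<forall>\<^sub>F y in at x within S. norm (f y - f x) \<le> L * dist y x powr \<alpha>"
    unfolding eventually_at_filter using L x by (intro always_eventually) auto
  ultimately have "((\<lambda>y. f y - f x) \<longlongrightarrow> 0) (at x within S)"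
    by (intro Lim_null_comparison[of "\<lambda>y. f y - f x" "\<lambda>y. L * dist y x powr \<alpha>"]) auto
  then show "(f \<longlongrightarrow> f x) (at x within S)" by (rule Lim_null[THEN iffD2])
qed

definition source_moment :: "(real^3) set \<Rightarrow> (real^3 \<Rightarrow> complex) \<Rightarrow> real^3 \<Rightarrow> real^3 \<Rightarrow> complex" where
  "source_moment D \<rho> a b = (LINT x|lebesgue. indicator D x *\<^sub>R (\<rho> x * plane_wave a b x))"

text \<open>
  The leading order of the moments at the tip \<open>p\<close>, along arbitrary frequencies \<open>\<tau> \<rightarrow> \<infinity>\<close> and \<open>\<sigma>\<close> with
  \<open>\<sigma> / \<tau> \<rightarrow> 1\<close>. The factor \<open>\<tau>\<^sup>3\<close> compensates the volume of a cone of size \<open>1 / \<tau>\<close>, and the wave at \<open>- p\<close>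
  normalises the value at the tip to one.
\<close>

definition moments_concentrate ::
    "real^3 \<Rightarrow> real^3 \<Rightarrow> (real^3) set \<Rightarrow> (real^3 \<Rightarrow> complex) \<Rightarrow> real^3 \<Rightarrow> complex \<Rightarrow> bool" where
  "moments_concentrate \<omega> \<theta> D \<rho> p A \<longleftrightarrow>
     (\<forall>\<tau> \<sigma>. (\<forall>n. 0 < \<tau> n) \<longrightarrow> filterlim \<tau> at_top sequentially \<longrightarrow> (\<lambda>n. \<sigma> n / \<tau> n) \<longlonglongrightarrow> 1 \<longrightarrow>
        (\<lambda>n. of_real (\<tau> n ^ 3) * (plane_wave (\<tau> n *\<^sub>R \<omega>) (\<sigma> n *\<^sub>R \<theta>) (- p) *
          source_moment D \<rho> (\<tau> n *\<^sub>R \<omega>) (\<sigma> n *\<^sub>R \<theta>))) \<longlonglongrightarrow> A)"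

context conical_tip
begin

lemma finite_cone_iff:
  assumes c: "0 < c"
  shows "p + c *\<^sub>R y \<in> finite_cone p \<delta> Q \<longleftrightarrow> y \<in> tangent_cone \<and> - \<delta> < c * (y \<bullet> \<omega>)"
proof
  assume "p + c *\<^sub>R y \<in> finite_cone p \<delta> Q"
  then obtain s z where s: "0 < s" "s < \<delta>" "z \<in> Q" "c *\<^sub>R y = (s / \<delta>) *\<^sub>R (z - p)"
    by (auto simp: finite_cone_def)
  have "z \<in> plane \<omega> (p \<bullet> \<omega> - \<delta>)" using base s(3) openin_imp_subset unfolding cone_base_def by blast
  then have zw: "(z - p) \<bullet> \<omega> = - \<delta>" by (simp add: plane_def inner_diff_left)
  have "c * (y \<bullet> \<omega>) = (c *\<^sub>R y) \<bullet> \<omega>" by simp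
  also have "\<dots> = (s / \<delta>) * ((z - p) \<bullet> \<omega>)" unfolding s(4) by simp
  finally have cy: "c * (y \<bullet> \<omega>) = - s" using height by (simp add: zw)
  then have yw: "y \<bullet> \<omega> = - s / c" using c by (simp add: field_simps)
  then have neg: "y \<bullet> \<omega> < 0" using s(1) c by (simp add: divide_neg_pos)
  have "(\<delta> / (y \<bullet> \<omega>)) *\<^sub>R y = (- (\<delta> / s)) *\<^sub>R (c *\<^sub>R y)"
    using s(1) c by (simp add: yw)
  also have "\<dots> = p - z" unfolding s(4) using s(1) height by simp
  finally have "p - (\<delta> / (y \<bullet> \<omega>)) *\<^sub>R y = z" by simp
  with neg s cy show "y \<in> tangent_cone \<and> - \<delta> < c * (y \<bullet> \<omega>)" by (simp add: tangent_cone_def)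
next
  assume y: "y \<in> tangent_cone \<and> - \<delta> < c * (y \<bullet> \<omega>)"
  define s where "s = - (c * (y \<bullet> \<omega>))"
  define z where "z = p - (\<delta> / (y \<bullet> \<omega>)) *\<^sub>R y"
  have neg: "y \<bullet> \<omega> < 0" and zQ: "z \<in> Q" using y by (auto simp: tangent_cone_def z_def)
  have "0 < s" "s < \<delta>" using neg c y by (auto simp: s_def mult_pos_neg)
  moreover have "p + c *\<^sub>R y = p + (s / \<delta>) *\<^sub>R (z - p)"
    using neg height by (simp add: z_def s_def)
  ultimately show "p + c *\<^sub>R y \<in> finite_cone p \<delta> Q" using zQ by (auto simp: finite_cone_def)
qed

text \<open>
  The diameter of the slice at depth \<open>s\<close> is proportional to \<open>s\<close>, hence points of small depth are close to
  the tip.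
\<close>

lemma finite_cone_near_tip:
  assumes \<eta>: "0 < \<eta>"
  shows "\<exists>\<delta>'. 0 < \<delta>' \<and> \<delta>' \<le> \<delta> \<and> (\<forall>x\<in>finite_cone p \<delta> Q. p \<bullet> \<omega> - \<delta>' < x \<bullet> \<omega> \<longrightarrow> x \<in> ball p \<eta>)"
proof -
  obtain R where R: "\<And>z. z \<in> Q \<Longrightarrow> norm z \<le> R" using base unfolding cone_base_def bounded_iff by blast
  define M where "M = \<bar>R\<bar> + norm p + 1"
  have M: "0 < M" by (simp add: M_def add_nonneg_pos)
  have "x \<in> ball p \<eta>" if x: "x \<in> finite_cone p \<delta> Q" "p \<bullet> \<omega> - min \<delta> (\<delta> * \<eta> / M) < x \<bullet> \<omega>" for x
  proof -
    obtain s z where s: "0 < s" "s < \<delta>" "z \<in> Q" "x = p + (s / \<delta>) *\<^sub>R (z - p)"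
      using x(1) by (auto simp: finite_cone_def)
    have "z \<in> plane \<omega> (p \<bullet> \<omega> - \<delta>)" using base s(3) openin_imp_subset unfolding cone_base_def by blast
    then have "(z - p) \<bullet> \<omega> = - \<delta>" by (simp add: plane_def inner_diff_left)
    then have "x \<bullet> \<omega> = p \<bullet> \<omega> - s" unfolding s(4) using height by (simp add: inner_add_left)
    then have "s < \<delta> * \<eta> / M" using x(2) by simp
    then have "s / \<delta> * M < \<eta>" using M height by (simp add: field_simps)
    moreover have "norm (z - p) \<le> M" using R[OF s(3)] norm_triangle_ineq4[of z p] by (simp add: M_def)
    then have "s / \<delta> * norm (z - p) \<le> s / \<delta> * M" using s height by (intro mult_left_mono) auto
    moreover have "dist p x = s / \<delta> * norm (z - p)" unfolding s(4) using s height by (simp add: dist_norm)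
    ultimately show ?thesis by simp
  qed
  then show ?thesis using height \<eta> M by (intro exI[of _ "min \<delta> (\<delta> * \<eta> / M)"]) auto
qed

text \<open>
  The part of \<open>D\<close> at depth at least \<open>\<delta>'\<close> contributes at most \<open>exp (- \<tau> \<delta>')\<close> times a constant. In the remaining
  part \<open>D\<close> is the cone and the density is \<open>\<rho>'\<close>. There the substitution \<open>x = p + y / \<tau>\<close> removes \<open>\<tau>\<close> from the
  exponential decay, and \<open>exp (y \<bullet> \<omega>)\<close> on the infinite cone dominates.
\<close>

lemma tip_concentration:
  fixes D :: "(real^3) set" and \<rho> \<rho>' :: "real^3 \<Rightarrow> complex"
  assumes \<theta>: "\<theta> \<in> orthogonal_circle \<omega>"
    and D: "open D" "bounded D" "\<And>x. x \<in> D \<Longrightarrow> x \<bullet> \<omega> < p \<bullet> \<omega>"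
    and cone: "D \<inter> {x. p \<bullet> \<omega> - \<delta> < x \<bullet> \<omega> \<and> x \<bullet> \<omega> < p \<bullet> \<omega>} = finite_cone p \<delta> Q"
    and \<rho>: "integrable lebesgue (\<lambda>x. indicator D x *\<^sub>R \<rho> x)"
    and \<eta>: "0 < \<eta>" and \<rho>': "continuous_on (cball p \<eta>) \<rho>'"
    and eq: "AE x in lebesgue. x \<in> ball p \<eta> \<inter> D \<longrightarrow> \<rho> x = \<rho>' x"
  shows "moments_concentrate \<omega> \<theta> D \<rho> p (\<rho>' p * cone_transform \<theta>)"
  unfolding moments_concentrate_def
proof (intro allI impI)
  fix \<tau> \<sigma> :: "nat \<Rightarrow> real"
  assume \<tau>0: "\<forall>n. 0 < \<tau> n" and \<tau>inf: "filterlim \<tau> at_top sequentially" and \<sigma>: "(\<lambda>n. \<sigma> n / \<tau> n) \<longlonglongrightarrow> 1"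
  have \<tau>: "0 < \<tau> n" "filterlim \<tau> at_top sequentially" for n using \<tau>0 \<tau>inf by auto
  let ?e = "\<lambda>n y. p + (1 / \<tau> n) *\<^sub>R y"
  let ?w = "\<lambda>n y. plane_wave \<omega> ((\<sigma> n / \<tau> n) *\<^sub>R \<theta>) y"
  define h where "h = p \<bullet> \<omega>"
  obtain \<delta>' where \<delta>': "0 < \<delta>'" "\<delta>' \<le> \<delta>" "\<And>x. x \<in> finite_cone p \<delta> Q \<Longrightarrow> h - \<delta>' < x \<bullet> \<omega> \<Longrightarrow> x \<in> ball p \<eta>"
    using finite_cone_near_tip[OF \<eta>] unfolding h_def by blast
  define W where "W n x = plane_wave (\<tau> n *\<^sub>R \<omega>) (\<sigma> n *\<^sub>R \<theta>) (x - p)" for n x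
  have Wc: "continuous_on UNIV (W n)" for n
    unfolding W_def by (rule continuous_on_compose2[OF continuous_on_plane_wave[of UNIV]]) (auto intro!: continuous_intros)
  then have Wm: "W n \<in> borel_measurable borel" for n by (rule borel_measurable_continuous_onI)
  let ?I = "\<lambda>n A. LINT x|lebesgue. indicator A x *\<^sub>R (\<rho> x * W n x)"
  have cW: "cmod (W n x) = exp (\<tau> n * (x \<bullet> \<omega> - h))" for n x
    by (simp add: W_def cmod_plane_wave inner_diff_left h_def algebra_simps)
  define Near where "Near = D \<inter> {x. h - \<delta>' < x \<bullet> \<omega>}"
  define Far where "Far = D \<inter> {x. x \<bullet> \<omega> \<le> h - \<delta>'}"
  have bN: "Near \<in> sets borel" and bF: "Far \<in> sets borel"
    unfolding Near_def Far_def using D(1) by (auto intro!: sets.Int)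
  have iW: "integrable lebesgue (\<lambda>x. indicator A x *\<^sub>R (\<rho> x * W n x))" if A: "A \<in> sets borel" "A \<subseteq> D" for A n
  proof (rule Bochner_Integration.integrable_bound[OF \<rho>])
    have "(\<lambda>x. indicator A x *\<^sub>R ((indicator D x *\<^sub>R \<rho> x) * W n x)) \<in> borel_measurable lebesgue"
      using A(1) by (intro borel_measurable_scaleR borel_measurable_indicator borel_measurable_times
          borel_measurable_integrable[OF \<rho>] measurable_completion) (simp_all add: Wm)
    moreover have "indicator A x *\<^sub>R ((indicator D x *\<^sub>R \<rho> x) * W n x) = indicator A x *\<^sub>R (\<rho> x * W n x)" for x
      using A(2) by (auto simp: indicator_def)
    ultimately show "(\<lambda>x. indicator A x *\<^sub>R (\<rho> x * W n x)) \<in> borel_measurable lebesgue"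
      by (simp only:)
    show "AE x in lebesgue. norm (indicator A x *\<^sub>R (\<rho> x * W n x)) \<le> norm (indicator D x *\<^sub>R \<rho> x)"
    proof (rule AE_I2)
      fix x
      have "cmod (W n x) \<le> 1" if "x \<in> D"
        using D(3)[OF that] \<tau>(1)[of n] by (simp add: cW h_def mult_nonneg_nonpos)
      then show "norm (indicator A x *\<^sub>R (\<rho> x * W n x)) \<le> norm (indicator D x *\<^sub>R \<rho> x)"
        using A(2) by (auto simp: indicator_def norm_mult mult_left_le)
    qed
  qed
  have split: "(?I n D) =
      (?I n Near) + (?I n Far)" for n
  proof -
    have "indicator D x *\<^sub>R (\<rho> x * W n x) = indicator Near x *\<^sub>R (\<rho> x * W n x) + indicator Far x *\<^sub>R (\<rho> x * W n x)" for x
      by (auto simp: Near_def Far_def indicator_def)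
    then show ?thesis
      using iW[OF bN] iW[OF bF] by (simp add: Near_def Far_def)
  qed
  have far: "(\<lambda>n. of_real (\<tau> n ^ 3) * (?I n Far)) \<longlonglongrightarrow> 0"
  proof (rule Lim_null_comparison)
    let ?N = "LINT x|lebesgue. cmod (indicator D x *\<^sub>R \<rho> x)"
    show "\<forall>\<^sub>F n in sequentially. norm (of_real (\<tau> n ^ 3) * (?I n Far)) \<le>
        \<tau> n ^ 3 * exp (- (\<delta>' * \<tau> n)) * ?N"
    proof (rule always_eventually, intro allI)
      fix n
      have "norm (?I n Far) \<le> (LINT x|lebesgue. exp (- (\<delta>' * \<tau> n)) * cmod (indicator D x *\<^sub>R \<rho> x))"
      proof (rule order_trans[OF integral_norm_bound integral_mono])
        show "integrable lebesgue (\<lambda>x. norm (indicator Far x *\<^sub>R (\<rho> x * W n x)))"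
          by (intro integrable_norm iW bF) (simp add: Far_def)
        show "integrable lebesgue (\<lambda>x. exp (- (\<delta>' * \<tau> n)) * cmod (indicator D x *\<^sub>R \<rho> x))"
          by (intro integrable_mult_right integrable_norm \<rho>)
        fix x
        have "cmod (W n x) \<le> exp (- (\<delta>' * \<tau> n))" if "x \<in> Far"
        proof -
          have "\<tau> n * (x \<bullet> \<omega> - h) \<le> \<tau> n * (- \<delta>')"
            using that \<tau>(1)[of n] by (intro mult_left_mono) (auto simp: Far_def)
          then show ?thesis by (simp add: cW mult.commute)
        qed
        then show "norm (indicator Far x *\<^sub>R (\<rho> x * W n x)) \<le> exp (- (\<delta>' * \<tau> n)) * cmod (indicator D x *\<^sub>R \<rho> x)"
          by (cases "x \<in> Far") (auto simp: Far_def norm_mult mult.commute intro!: mult_left_mono)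
      qed
      also have "\<dots> = exp (- (\<delta>' * \<tau> n)) * ?N" by simp
      finally have "\<tau> n ^ 3 * norm (?I n Far) \<le> \<tau> n ^ 3 * (exp (- (\<delta>' * \<tau> n)) * ?N)"
        using \<tau>(1)[of n] by (intro mult_left_mono) auto
      then show "norm (of_real (\<tau> n ^ 3) * (?I n Far)) \<le>
        \<tau> n ^ 3 * exp (- (\<delta>' * \<tau> n)) * ?N"
        using \<tau>(1)[of n] by (simp add: norm_mult norm_power mult.assoc)
    qed
    have "filterlim (\<lambda>n. \<delta>' * \<tau> n) at_top sequentially"
      using \<delta>'(1) \<tau>(2) by (intro filterlim_tendsto_pos_mult_at_top[OF tendsto_const])
    then have "(\<lambda>n. (\<delta>' * \<tau> n) ^ 3 / exp (\<delta>' * \<tau> n)) \<longlonglongrightarrow> 0"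
      by (rule filterlim_compose[OF tendsto_power_div_exp_0])
    then have "(\<lambda>n. inverse (\<delta>' ^ 3) * ((\<delta>' * \<tau> n) ^ 3 / exp (\<delta>' * \<tau> n))) \<longlonglongrightarrow> 0"
      by (rule tendsto_mult_right_zero)
    moreover have "inverse (\<delta>' ^ 3) * ((\<delta>' * \<tau> n) ^ 3 / exp (\<delta>' * \<tau> n)) = \<tau> n ^ 3 * exp (- (\<delta>' * \<tau> n))" for n
      using \<delta>'(1) by (simp add: power_mult_distrib exp_minus field_simps)
    ultimately have "(\<lambda>n. \<tau> n ^ 3 * exp (- (\<delta>' * \<tau> n))) \<longlonglongrightarrow> 0" by simp
    then show "(\<lambda>n. \<tau> n ^ 3 * exp (- (\<delta>' * \<tau> n)) * ?N) \<longlonglongrightarrow> 0" by (rule tendsto_mult_left_zero)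
  qed
  define \<rho>b where "\<rho>b x = indicator (cball p \<eta>) x *\<^sub>R \<rho>' x" for x
  let ?N = "\<lambda>n y. indicator Near (?e n y) *\<^sub>R (\<rho>b (?e n y) * ?w n y)"
  have \<rho>bm: "\<rho>b \<in> borel_measurable borel"
    unfolding \<rho>b_def by (rule borel_measurable_continuous_on_indicator[OF _ \<rho>']) simp
  have "compact (\<rho>' ` cball p \<eta>)" by (intro compact_continuous_image \<rho>') simp
  then have "bounded (\<rho>' ` cball p \<eta>)" by (rule compact_imp_bounded)
  then obtain B where B: "\<And>x. x \<in> cball p \<eta> \<Longrightarrow> cmod (\<rho>' x) \<le> B" unfolding bounded_iff by blast
  have "cmod (\<rho>' p) \<le> B" using \<eta> by (intro B) simp
  then have B0: "0 \<le> B" using norm_ge_zero[of "\<rho>' p"] by linarith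
  have \<rho>bB: "cmod (\<rho>b x) \<le> B" for x using B B0 by (simp add: \<rho>b_def indicator_def)
  have Near_iff: "?e n y \<in> Near \<longleftrightarrow> y \<in> tangent_cone \<and> - (\<tau> n * \<delta>') < y \<bullet> \<omega>" for n y
  proof -
    have t: "0 < 1 / \<tau> n" using \<tau>(1)[of n] by simp
    have "Near = finite_cone p \<delta> Q \<inter> {x. h - \<delta>' < x \<bullet> \<omega>}"
      using \<delta>'(2) D(3) unfolding Near_def cone[symmetric] h_def by auto
    then have "?e n y \<in> Near \<longleftrightarrow>
        y \<in> tangent_cone \<and> - \<delta> < 1 / \<tau> n * (y \<bullet> \<omega>) \<and> - \<delta>' < 1 / \<tau> n * (y \<bullet> \<omega>)"
      using finite_cone_iff[OF t, of y] by (auto simp: inner_add_left h_def)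
    moreover have "- \<delta>' < 1 / \<tau> n * (y \<bullet> \<omega>) \<longleftrightarrow> - (\<tau> n * \<delta>') < y \<bullet> \<omega>"
      using \<tau>(1)[of n] by (auto simp: field_simps)
    ultimately show ?thesis using \<delta>'(2) by auto
  qed
  have near_eq: "of_real (\<tau> n ^ 3) * (?I n Near) =
      (LINT y|lborel. ?N n y)" for n
  proof -
    have Fm: "(\<lambda>x. indicator Near x *\<^sub>R (\<rho>b x * W n x)) \<in> borel_measurable borel"
      by (intro borel_measurable_scaleR borel_measurable_indicator bN borel_measurable_times \<rho>bm Wm)
    have "(?I n Near) = (LINT x|lebesgue. indicator Near x *\<^sub>R (\<rho>b x * W n x))"
    proof (rule integral_cong_AE)
      show "(\<lambda>x. indicator Near x *\<^sub>R (\<rho> x * W n x)) \<in> borel_measurable lebesgue"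
        by (intro borel_measurable_integrable iW bN) (simp add: Near_def)
      show "(\<lambda>x. indicator Near x *\<^sub>R (\<rho>b x * W n x)) \<in> borel_measurable lebesgue"
        using Fm by (intro measurable_completion) simp
      have sub: "x \<in> ball p \<eta> \<inter> D" if "x \<in> Near" for x
      proof -
        have "x \<in> finite_cone p \<delta> Q"
          unfolding cone[symmetric] using that \<delta>'(2) D(3)[of x] by (auto simp: Near_def h_def)
        then show ?thesis using that \<delta>'(3)[of x] by (auto simp: Near_def)
      qed
      show "AE x in lebesgue. indicator Near x *\<^sub>R (\<rho> x * W n x) = indicator Near x *\<^sub>R (\<rho>b x * W n x)"
        using eq
      proof eventually_elim
        case (elim x)
        then show ?case using sub[of x] by (cases "x \<in> Near") (auto simp: \<rho>b_def)
      qed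
    qed
    also have "\<dots> = (LINT x|lborel. indicator Near x *\<^sub>R (\<rho>b x * W n x))"
      using Fm by (intro integral_completion) simp
    also have "\<dots> = ((1 / \<tau> n) ^ 3) *\<^sub>R (LINT y|lborel. indicator Near (?e n y) *\<^sub>R
        (\<rho>b (?e n y) * W n (?e n y)))"
      using integral_lborel_affine[of "1 / \<tau> n", OF _ Fm, of p] \<tau>(1)[of n] by simp
    finally have e: "(?I n Near) = ((1 / \<tau> n) ^ 3) *\<^sub>R
        (LINT y|lborel. indicator Near (?e n y) *\<^sub>R
        (\<rho>b (?e n y) * W n (?e n y)))" .
    have W: "W n (?e n y) = ?w n y" for y
      using plane_wave_scale[of "\<tau> n" \<omega> "\<sigma> n" \<theta> y] \<tau>(1)[of n] by (simp add: W_def)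
    have c: "of_real (\<tau> n ^ 3) * (((1 / \<tau> n) ^ 3) *\<^sub>R z) = z" for z :: complex
      using \<tau>(1)[of n] by (simp add: scaleR_conv_of_real power_divide)
    show ?thesis unfolding e W c ..
  qed
  have near: "(\<lambda>n. LINT y|lborel. ?N n y)
      \<longlonglongrightarrow> (LINT y|lborel. \<rho>' p * (indicator tangent_cone y *\<^sub>R plane_wave \<omega> \<theta> y))"
  proof (rule integral_dominated_convergence[where w = "\<lambda>y. B * (indicator tangent_cone y * exp (y \<bullet> \<omega>))"])
    show "(\<lambda>y. \<rho>' p * (indicator tangent_cone y *\<^sub>R plane_wave \<omega> \<theta> y)) \<in> borel_measurable lborel"
      using tangent_wave_measurable[of \<theta>] by (intro borel_measurable_times borel_measurable_const) simp
    show "integrable lborel (\<lambda>y. B * (indicator tangent_cone y * exp (y \<bullet> \<omega>)))"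
      by (intro integrable_mult_right integrable_tangent_decay[OF \<theta>])
    have am: "(\<lambda>y. ?e n y) \<in> borel_measurable borel" for n
      by (intro borel_measurable_continuous_onI continuous_intros)
    show "(\<lambda>y. ?N n y) \<in> borel_measurable lborel" for n
      unfolding measurable_lborel2
      by (intro borel_measurable_scaleR borel_measurable_times measurable_compose[OF am borel_measurable_indicator[OF bN]]
          measurable_compose[OF am \<rho>bm] borel_measurable_continuous_onI continuous_on_plane_wave)
    show "AE y in lborel. norm (?N n y)
        \<le> B * (indicator tangent_cone y * exp (y \<bullet> \<omega>))" for n
    proof (rule AE_I2)
      fix y
      show "norm (?N n y)
        \<le> B * (indicator tangent_cone y * exp (y \<bullet> \<omega>))"
        using Near_iff[of n y] \<rho>bB B0 by (auto simp: indicator_def norm_mult cmod_plane_wave intro!: mult_right_mono)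
    qed
    show "AE y in lborel. (\<lambda>n. ?N n y)
        \<longlonglongrightarrow> \<rho>' p * (indicator tangent_cone y *\<^sub>R plane_wave \<omega> \<theta> y)"
    proof (rule AE_I2)
      fix y
      show "(\<lambda>n. ?N n y)
        \<longlonglongrightarrow> \<rho>' p * (indicator tangent_cone y *\<^sub>R plane_wave \<omega> \<theta> y)"
      proof (cases "y \<in> tangent_cone")
        case False
        then show ?thesis using Near_iff[of _ y] by simp
      next
        case True
        have inv: "(\<lambda>n. 1 / \<tau> n) \<longlonglongrightarrow> 0"
          using \<tau>(2) by (intro tendsto_divide_0[OF tendsto_const] filterlim_at_top_imp_at_infinity)
        have "(\<lambda>n. ?e n y) \<longlonglongrightarrow> p + 0 *\<^sub>R y" by (intro tendsto_intros inv)
        then have toP: "(\<lambda>n. ?e n y) \<longlonglongrightarrow> p" by simp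
        have "p \<in> interior (cball p \<eta>)" using \<eta> by simp
        then have "isCont \<rho>' p" using \<rho>' continuous_on_interior by blast
        then have "(\<lambda>n. \<rho>' (?e n y)) \<longlonglongrightarrow> \<rho>' p" using toP by (rule isCont_tendsto_compose)
        moreover have "?w n y = exp (Complex (y \<bullet> \<omega>) (\<sigma> n / \<tau> n * (y \<bullet> \<theta>)))" for n
          by (simp add: plane_wave_def)
        moreover have "(\<lambda>n. exp (Complex (y \<bullet> \<omega>) (\<sigma> n / \<tau> n * (y \<bullet> \<theta>)))) \<longlonglongrightarrow> exp (Complex (y \<bullet> \<omega>) (1 * (y \<bullet> \<theta>)))"
          by (intro tendsto_exp tendsto_Complex tendsto_mult tendsto_const \<sigma>)
        ultimately have lim: "(\<lambda>n. \<rho>' (?e n y) * ?w n y) \<longlonglongrightarrow> \<rho>' p * plane_wave \<omega> \<theta> y"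
          by (simp add: tendsto_mult plane_wave_def)
        have ev1: "\<forall>\<^sub>F n in sequentially. ?e n y \<in> ball p \<eta>"
          using topological_tendstoD[OF toP, of "ball p \<eta>"] \<eta> by simp
        have ev2: "\<forall>\<^sub>F n in sequentially. - (y \<bullet> \<omega>) / \<delta>' < \<tau> n"
          using \<tau>(2) by (simp add: filterlim_at_top_dense)
        have "\<forall>\<^sub>F n in sequentially. \<rho>' (?e n y) * ?w n y =
            ?N n y"
          using ev1 ev2
        proof eventually_elim
          case (elim n)
          have "- (\<tau> n * \<delta>') < y \<bullet> \<omega>" using elim(2) \<delta>'(1) by (simp add: field_simps)
          then have "?e n y \<in> Near" using True Near_iff by blast
          then show ?case using elim(1) by (simp add: \<rho>b_def)
        qed
        then have "(\<lambda>n. ?N n y)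
            \<longlonglongrightarrow> \<rho>' p * plane_wave \<omega> \<theta> y"
          by (rule Lim_transform_eventually[OF lim])
        then show ?thesis using True by simp
      qed
    qed
  qed
  have "plane_wave (\<tau> n *\<^sub>R \<omega>) (\<sigma> n *\<^sub>R \<theta>) (- p) * source_moment D \<rho> (\<tau> n *\<^sub>R \<omega>) (\<sigma> n *\<^sub>R \<theta>) = ?I n D" for n
  proof -
    have "W n x = plane_wave (\<tau> n *\<^sub>R \<omega>) (\<sigma> n *\<^sub>R \<theta>) (- p) * plane_wave (\<tau> n *\<^sub>R \<omega>) (\<sigma> n *\<^sub>R \<theta>) x" for x
      using plane_wave_add[of _ _ "- p" x] by (simp add: W_def)
    then have "(?I n D) =
        (LINT x|lebesgue. plane_wave (\<tau> n *\<^sub>R \<omega>) (\<sigma> n *\<^sub>R \<theta>) (- p) * (indicator D x *\<^sub>R (\<rho> x * plane_wave (\<tau> n *\<^sub>R \<omega>) (\<sigma> n *\<^sub>R \<theta>) x)))"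
      by (intro Bochner_Integration.integral_cong refl) (simp add: indicator_def)
    then show ?thesis by (simp only: source_moment_def integral_mult_right_zero)
  qed
  moreover have "(\<lambda>n. of_real (\<tau> n ^ 3) * (?I n D)) \<longlonglongrightarrow>
      (LINT y|lborel. \<rho>' p * (indicator tangent_cone y *\<^sub>R plane_wave \<omega> \<theta> y)) + 0"
    unfolding split distrib_left near_eq by (intro tendsto_add near far)
  ultimately show "(\<lambda>n. of_real (\<tau> n ^ 3) * (plane_wave (\<tau> n *\<^sub>R \<omega>) (\<sigma> n *\<^sub>R \<theta>) (- p) *
      source_moment D \<rho> (\<tau> n *\<^sub>R \<omega>) (\<sigma> n *\<^sub>R \<theta>))) \<longlonglongrightarrow> \<rho>' p * cone_transform \<theta>"
    unfolding cone_transform_def by (simp only: integral_mult_right_zero add_0_right)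
qed

end

section \<open>Recovering the tip from the moments\<close>

text \<open>
  The supremum is not attained in \<open>D\<close>, since \<open>D\<close> is open and leaves room to move in direction \<open>\<omega>\<close>.
\<close>

lemma contact_point_props:
  assumes D: "open D" "D \<noteq> {}" "bounded D" and reg: "regular_direction D \<omega>" and \<omega>: "\<omega> \<in> sphere 0 1"
  shows "contact_point D \<omega> \<bullet> \<omega> = support_fun D \<omega>"
    and "x \<in> D \<Longrightarrow> x \<bullet> \<omega> < contact_point D \<omega> \<bullet> \<omega>"
proof -
  have "contact_set D \<omega> = {contact_point D \<omega>}"
    using reg unfolding regular_direction_def contact_point_def is_singleton_the_elem .
  then have "contact_point D \<omega> \<in> contact_set D \<omega>" by simp
  then show eq: "contact_point D \<omega> \<bullet> \<omega> = support_fun D \<omega>" by (simp add: contact_set_def)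
  obtain R where R: "\<And>x. x \<in> D \<Longrightarrow> norm x \<le> R" using D(3) unfolding bounded_iff by blast
  have bdd: "bdd_above ((\<lambda>x. x \<bullet> \<omega>) ` D)"
  proof (rule bdd_aboveI2)
    fix x assume "x \<in> D"
    then show "x \<bullet> \<omega> \<le> R" using R[of x] \<omega> norm_cauchy_schwarz[of x \<omega>] by simp
  qed
  assume x: "x \<in> D"
  then obtain e where e: "0 < e" "cball x e \<subseteq> D" using D(1) open_contains_cball by blast
  have "x + e *\<^sub>R \<omega> \<in> D" using e \<omega> by (intro subsetD[OF e(2)]) (simp add: dist_norm)
  then have "(x + e *\<^sub>R \<omega>) \<bullet> \<omega> \<le> support_fun D \<omega>" unfolding support_fun_def by (rule cSUP_upper[OF _ bdd])
  moreover have "(x + e *\<^sub>R \<omega>) \<bullet> \<omega> = x \<bullet> \<omega> + e"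
    using \<omega> by (simp add: inner_add_left norm_eq_1)
  ultimately show "x \<bullet> \<omega> < contact_point D \<omega> \<bullet> \<omega>" using e(1) eq by simp
qed

lemma source_term_moment:
  assumes D: "open D" "closure D \<subseteq> \<Omega>" and \<Omega>: "\<Omega> \<in> sets borel"
  shows "(LINT x|lebesgue_on \<Omega>. source_term \<rho> D x * plane_wave a b x) = source_moment D \<rho> a b"
proof -
  let ?v = "plane_wave a b"
  have "(LINT x|lebesgue_on \<Omega>. source_term \<rho> D x * ?v x) = (LINT x|lebesgue. indicator \<Omega> x *\<^sub>R (source_term \<rho> D x * ?v x))"
    using \<Omega> by (subst integral_restrict_space) auto
  also have "\<dots> = (LINT x|lebesgue. indicator D x *\<^sub>R (\<rho> x * ?v x))"
    using D(2) closure_subset[of D] by (intro Bochner_Integration.integral_cong refl) (auto simp: source_term_def indicator_def)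
  finally show ?thesis by (simp only: source_moment_def)
qed

lemma source_term_L2:
  assumes D: "open D" "closure D \<subseteq> \<Omega>" and \<Omega>: "\<Omega> \<in> sets borel" and \<rho>: "L2 (lebesgue_on D) \<rho>"
  shows "L2 (lebesgue_on \<Omega>) (source_term \<rho> D)"
proof -
  have Dm: "D \<inter> space lebesgue \<in> sets lebesgue" and \<Omega>m: "\<Omega> \<inter> space lebesgue \<in> sets lebesgue" using D \<Omega> by auto
  have sub: "x \<in> D \<Longrightarrow> x \<in> \<Omega>" for x using D(2) closure_subset by blast
  have st: "source_term \<rho> D x = indicator D x *\<^sub>R \<rho> x" for x by (simp add: source_term_def indicator_def)
  have "(\<lambda>x. indicator D x *\<^sub>R \<rho> x) \<in> borel_measurable lebesgue"
    using \<rho> unfolding L2_def borel_measurable_restrict_space_iff[OF Dm] by blast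
  then have m: "source_term \<rho> D \<in> borel_measurable lebesgue" by (simp add: st[abs_def])
  have "integrable lebesgue (\<lambda>x. indicator D x *\<^sub>R (cmod (\<rho> x))\<^sup>2)"
    using \<rho> unfolding L2_def integrable_restrict_space[OF Dm] by blast
  moreover have "indicator \<Omega> x *\<^sub>R (cmod (source_term \<rho> D x))\<^sup>2 = indicator D x *\<^sub>R (cmod (\<rho> x))\<^sup>2" for x
    using sub by (auto simp: source_term_def indicator_def)
  ultimately have "integrable lebesgue (\<lambda>x. indicator \<Omega> x *\<^sub>R (cmod (source_term \<rho> D x))\<^sup>2)" by (simp only:)
  then show ?thesis
    using m unfolding L2_def integrable_restrict_space[OF \<Omega>m] by (blast intro: measurable_restrict_space1)
qed

text \<open>
  The modulus \<open>exp (\<tau> a)\<close> cannot converge to a positive number unless \<open>a = 0\<close>. If \<open>b\<close> were not zero, along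
  frequencies for which \<open>\<surd>(\<tau>\<^sup>2 + k\<^sup>2) b\<close> advances by \<open>\<pi>\<close> in each step the values would alternate in sign, and
  the limit would equal its own negative.
\<close>

lemma bounded_phase_forces_orthogonality:
  fixes k a b :: real and L :: complex
  assumes L: "L \<noteq> 0"
    and lim: "\<And>\<tau>. (\<And>n. 0 < \<tau> n) \<Longrightarrow> filterlim \<tau> at_top sequentially \<Longrightarrow>
      (\<lambda>n. exp (Complex (\<tau> n * a) (sqrt ((\<tau> n)\<^sup>2 + k\<^sup>2) * b))) \<longlonglongrightarrow> L"
  shows "a = 0" and "b = 0"
proof -
  show "a = 0"
  proof (rule ccontr)
    assume a: "a \<noteq> 0"
    have inf: "filterlim (\<lambda>n. real (Suc n)) at_top sequentially"
      by (rule filterlim_compose[OF filterlim_real_sequentially filterlim_Suc])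
    have "(\<lambda>n. norm (exp (Complex (real (Suc n) * a) (sqrt ((real (Suc n))\<^sup>2 + k\<^sup>2) * b)))) \<longlonglongrightarrow> norm L"
      by (intro tendsto_norm lim inf) simp
    then have "(\<lambda>n. exp (real (Suc n) * a)) \<longlonglongrightarrow> norm L" by simp
    then have "(\<lambda>n. ln (exp (real (Suc n) * a))) \<longlonglongrightarrow> ln (norm L)" using L by (intro tendsto_ln) auto
    then have "(\<lambda>n. real (Suc n) * a * (1 / a)) \<longlonglongrightarrow> ln (norm L) * (1 / a)"
      unfolding ln_exp by (intro tendsto_mult tendsto_const)
    then have "(\<lambda>n. real (Suc n)) \<longlonglongrightarrow> ln (norm L) * (1 / a)" using a by simp
    with inf show False using not_tendsto_and_filterlim_at_infinity[of sequentially]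
        filterlim_at_top_imp_at_infinity by (metis sequentially_bot)
  qed
  show "b = 0"
  proof (rule ccontr)
    assume b: "b \<noteq> 0"
    \<comment> \<open>The offset \<open>N\<close> makes \<open>s n > |k|\<close>, so that \<open>s n = \<surd>(\<tau>\<^sup>2 + k\<^sup>2)\<close> has a positive solution \<open>\<tau>\<close>.\<close>
    obtain N where N: "\<bar>k\<bar> * \<bar>b\<bar> / pi < real N" using reals_Archimedean2 by blast
    define s where "s n = (real n + real N) * pi / \<bar>b\<bar>" for n
    define \<tau> where "\<tau> n = sqrt ((s n)\<^sup>2 - k\<^sup>2)" for n
    have sk: "\<bar>k\<bar> < s n" for n
    proof -
      have "\<bar>k\<bar> * \<bar>b\<bar> < real N * pi" using N by (simp add: divide_less_eq)
      also have "\<dots> \<le> (real n + real N) * pi" by (intro mult_right_mono) auto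
      finally show ?thesis using b by (simp add: s_def less_divide_eq)
    qed
    then have sq: "k\<^sup>2 < (s n)\<^sup>2" for n using power_strict_mono[of "\<bar>k\<bar>" "s n" 2] by simp
    then have pos: "0 < \<tau> n" for n by (simp add: \<tau>_def)
    have ss: "sqrt ((\<tau> n)\<^sup>2 + k\<^sup>2) = s n" for n
      using sq[of n] sk[of n] by (simp add: \<tau>_def)
    have "0 < pi / \<bar>b\<bar>" using b by simp
    then have "filterlim (\<lambda>n. (real N * pi / \<bar>b\<bar> - \<bar>k\<bar>) + pi / \<bar>b\<bar> * real n) at_top sequentially"
      by (intro filterlim_tendsto_add_at_top[OF tendsto_const] filterlim_tendsto_pos_mult_at_top[OF tendsto_const]
          filterlim_real_sequentially)
    moreover have "(real N * pi / \<bar>b\<bar> - \<bar>k\<bar>) + pi / \<bar>b\<bar> * real n = s n - \<bar>k\<bar>" for n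
      by (simp add: s_def distrib_right add_divide_distrib)
    ultimately have "filterlim (\<lambda>n. s n - \<bar>k\<bar>) at_top sequentially" by (simp only:)
    moreover have "\<forall>\<^sub>F n in sequentially. s n - \<bar>k\<bar> \<le> \<tau> n"
    proof (rule always_eventually, intro allI)
      fix n
      have "(s n - \<bar>k\<bar>) * (s n - \<bar>k\<bar>) \<le> (s n - \<bar>k\<bar>) * (s n + \<bar>k\<bar>)"
        using sk[of n] by (intro mult_left_mono) auto
      then have "(s n - \<bar>k\<bar>)\<^sup>2 \<le> (s n)\<^sup>2 - k\<^sup>2"
        by (simp add: power2_eq_square algebra_simps)
      then show "s n - \<bar>k\<bar> \<le> \<tau> n" unfolding \<tau>_def by (rule real_le_rsqrt)
    qed
    ultimately have inf: "filterlim \<tau> at_top sequentially"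
      by (rule filterlim_at_top_mono)
    have conv: "(\<lambda>n. exp (Complex (\<tau> n * a) (s n * b))) \<longlonglongrightarrow> L"
      using lim[OF pos inf] by (simp add: ss)
    have alt: "exp (Complex 0 (s (Suc n) * b)) = - exp (Complex 0 (s n * b))" for n
    proof -
      have "s (Suc n) * b = s n * b + sgn b * pi"
        using b by (simp add: s_def sgn_if field_simps)
      then have step: "Complex 0 (s (Suc n) * b) = Complex 0 (s n * b) + Complex 0 (sgn b * pi)"
        by (simp add: complex_eq_iff)
      have "exp (Complex 0 pi) = -1" "exp (Complex 0 (- pi)) = -1"
        by (simp_all add: complex_eq_iff Re_exp Im_exp)
      with b have "exp (Complex 0 (sgn b * pi)) = -1" by (cases "0 < b") simp_all
      then show ?thesis unfolding step exp_add by simp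
    qed
    have c: "(\<lambda>n. exp (Complex 0 (s n * b))) \<longlonglongrightarrow> L" using conv \<open>a = 0\<close> by simp
    have "(\<lambda>n. - exp (Complex 0 (s n * b))) \<longlonglongrightarrow> L" using LIMSEQ_Suc[OF c] by (simp only: alt)
    then have "L = - L" by (rule LIMSEQ_unique[OF _ tendsto_minus[OF c]])
    then show False using L by simp
  qed
qed

lemma sqrt_ratio_tendsto_1:
  fixes k :: real
  assumes "\<And>n. 0 < \<tau> n" "filterlim \<tau> at_top sequentially"
  shows "(\<lambda>n. sqrt ((\<tau> n)\<^sup>2 + k\<^sup>2) / \<tau> n) \<longlonglongrightarrow> 1"
proof -
  have "(\<lambda>n. k / \<tau> n) \<longlonglongrightarrow> 0"
    using assms(2) by (intro tendsto_divide_0[OF tendsto_const] filterlim_at_top_imp_at_infinity)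
  then have "(\<lambda>n. sqrt (1 + (k / \<tau> n)\<^sup>2)) \<longlonglongrightarrow> sqrt (1 + 0\<^sup>2)" by (intro tendsto_intros)
  moreover have "sqrt (1 + (k / \<tau> n)\<^sup>2) = sqrt ((\<tau> n)\<^sup>2 + k\<^sup>2) / \<tau> n" for n
  proof -
    have "1 + (k / \<tau> n)\<^sup>2 = ((\<tau> n)\<^sup>2 + k\<^sup>2) / (\<tau> n)\<^sup>2" using assms(1)[of n] by (simp add: power_divide field_simps)
    then show ?thesis using assms(1)[of n] by (simp add: real_sqrt_divide)
  qed
  ultimately show ?thesis by simp
qed

text \<open>
  The constant is the value at the tip of the Hoelder continuous representative of the density; that the
  source is active makes it nonzero.
\<close>

lemma source_moments_concentrate:
  assumes \<omega>: "\<omega> \<in> sphere 0 1" and \<Omega>: "bounded \<Omega>"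
    and sp: "source_problem \<Omega> k D \<rho> u" and reg: "regular_direction D \<omega>"
    and con: "conical_singularity D \<omega> \<delta> Q" and act: "active_at \<rho> D (contact_point D \<omega>)"
  shows "conical_tip \<omega> (contact_point D \<omega>) \<delta> Q"
    and "\<exists>c. c \<noteq> 0 \<and> (\<forall>\<theta>\<in>orthogonal_circle \<omega>. moments_concentrate \<omega> \<theta> D \<rho> (contact_point D \<omega>)
      (c * conical_tip.cone_transform \<omega> (contact_point D \<omega>) \<delta> Q \<theta>))"
proof -
  let ?p = "contact_point D \<omega>"
  have D: "open D" "D \<noteq> {}" "closure D \<subseteq> \<Omega>" and \<rho>: "L2 (lebesgue_on D) \<rho>"
    using sp by (simp_all add: source_problem_def)
  have bD: "bounded D" by (rule bounded_subset[OF \<Omega> order_trans[OF closure_subset D(3)]])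
  note cp = contact_point_props[OF D(1,2) bD reg \<omega>]
  show tip: "conical_tip \<omega> ?p \<delta> Q"
    using con \<omega> unfolding conical_singularity_def by (intro conical_tip.intro) (simp_all add: cp(1))
  obtain \<eta> \<alpha> \<rho>' where act': "\<eta> > 0" "0 < \<alpha>" "holder_on \<alpha> (cball ?p \<eta>) \<rho>'"
    "AE x in lebesgue. x \<in> ball ?p \<eta> \<inter> D \<longrightarrow> \<rho> x = \<rho>' x" "\<rho>' ?p \<noteq> 0"
    using act unfolding active_at_def by (elim conjE exE)
  have "finite_measure (lebesgue_on D)" using D(1) bD by (intro finite_measure_lebesgue_on) auto
  then have "integrable (lebesgue_on D) (\<lambda>x. \<rho> x * 1)"
    by (rule integrable_L2_times_bounded[OF _ \<rho>, where B = 1]) auto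
  then have int: "integrable lebesgue (\<lambda>x. indicator D x *\<^sub>R \<rho> x)"
    using D(1) by (simp add: integrable_restrict_space)
  have cone: "D \<inter> {x. ?p \<bullet> \<omega> - \<delta> < x \<bullet> \<omega> \<and> x \<bullet> \<omega> < ?p \<bullet> \<omega>} = finite_cone ?p \<delta> Q"
    using con unfolding conical_singularity_def cp(1) by (elim conjE)
  note concentration = conical_tip.tip_concentration[OF tip _ D(1) bD cp(2) cone int act'(1)
      holder_on_imp_continuous_on[OF act'(2,3)] act'(4)]
  show "\<exists>c. c \<noteq> 0 \<and> (\<forall>\<theta>\<in>orthogonal_circle \<omega>. moments_concentrate \<omega> \<theta> D \<rho> ?p
      (c * conical_tip.cone_transform \<omega> ?p \<delta> Q \<theta>))"
    by (intro exI[of _ "\<rho>' ?p"] conjI act'(5) ballI concentration) simp_all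
qed

lemma same_moments_orthogonal:
  assumes A: "A1 \<noteq> 0" "A2 \<noteq> 0"
    and conc1: "moments_concentrate \<omega> \<theta> D1 \<rho>1 p1 A1" and conc2: "moments_concentrate \<omega> \<theta> D2 \<rho>2 p2 A2"
    and same: "\<And>t. source_moment D1 \<rho>1 (t *\<^sub>R \<omega>) (sqrt (t\<^sup>2 + k\<^sup>2) *\<^sub>R \<theta>) = source_moment D2 \<rho>2 (t *\<^sub>R \<omega>) (sqrt (t\<^sup>2 + k\<^sup>2) *\<^sub>R \<theta>)"
  shows "(p1 - p2) \<bullet> \<omega> = 0" "(p1 - p2) \<bullet> \<theta> = 0"
proof -
  have "(\<lambda>n. exp (Complex (\<tau> n * ((p1 - p2) \<bullet> \<omega>)) (sqrt ((\<tau> n)\<^sup>2 + k\<^sup>2) * ((p1 - p2) \<bullet> \<theta>)))) \<longlonglongrightarrow> A2 / A1"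
    if \<tau>: "\<And>n. 0 < \<tau> n" "filterlim \<tau> at_top sequentially" for \<tau>
  proof -
    let ?a = "\<lambda>n. \<tau> n *\<^sub>R \<omega>" and ?b = "\<lambda>n. sqrt ((\<tau> n)\<^sup>2 + k\<^sup>2) *\<^sub>R \<theta>"
    let ?w = "\<lambda>n. plane_wave (?a n) (?b n)"
    let ?X1 = "\<lambda>n. of_real (\<tau> n ^ 3) * (?w n (- p1) * source_moment D1 \<rho>1 (?a n) (?b n))"
    let ?X2 = "\<lambda>n. of_real (\<tau> n ^ 3) * (?w n (- p2) * source_moment D2 \<rho>2 (?a n) (?b n))"
    have l1: "?X1 \<longlonglongrightarrow> A1" and l2: "?X2 \<longlonglongrightarrow> A2"
      using conc1[unfolded moments_concentrate_def, rule_format, OF \<tau> sqrt_ratio_tendsto_1[OF \<tau>, of k]]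
        conc2[unfolded moments_concentrate_def, rule_format, OF \<tau> sqrt_ratio_tendsto_1[OF \<tau>, of k]] .
    have lim: "(\<lambda>n. ?X2 n / ?X1 n) \<longlonglongrightarrow> A2 / A1" by (rule tendsto_divide[OF l2 l1 A(1)])
    have "\<forall>\<^sub>F n in sequentially. ?X1 n \<noteq> 0"
      using tendsto_imp_eventually_ne[OF l1 A(1)] .
    then have "\<forall>\<^sub>F n in sequentially. ?X2 n / ?X1 n = ?w n (p1 - p2)"
    proof eventually_elim
      case (elim n)
      have "?w n (- p2) = ?w n (p1 - p2) * ?w n (- p1)"
        using plane_wave_add[of _ _ "p1 - p2" "- p1"] by simp
      then have "?X2 n = ?w n (p1 - p2) * ?X1 n" unfolding same by simp
      then show ?case using elim by (simp only: nonzero_mult_div_cancel_right not_False_eq_True)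
    qed
    then have "(\<lambda>n. ?w n (p1 - p2)) \<longlonglongrightarrow> A2 / A1" by (rule Lim_transform_eventually[OF lim])
    then show ?thesis by (simp add: plane_wave_def)
  qed
  moreover have "A2 / A1 \<noteq> 0" using A by simp
  ultimately show "(p1 - p2) \<bullet> \<omega> = 0" "(p1 - p2) \<bullet> \<theta> = 0"
    by (intro bounded_phase_forces_orthogonality[of "A2 / A1" "(p1 - p2) \<bullet> \<omega>" k "(p1 - p2) \<bullet> \<theta>"]; blast)+
qed

theorem corollary1p1:
  fixes \<Omega> D\<^sub>1 D\<^sub>2 Q\<^sub>1 Q\<^sub>2 :: "(real^3) set"
    and k \<delta>\<^sub>1 \<delta>\<^sub>2 :: real
    and \<omega> \<theta> :: "real^3"
    and \<rho>\<^sub>1 \<rho>\<^sub>2 u\<^sub>1 u\<^sub>2 :: "real^3 \<Rightarrow> complex"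
    and \<gamma> :: "real^3 \<Rightarrow> complex"
    and \<Lambda> :: "(real^3 \<Rightarrow> complex) \<Rightarrow> complex"
  assumes "bounded_C2_domain \<Omega>" and "k \<ge> 0"
    and "\<omega> \<in> sphere 0 1" and "\<theta> \<in> orthogonal_circle \<omega>"
    and "source_problem \<Omega> k D\<^sub>1 \<rho>\<^sub>1 u\<^sub>1"
    and "regular_direction D\<^sub>1 \<omega>"
    and "conical_singularity D\<^sub>1 \<omega> \<delta>\<^sub>1 Q\<^sub>1"
    and "active_at \<rho>\<^sub>1 D\<^sub>1 (contact_point D\<^sub>1 \<omega>)"
    and "cone_const (contact_point D\<^sub>1 \<omega>) \<omega> \<delta>\<^sub>1 Q\<^sub>1 \<theta> \<noteq> 0"
    and "source_problem \<Omega> k D\<^sub>2 \<rho>\<^sub>2 u\<^sub>2"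
    and "regular_direction D\<^sub>2 \<omega>"
    and "conical_singularity D\<^sub>2 \<omega> \<delta>\<^sub>2 Q\<^sub>2"
    and "active_at \<rho>\<^sub>2 D\<^sub>2 (contact_point D\<^sub>2 \<omega>)"
    and "cone_const (contact_point D\<^sub>2 \<omega>) \<omega> \<delta>\<^sub>2 Q\<^sub>2 \<theta> \<noteq> 0"
    and "has_cauchy_data \<Omega> k (source_term \<rho>\<^sub>1 D\<^sub>1) u\<^sub>1 (\<gamma>, \<Lambda>)"
    and "has_cauchy_data \<Omega> k (source_term \<rho>\<^sub>2 D\<^sub>2) u\<^sub>2 (\<gamma>, \<Lambda>)"
  shows "contact_point D\<^sub>1 \<omega> = contact_point D\<^sub>2 \<omega>"
proof -
  note \<Omega> = assms(1) and \<omega> = assms(3) and \<theta> = assms(4)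
  let ?p1 = "contact_point D\<^sub>1 \<omega>" and ?p2 = "contact_point D\<^sub>2 \<omega>"
  have dom: "open \<Omega>" "bounded \<Omega>" using \<Omega> by (simp_all add: bounded_C2_domain_def)
  interpret trace_domain \<Omega>
    by (intro trace_domain.intro dom emeasure_hausdorff2_frontier_finite \<Omega>)
  note tip1 = source_moments_concentrate(1)[OF \<omega> dom(2) assms(5-8)]
    and tip2 = source_moments_concentrate(1)[OF \<omega> dom(2) assms(10-13)]
  let ?L1 = "conical_tip.cone_transform \<omega> ?p1 \<delta>\<^sub>1 Q\<^sub>1" and ?L2 = "conical_tip.cone_transform \<omega> ?p2 \<delta>\<^sub>2 Q\<^sub>2"
  obtain c1 where c1: "c1 \<noteq> 0" and conc1: "\<forall>\<theta>\<in>orthogonal_circle \<omega>. moments_concentrate \<omega> \<theta> D\<^sub>1 \<rho>\<^sub>1 ?p1 (c1 * ?L1 \<theta>)"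
    using source_moments_concentrate(2)[OF \<omega> dom(2) assms(5-8)] by (elim exE conjE)
  obtain c2 where c2: "c2 \<noteq> 0" and conc2: "\<forall>\<theta>\<in>orthogonal_circle \<omega>. moments_concentrate \<omega> \<theta> D\<^sub>2 \<rho>\<^sub>2 ?p2 (c2 * ?L2 \<theta>)"
    using source_moments_concentrate(2)[OF \<omega> dom(2) assms(10-13)] by (elim exE conjE)
  have D1: "open D\<^sub>1" "closure D\<^sub>1 \<subseteq> \<Omega>" "L2 (lebesgue_on D\<^sub>1) \<rho>\<^sub>1"
    and D2: "open D\<^sub>2" "closure D\<^sub>2 \<subseteq> \<Omega>" "L2 (lebesgue_on D\<^sub>2) \<rho>\<^sub>2"
    using assms(5,10) by (simp_all add: source_problem_def)
  have orth: "(?p1 - ?p2) \<bullet> \<omega> = 0 \<and> (?p1 - ?p2) \<bullet> \<theta>' = 0"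
    if \<theta>': "\<theta>' \<in> orthogonal_circle \<omega>" and nz: "?L1 \<theta>' \<noteq> 0" "?L2 \<theta>' \<noteq> 0" for \<theta>'
  proof -
    have moments: "source_moment D\<^sub>1 \<rho>\<^sub>1 (t *\<^sub>R \<omega>) (sqrt (t\<^sup>2 + k\<^sup>2) *\<^sub>R \<theta>') = source_moment D\<^sub>2 \<rho>\<^sub>2 (t *\<^sub>R \<omega>) (sqrt (t\<^sup>2 + k\<^sup>2) *\<^sub>R \<theta>')" for t
    proof -
      let ?v = "plane_wave (t *\<^sub>R \<omega>) (sqrt (t\<^sup>2 + k\<^sup>2) *\<^sub>R \<theta>')"
      have un: "\<omega> \<bullet> \<omega> = 1" "\<theta>' \<bullet> \<theta>' = 1" "\<omega> \<bullet> \<theta>' = 0"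
        using \<omega> \<theta>' by (auto simp: orthogonal_circle_def norm_eq_1)
      have "(\<Sum>i\<in>UNIV. partial_deriv i (partial_deriv i ?v) x) = - (complex_of_real k)\<^sup>2 * ?v x" for x
        by (subst plane_wave_helmholtz) (simp_all add: un power2_eq_square[symmetric])
      then have "(LINT x|lebesgue_on \<Omega>. source_term \<rho>\<^sub>1 D\<^sub>1 x * ?v x) = (LINT x|lebesgue_on \<Omega>. source_term \<rho>\<^sub>2 D\<^sub>2 x * ?v x)"
        by (intro source_moments_eq[OF assms(15,16)] source_term_L2 D1 D2 borel_dom smooth_plane_wave)
      then show ?thesis
        by (simp only: source_term_moment[OF D1(1,2) borel_dom] source_term_moment[OF D2(1,2) borel_dom])
    qed
    have A: "c1 * ?L1 \<theta>' \<noteq> 0" "c2 * ?L2 \<theta>' \<noteq> 0" using c1 c2 nz by simp_all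
    show ?thesis
      using same_moments_orthogonal[OF A conc1[rule_format, OF \<theta>'] conc2[rule_format, OF \<theta>'] moments]
      by (rule conjI)
  qed
  have L\<theta>: "?L1 \<theta> \<noteq> 0" "?L2 \<theta> \<noteq> 0"
    using assms(9,14) conical_tip.cone_transform_eq_cone_const[OF tip1 \<theta>] conical_tip.cone_transform_eq_cone_const[OF tip2 \<theta>]
    by simp_all
  define e where "e = cross3 \<omega> \<theta>"
  have fr: "unit_frame (- \<omega>) \<theta> e" unfolding e_def by (rule conical_tip.unit_frame_tangent[OF tip1 \<theta>])
  \<comment> \<open>Directions of the circle that approach \<open>\<theta>\<close> but have a positive component along \<open>e\<close>.\<close>
  define \<theta>s where "\<theta>s n = cos (1 / real (Suc n)) *\<^sub>R \<theta> + sin (1 / real (Suc n)) *\<^sub>R e" for n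
  have circ: "\<theta>s n \<in> orthogonal_circle \<omega>" for n
  proof -
    have "\<theta>s n \<bullet> \<theta>s n = (cos (1 / real (Suc n)))\<^sup>2 + (sin (1 / real (Suc n)))\<^sup>2"
      using fr by (simp add: \<theta>s_def unit_frame_def inner_add_left inner_add_right inner_commute[of e \<theta>] power2_eq_square)
    moreover have "\<omega> \<bullet> \<theta>s n = 0" using fr by (simp add: \<theta>s_def unit_frame_def inner_add_right)
    ultimately show ?thesis by (simp add: orthogonal_circle_def norm_eq_1)
  qed
  have "(\<lambda>n. 1 / real (Suc n)) \<longlonglongrightarrow> 0" using LIMSEQ_inverse_real_of_nat by (simp only: inverse_eq_divide)
  then have "\<theta>s \<longlonglongrightarrow> cos 0 *\<^sub>R \<theta> + sin 0 *\<^sub>R e" unfolding \<theta>s_def by (intro tendsto_intros)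
  then have lims: "\<theta>s \<longlonglongrightarrow> \<theta>" by simp
  have "\<forall>\<^sub>F n in sequentially. ?L1 (\<theta>s n) \<noteq> 0 \<and> ?L2 (\<theta>s n) \<noteq> 0"
    using tendsto_imp_eventually_ne[OF conical_tip.cone_transform_continuous[OF tip1 \<theta> lims] L\<theta>(1)]
      tendsto_imp_eventually_ne[OF conical_tip.cone_transform_continuous[OF tip2 \<theta> lims] L\<theta>(2)]
    by (rule eventually_conj)
  then obtain n where n: "?L1 (\<theta>s n) \<noteq> 0" "?L2 (\<theta>s n) \<noteq> 0"
    unfolding eventually_sequentially by blast
  have o1: "(?p1 - ?p2) \<bullet> \<omega> = 0" "(?p1 - ?p2) \<bullet> \<theta> = 0" using orth[OF \<theta> L\<theta>] by auto
  have "(?p1 - ?p2) \<bullet> \<theta>s n = 0" using orth[OF circ n] by simp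
  then have "sin (1 / real (Suc n)) * ((?p1 - ?p2) \<bullet> e) = 0"
    unfolding \<theta>s_def inner_add_right inner_scaleR_right o1(2) by simp
  moreover have "0 < sin (1 / real (Suc n))"
    by (rule sin_gt_zero) (use pi_gt3 in \<open>auto intro: le_less_trans[of _ 1]\<close>)
  ultimately have "(?p1 - ?p2) \<bullet> e = 0" by simp
  then have "?p1 - ?p2 = 0" using unit_frame_expansion[OF fr, of "?p1 - ?p2"] o1 by simp
  then show ?thesis by simp
qed

end
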